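(* Let $q \ge 2$ be a prime power, let $\mathbb{F}_q$ be the finite field with $q$ elements, and let $\mathcal{C} \subset \mathbb{P}^2$ be the Dickson--Guralnick--Zieve curve, considered over the algebraic closure $\overline{\mathbb{F}}_q$. Let $\Delta(\mathcal{C}) \subset \mathbb{P}^2 = \mathbb{P}^2(\overline{\mathbb{F}}_q)$ be the set of all Galois points for $\mathcal{C}$. Then $$\Delta(\mathcal{C}) = \mathbb{P}^2(\mathbb{F}_q).$$ In particular, the number of Galois points for $\mathcal{C}$ is exactly $q^2+q+1$.
   Context: The Dickson--Guralnick--Zieve curve over $\mathbb{F}_q$ is the projective plane curve $\mathcal{C} \subset \mathbb{P}^2$ with homogeneous coordinates $(x:y:z)$ defined by $F(x,y,z)=0$, where $F(x,y,z) = D_1(x,y,z)/D_2(x,y,z)$ with $$D_1=\left|\begin{array}{ccc} x & x^q & x^{q^3} \\ y & y^q & y^{q^3} \\ z & z^q & z^{q^3} \end{array}\right|, \qquad D_2=\left|\begin{array}{ccc} x & x^q & x^{q^2} \\ y & y^q & y^{q^2} \\ z & z^q & z^{q^2} \end{array}\right|.$$ It is known that $F$ is a homogeneous polynomial of degree $q^3-q^2$ with coefficients in $\mathbb{F}_q$ and that $F$ is irreducible over $\overline{\mathbb{F}}_q$; thus $\mathcal{C}$ is an irreducible plane curve over $k := \overline{\mathbb{F}}_q$ with function field $k(\mathcal{C})$. Galois point: for an irreducible plane curve $\mathcal{C} \subset \mathbb{P}^2$ over an algebraically closed field $k$ and a point $P \in \mathbb{P}^2(k)$ (on or off $\mathcal{C}$,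 and possibly a singular point of $\mathcal{C}$), let $\pi_P : \mathcal{C} \dashrightarrow \mathbb{P}^1$ be the projection from $P$, i.e. the rational map sending $Q \neq P$ to the line $\overline{PQ}$, where the lines through $P$ are parametrized by $\mathbb{P}^1$. The point $P$ is called a Galois point for $\mathcal{C}$ if the induced extension of function fields $k(\mathcal{C})/\pi_P^*k(\mathbb{P}^1)$ is a Galois extension. $\Delta(\mathcal{C})$ denotes the set of all Galois points $P \in \mathbb{P}^2(k)$ for $\mathcal{C}$. $\mathbb{P}^2(\mathbb{F}_q)$ denotes the set of $\mathbb{F}_q$-rational points of $\mathbb{P}^2$. *)

theory Defs
  imports
    "HOL-Analysis.Determinants"
    "HOL-Algebra.Algebraic_Closure_Type"
    "HOL-Algebra.Generated_Fields"
    "HOL-Algebra.Finite_Extensions"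
    "HOL-Computational_Algebra.Fraction_Field"
begin

section \<open>Ternary forms\<close>

text \<open>
  The ring \<open>k[x,y,z]\<close> is represented as \<open>((k[x])[y])[z]\<close>, so the coefficient of
  \<open>x^i y^j z^l\<close> in \<open>p\<close> is \<^term>\<open>coeff (coeff (coeff p l) j) i\<close>.
\<close>

type_synonym 'k poly3 = "'k poly poly poly"

definition const3 :: "'k::field \<Rightarrow> 'k poly3"
  where "const3 c = [:[:[:c:]:]:]"

definition var_x :: "'k::field poly3"
  where "var_x = [:[:[:0, 1:]:]:]"

definition var_y :: "'k::field poly3"
  where "var_y = [:[:0, 1:]:]"

definition var_z :: "'k::field poly3"
  where "var_z = [:0, 1:]"

definition eval3 :: "'k::field poly3 \<Rightarrow> 'k ^ 3 \<Rightarrow> 'k"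
  where "eval3 p v = poly (poly (poly p [:[:v $ 3:]:]) [:v $ 2:]) (v $ 1)"

text \<open>The zero polynomial counts as homogeneous of every degree.\<close>

definition homogeneous3 :: "nat \<Rightarrow> 'k::field poly3 \<Rightarrow> bool"
  where "homogeneous3 d p \<longleftrightarrow>
    (\<forall>i j l. coeff (coeff (coeff p l) j) i \<noteq> 0 \<longrightarrow> i + j + l = d)"


section \<open>The projective plane\<close>

text \<open>A point of \<open>\<P>\<^sup>2(k)\<close> is the set of all its homogeneous coordinate vectors.\<close>

definition proj_point :: "'k::field ^ 3 \<Rightarrow> ('k ^ 3) set"
  where "proj_point v = {c *s v |c. c \<noteq> 0}"

definition proj_plane :: "('k::field ^ 3) set set"
  where "proj_plane = {proj_point v |v. v \<noteq> 0}"

text \<open>The points of \<open>\<P>\<^sup>2\<close> over the algebraic closure of \<open>'a\<close> that are rational over \<open>'a\<close>.\<close>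

definition rational_points :: "('a::field alg_closure ^ 3) set set"
  where "rational_points = {proj_point (\<chi> i. to_ac (a $ i)) |a :: 'a ^ 3. a \<noteq> 0}"


section \<open>The function field of a plane curve\<close>

text \<open>
  Throughout, \<open>F\<close> is meant to be an irreducible form, and \<open>\<C>\<close> is the curve \<open>F = 0\<close>.
  The rational functions on \<open>\<P>\<^sup>2\<close> (quotients of forms of equal degree) whose denominator does
  not vanish identically on \<open>\<C>\<close> form a local ring; its maximal ideal consists of those that
  vanish identically on \<open>\<C>\<close>, and its residue field is \<open>k(\<C>)\<close>.
\<close>

definition local_ring_of_curve :: "'k::field poly3 \<Rightarrow> 'k poly3 fract ring"
  where "local_ring_of_curve F = ring_of_type_algebra
    \<lparr>carrier := {Fract a b |a b d. homogeneous3 d a \<and> homogeneous3 d b \<and> \<not> F dvd b}\<rparr>"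

definition ideal_of_curve :: "'k::field poly3 \<Rightarrow> 'k poly3 fract set"
  where "ideal_of_curve F =
    {Fract a b |a b d. homogeneous3 d a \<and> homogeneous3 d b \<and> F dvd a \<and> \<not> F dvd b}"

definition function_field :: "'k::field poly3 \<Rightarrow> 'k poly3 fract set ring"
  where "function_field F = local_ring_of_curve F Quot ideal_of_curve F"

definition restrict_to_curve :: "'k::field poly3 \<Rightarrow> 'k poly3 fract \<Rightarrow> 'k poly3 fract set"
  where "restrict_to_curve F r = ideal_of_curve F +>\<^bsub>local_ring_of_curve F\<^esub> r"


section \<open>Galois points\<close>

text \<open>
  An extension \<open>R/K\<close> is Galois if it is algebraic and \<open>K\<close> is the fixed field of the group of
  automorphisms of \<open>R\<close> over \<open>K\<close>.
\<close>

definition (in ring) galois_over :: "'a set \<Rightarrow> bool"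
  where "galois_over K \<longleftrightarrow>
    field R \<and> subfield K R \<and>
    (\<forall>x\<in>carrier R. (algebraic over K) x) \<and>
    {x \<in> carrier R. \<forall>\<sigma>\<in>ring_iso R R. (\<forall>a\<in>K. \<sigma> a = a) \<longrightarrow> \<sigma> x = x} = K"

definition linear_forms_through :: "('k::field ^ 3) set \<Rightarrow> 'k poly3 set"
  where "linear_forms_through P = {l. homogeneous3 1 l \<and> (\<forall>v\<in>P. eval3 l v = 0)}"

text \<open>
  If \<open>l, m\<close> is a basis of the linear forms vanishing at \<open>P\<close>, then the lines through \<open>P\<close> are
  parametrized by \<open>\<P>\<^sup>1\<close> so that the projection from \<open>P\<close> is \<open>Q \<mapsto> (l(Q) : m(Q))\<close>.  Hence the
  pullback of \<open>k(\<P>\<^sup>1)\<close> is the subfield of \<open>k(\<C>)\<close> generated over \<open>k\<close> by \<open>l/m\<close>; allowing all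
  pairs of linear forms through \<open>P\<close> avoids the choice of a basis and gives the same subfield.
\<close>

definition projection_subfield ::
    "'k::field poly3 \<Rightarrow> ('k ^ 3) set \<Rightarrow> 'k poly3 fract set set"
  where "projection_subfield F P = generate_field (function_field F)
    ({restrict_to_curve F (Fract (const3 c) 1) |c. True} \<union>
     {restrict_to_curve F (Fract l m) |l m.
        l \<in> linear_forms_through P \<and> m \<in> linear_forms_through P \<and> \<not> F dvd m})"

definition galois_points :: "'k::field poly3 \<Rightarrow> ('k ^ 3) set set"
  where "galois_points F =
    {P \<in> proj_plane. ring.galois_over (function_field F) (projection_subfield F P)}"


section \<open>The Dickson--Guralnick--Zieve curve\<close>

definition DGZ_numerator :: "nat \<Rightarrow> 'k::field poly3"
  where "DGZ_numerator q = det (vector [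
    vector [var_x, var_x ^ q, var_x ^ q ^ 3],
    vector [var_y, var_y ^ q, var_y ^ q ^ 3],
    vector [var_z, var_z ^ q, var_z ^ q ^ 3]] :: 'k poly3 ^ 3 ^ 3)"

definition DGZ_denominator :: "nat \<Rightarrow> 'k::field poly3"
  where "DGZ_denominator q = det (vector [
    vector [var_x, var_x ^ q, var_x ^ q ^ 2],
    vector [var_y, var_y ^ q, var_y ^ q ^ 2],
    vector [var_z, var_z ^ q, var_z ^ q ^ 2]] :: 'k poly3 ^ 3 ^ 3)"

text \<open>The denominator divides the numerator, so this is the exact quotient.\<close>

definition DGZ_form :: "nat \<Rightarrow> 'k::field poly3"
  where "DGZ_form q = DGZ_numerator q div DGZ_denominator q"

end

theory Submission
  imports Defs
begin

text \<open>
  The linear forms in \<open>x\<close>, \<open>y\<close> over the finite field are the roots of the polynomial \<open>V\<close> with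
  \<open>D\<^sub>2 = (x y^q - x^q y) V(z)\<close>, and \<open>F = V^(q - 1) + e^q\<close> with \<open>e\<close> a Dickson invariant of \<open>x\<close>, \<open>y\<close>. Hence the
  roots of \<open>F(t, 1, Z)\<close> in \<open>Z\<close> form one orbit of the group of affine maps \<open>Z \<mapsto> c Z + a t + b\<close> over the
  finite field. These maps show that the projection from \<open>(0 : 0 : 1)\<close> is Galois, and so is the projection
  from any rational point, because the curve is invariant under \<open>PGL(3, q)\<close>.

  In a Galois extension, all places over a given one have the same ramification index. For a point that
  is not rational there is a line through it that meets the curve in an unramified and in a ramified
  place: a tangent line at some point \<open>Q\<close>, which passes through the Frobenius conjugate of \<open>Q\<close>, or a line
  defined over the finite field, if the point lies on such a line and has coordinates of degree two.
  Tangent lines are found on the dual curve, given by the determinant of \<open>l\<close>, \<open>l^(q^2)\<close>, \<open>l^(q^3)\<close>; the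
  places are given by power series solutions of the equation of the curve.
\<close>

text \<open>The function field is a quotient of a local ring of fractions, in which little can be
  computed directly, and irreducibility of \<open>F\<close> has to be proved along the way. Both
  difficulties are met by nonconstant points of the curve with coordinates in an extension of k.
  Once a root of \<open>F(t, 1, Z)\<close> is known to have full degree \<open>q^2 (q - 1)\<close>
  over k(t), every such point is generic: a form vanishes there only if \<open>F\<close> divides it,
  so evaluation embeds the function field. Points over the algebraic closure of k(t) supply the
  automorphisms, points over Laurent series the places; ramification indices are compared only
  through the integrality of orbit polynomials. The tangent lines have a simple description because
  q-th powers have derivative zero: the gradient of the numerator \<open>D1\<close> at
  \<open>Q\<close> is the cross product of \<open>Q^q\<close> and \<open>Q^(q^3)\<close>, so the
  tangent contains \<open>Q\<close>, \<open>Q^q\<close> and \<open>Q^(q^3)\<close>. This needs the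
  denominator \<open>D2\<close> to be nonzero at \<open>Q\<close>, that is, \<open>Q\<close> on no
  line over the finite field. At points of degree two on such lines the branches of the curve are
  computed from the equation \<open>V^(q-1) + e^q = 0\<close>.\<close>

no_notation fps_nth (infixl \<open>$\<close> 75)

section \<open>Evaluation of ternary polynomials\<close>

text \<open>Its instances are embeddings of constants, evaluations and Frobenius powers. Each
  polynomial identity between the Dickson forms can thus be proved in one ring and carried to all
  others by the same rewrite rules.\<close>

locale type_hom =
  fixes h :: "'b::comm_ring_1 \<Rightarrow> 'c::comm_ring_1"
  assumes hom_1 [simp]: "h 1 = 1"
    and hom_add [simp]: "h (x + y) = h x + h y"
    and hom_mult [simp]: "h (x * y) = h x * h y"
begin

lemma hom_0 [simp]: "h 0 = 0"
proof -
  have "h 0 + h 0 = h 0 + 0"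
    by (metis hom_add add_0_right)
  then show ?thesis by (rule add_left_imp_eq)
qed

lemma hom_uminus [simp]: "h (- x) = - h x"
proof -
  have "h x + h (- x) = 0"
    by (metis hom_add add.right_inverse hom_0)
  then show ?thesis by (simp add: eq_neg_iff_add_eq_0 add.commute)
qed

lemma hom_diff [simp]: "h (x - y) = h x - h y"
  using hom_add[of x "- y"] by simp

lemma hom_power [simp]: "h (x ^ n) = h x ^ n"
  by (induction n) auto

lemma hom_sum: "h (sum f A) = (\<Sum>a\<in>A. h (f a))"
  by (induction A rule: infinite_finite_induct) auto

lemma hom_of_nat [simp]: "h (of_nat n) = of_nat n"
  by (induction n) auto

end

lemma type_hom_id: "type_hom (\<lambda>x. x)"
  by unfold_locales auto

lemma type_hom_to_ac: "type_hom to_ac"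
  by unfold_locales auto

lemma type_hom_const_poly: "type_hom (\<lambda>c. [:c:])"
  by unfold_locales (auto simp: one_pCons)

lemma type_hom_const3: "type_hom const3"
  by unfold_locales (auto simp: const3_def one_pCons)

lemma type_hom_comp:
  assumes "type_hom f" "type_hom g"
  shows "type_hom (\<lambda>x. f (g x))"
proof -
  interpret f: type_hom f by fact
  interpret g: type_hom g by fact
  show ?thesis by unfold_locales auto
qed

text \<open>Evaluation over an extension: the coefficients are moved by \<open>h\<close> before the
  variable is replaced, so that forms over k can be evaluated at points with coordinates in any
  k-algebra.\<close>

definition ev1 :: "('b::comm_ring_1 \<Rightarrow> 'c::comm_ring_1) \<Rightarrow> 'c \<Rightarrow> 'b poly \<Rightarrow> 'c"
  where "ev1 h x p = poly (map_poly h p) x"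

context type_hom
begin

lemma ev1_0 [simp]: "ev1 h x 0 = 0"
  by (simp add: ev1_def)

lemma ev1_pCons [simp]: "ev1 h x (pCons a p) = h a + x * ev1 h x p"
  by (simp add: ev1_def map_poly_pCons)

lemma ev1_add: "ev1 h x (p + r) = ev1 h x p + ev1 h x r"
  by (induction p r rule: poly_induct2) (auto simp: algebra_simps)

lemma ev1_smult: "ev1 h x (smult c p) = h c * ev1 h x p"
  by (induction p) (auto simp: algebra_simps)

lemma ev1_mult: "ev1 h x (p * r) = ev1 h x p * ev1 h x r"
  by (induction p) (auto simp: ev1_add ev1_smult algebra_simps)

lemma type_hom_ev1: "type_hom (ev1 h x)"
  by unfold_locales (auto simp: ev1_add ev1_mult one_pCons)

lemma ev1_altdef:
  assumes "degree p \<le> n"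
  shows "ev1 h x p = (\<Sum>i\<le>n. h (coeff p i) * x ^ i)"
proof -
  have "ev1 h x p = poly (map_poly h p) x" by (simp add: ev1_def)
  also have "\<dots> = (\<Sum>i\<le>degree (map_poly h p). h (coeff p i) * x ^ i)"
    by (simp add: poly_altdef coeff_map_poly)
  also have "\<dots> = (\<Sum>i\<le>n. h (coeff p i) * x ^ i)"
  proof (rule sum.mono_neutral_left)
    show "{..degree (map_poly h p)} \<subseteq> {..n}"
      using assms map_poly_degree_leq[of h p] by auto
    show "\<forall>i\<in>{..n} - {..degree (map_poly h p)}. h (coeff p i) * x ^ i = 0"
    proof
      fix i assume "i \<in> {..n} - {..degree (map_poly h p)}"
      then have "coeff (map_poly h p) i = 0" by (intro coeff_eq_0) auto
      then show "h (coeff p i) * x ^ i = 0" by (simp add: coeff_map_poly)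
    qed
  qed auto
  finally show ?thesis .
qed

end

lemma ev1_comp:
  assumes "type_hom g" "type_hom h"
  shows "g (ev1 h x p) = ev1 (\<lambda>a. g (h a)) (g x) p"
proof -
  note gh = type_hom_comp[OF assms]
  show ?thesis
    by (induction p)
      (simp_all only: type_hom.ev1_0[OF gh] type_hom.ev1_0[OF assms(2)] type_hom.hom_0[OF assms(1)]
        type_hom.ev1_pCons[OF gh] type_hom.ev1_pCons[OF assms(2)] type_hom.hom_add[OF assms(1)]
        type_hom.hom_mult[OF assms(1)])
qed

definition ev3 :: "('b::comm_ring_1 \<Rightarrow> 'c::comm_ring_1) \<Rightarrow> 'c ^ 3 \<Rightarrow> 'b poly poly poly \<Rightarrow> 'c"
  where "ev3 h U p = ev1 (ev1 (ev1 h (U $ 1)) (U $ 2)) (U $ 3) p"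

lemma type_hom_ev3: "type_hom h \<Longrightarrow> type_hom (ev3 h U)"
  unfolding ev3_def by (intro type_hom.type_hom_ev1)

lemma ev3_comp:
  assumes "type_hom g" "type_hom h"
  shows "g (ev3 h U p) = ev3 (\<lambda>a. g (h a)) (\<chi> i. g (U $ i)) p"
  unfolding ev3_def
  by (simp add: ev1_comp[OF assms(1)] type_hom.type_hom_ev1 assms ev1_comp[OF assms])

lemma ev3_const3: "type_hom h \<Longrightarrow> ev3 h U (const3 c) = h c"
  using type_hom.type_hom_ev1[of h]
  by (simp add: ev3_def const3_def type_hom.ev1_pCons type_hom.ev1_0 type_hom.type_hom_ev1)

lemma ev3_var:
  assumes "type_hom h"
  shows "ev3 h U var_x = U $ 1" "ev3 h U var_y = U $ 2" "ev3 h U var_z = U $ 3"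
  using type_hom.type_hom_ev1[of h] assms
  by (auto simp add: ev3_def var_x_def var_y_def var_z_def type_hom.ev1_pCons type_hom.ev1_0
        type_hom.type_hom_ev1 type_hom.hom_0 type_hom.hom_1 type_hom.hom_add type_hom.hom_mult one_pCons)

text \<open>One bound \<open>n\<close> for all three exponents, independent of the point, turns
  evaluation into a finite sum of monomials, on which homogeneity can be used term by term.\<close>

lemma ev3_altdef:
  assumes h: "type_hom h"
  shows "\<exists>n. \<forall>U. ev3 h U p = (\<Sum>l\<le>n. \<Sum>j\<le>n. \<Sum>i\<le>n. h (coeff (coeff (coeff p l) j) i) * U$1 ^ i * U$2 ^ j * U$3 ^ l)"
proof -
  define n1 where "n1 = degree p"
  define n2 where "n2 = Max ((\<lambda>l. degree (coeff p l)) ` {..n1})"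
  define n3 where "n3 = Max ((\<lambda>(l,j). degree (coeff (coeff p l) j)) ` ({..n1} \<times> {..n2}))"
  define n where "n = max n1 (max n2 n3)"
  have d2: "degree (coeff p l) \<le> n2" if "l \<le> n1" for l
    unfolding n2_def using that by (intro Max_ge) auto
  have d3: "degree (coeff (coeff p l) j) \<le> n3" if "l \<le> n1" "j \<le> n2" for l j
    unfolding n3_def using that by (intro Max_ge) force+
  have d2': "degree (coeff p l) \<le> n" for l
    using d2[of l] by (cases "l \<le> n1") (auto simp: n_def n1_def coeff_eq_0)
  have d3': "degree (coeff (coeff p l) j) \<le> n" for l j
  proof (cases "l \<le> n1 \<and> j \<le> n2")
    case True then show ?thesis using d3[of l j] by (auto simp: n_def)
  next
    case False
    then have "coeff (coeff p l) j = 0"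
      by (metis coeff_0 coeff_eq_0 d2 le_less_linear n1_def order.strict_trans1)
    then show ?thesis by simp
  qed
  have d1': "degree p \<le> n" by (simp add: n_def n1_def)
  have h1: "type_hom (ev1 h x)" for x by (rule type_hom.type_hom_ev1[OF h])
  have h2: "type_hom (ev1 (ev1 h x) y)" for x y by (rule type_hom.type_hom_ev1[OF h1])
  have "ev3 h U p = (\<Sum>l\<le>n. \<Sum>j\<le>n. \<Sum>i\<le>n. h (coeff (coeff (coeff p l) j) i) * U$1 ^ i * U$2 ^ j * U$3 ^ l)" for U
    unfolding ev3_def
    by (simp add: type_hom.ev1_altdef[OF h2 d1'] type_hom.ev1_altdef[OF h1 d2']
        type_hom.ev1_altdef[OF h d3'] sum_distrib_right sum_distrib_left)
  then show ?thesis by blast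
qed

lemma eval3_eq_ev3: "eval3 p v = ev3 (\<lambda>c. c) v p"
proof -
  note i = type_hom_id
  have 1: "ev1 (\<lambda>c. c) (v$1) = (\<lambda>p1. poly p1 (v$1))"
  proof
    show "ev1 (\<lambda>c. c) (v$1) p1 = poly p1 (v$1)" for p1
      by (induction p1) (auto simp: type_hom.ev1_0[OF i] type_hom.ev1_pCons[OF i])
  qed
  note i1 = type_hom.type_hom_ev1[OF i, of "v$1", unfolded 1]
  have 2: "ev1 (\<lambda>p1. poly p1 (v$1)) (v$2) = (\<lambda>p2. poly (poly p2 [:v$2:]) (v$1))"
  proof
    show "ev1 (\<lambda>p1. poly p1 (v$1)) (v$2) p2 = poly (poly p2 [:v$2:]) (v$1)" for p2
      by (induction p2) (auto simp: type_hom.ev1_0[OF i1] type_hom.ev1_pCons[OF i1])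
  qed
  note i2 = type_hom.type_hom_ev1[OF i1, of "v$2", unfolded 2]
  have 3: "ev1 (\<lambda>p2. poly (poly p2 [:v$2:]) (v$1)) (v$3) p = poly (poly (poly p [:[:v$3:]:]) [:v$2:]) (v$1)"
    by (induction p) (auto simp: type_hom.ev1_0[OF i2] type_hom.ev1_pCons[OF i2])
  show ?thesis unfolding ev3_def 1 2 3 eval3_def ..
qed

section \<open>Forms\<close>

lemma homogeneous3_0 [simp]: "homogeneous3 d 0"
  by (simp add: homogeneous3_def)

lemma homogeneous3_const3 [simp]: "homogeneous3 0 (const3 c)"
  by (auto simp: homogeneous3_def const3_def coeff_pCons split: nat.splits)

lemma homogeneous3_1 [simp]: "homogeneous3 0 1"
  using homogeneous3_const3[of 1] by (simp add: const3_def one_pCons)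

lemma homogeneous3_var [simp]:
  "homogeneous3 (Suc 0) var_x" "homogeneous3 (Suc 0) var_y" "homogeneous3 (Suc 0) var_z"
  by (auto simp: homogeneous3_def var_x_def var_y_def var_z_def coeff_pCons one_pCons split: nat.splits)

lemma homogeneous3_add [intro]:
  "homogeneous3 d a \<Longrightarrow> homogeneous3 d b \<Longrightarrow> homogeneous3 d (a + b)"
  unfolding homogeneous3_def by (metis add.right_neutral coeff_add)

lemma homogeneous3_uminus [intro]: "homogeneous3 d a \<Longrightarrow> homogeneous3 d (- a)"
  unfolding homogeneous3_def by simp

lemma homogeneous3_sum [intro]:
  "(\<And>i. i \<in> A \<Longrightarrow> homogeneous3 d (f i)) \<Longrightarrow> homogeneous3 d (sum f A)"
  by (induction A rule: infinite_finite_induct) auto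

lemma homogeneous3_mult [intro]:
  assumes "homogeneous3 d a" "homogeneous3 e b"
  shows "homogeneous3 (d + e) (a * b)"
  unfolding homogeneous3_def
proof (intro allI impI)
  fix i j l assume "coeff (coeff (coeff (a * b) l) j) i \<noteq> 0"
  then have "(\<Sum>l'\<le>l. \<Sum>j'\<le>j. \<Sum>i'\<le>i. coeff (coeff (coeff a l') j') i' *
      coeff (coeff (coeff b (l - l')) (j - j')) (i - i')) \<noteq> 0"
    by (simp add: coeff_mult coeff_sum)
  then obtain l' j' i' where "l' \<le> l" "j' \<le> j" "i' \<le> i"
    "coeff (coeff (coeff a l') j') i' * coeff (coeff (coeff b (l - l')) (j - j')) (i - i') \<noteq> 0"
    by (meson atMost_iff sum.not_neutral_contains_not_neutral)
  then show "i + j + l = d + e"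
    using assms unfolding homogeneous3_def by (metis (no_types, lifting) add.assoc add.left_commute
        le_add_diff_inverse mult_eq_0_iff)
qed

lemma homogeneous3_power [intro]: "homogeneous3 d a \<Longrightarrow> homogeneous3 (d * n) (a ^ n)"
  by (induction n) (auto intro: homogeneous3_mult)

lemma ev3_scale:
  assumes h: "type_hom h" and "homogeneous3 d p"
  shows "ev3 h (c *s U) p = c ^ d * ev3 h U p"
proof -
  obtain n where n: "\<And>U. ev3 h U p = (\<Sum>l\<le>n. \<Sum>j\<le>n. \<Sum>i\<le>n. h (coeff (coeff (coeff p l) j) i) * U$1 ^ i * U$2 ^ j * U$3 ^ l)"
    using ev3_altdef[OF h] by blast
  have "h (coeff (coeff (coeff p l) j) i) * (c * U$1) ^ i * (c * U$2) ^ j * (c * U$3) ^ l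
     = c ^ d * (h (coeff (coeff (coeff p l) j) i) * U$1 ^ i * U$2 ^ j * U$3 ^ l)" for l j i
  proof (cases "coeff (coeff (coeff p l) j) i = 0")
    case True then show ?thesis using type_hom.hom_0[OF h] by simp
  next
    case False
    then have "d = i + j + l" using assms(2) unfolding homogeneous3_def by metis
    then show ?thesis by (simp add: power_mult_distrib power_add mult_ac)
  qed
  then show ?thesis by (simp add: n sum_distrib_left vector_scalar_mult_def)
qed

lemma homogeneous3_ev3:
  assumes "homogeneous3 d p" "\<And>i. homogeneous3 (Suc 0) (U $ i)"
  shows "homogeneous3 d (ev3 const3 U p)"
proof -
  obtain n where n: "\<And>U. ev3 const3 U p = (\<Sum>l\<le>n. \<Sum>j\<le>n. \<Sum>i\<le>n. const3 (coeff (coeff (coeff p l) j) i) * U$1 ^ i * U$2 ^ j * U$3 ^ l)"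
    using ev3_altdef[OF type_hom_const3] by blast
  have "homogeneous3 d (const3 (coeff (coeff (coeff p l) j) i) * U$1 ^ i * U$2 ^ j * U$3 ^ l)" for l j i
  proof (cases "coeff (coeff (coeff p l) j) i = 0")
    case True then show ?thesis by (simp add: const3_def)
  next
    case False
    then have d: "d = 0 + Suc 0 * i + Suc 0 * j + Suc 0 * l" using assms(1) unfolding homogeneous3_def by simp
    show ?thesis unfolding d
      by (intro homogeneous3_mult homogeneous3_power assms(2) homogeneous3_const3)
  qed
  then show ?thesis unfolding n by (intro homogeneous3_sum)
qed

definition linear_form :: "'k::field ^ 3 \<Rightarrow> 'k poly3"
  where "linear_form a = const3 (a$1) * var_x + const3 (a$2) * var_y + const3 (a$3) * var_z"

lemma homogeneous3_linear_form: "homogeneous3 (Suc 0) (linear_form a)"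
  unfolding linear_form_def
  by (intro homogeneous3_add homogeneous3_mult[of 0 _ "Suc 0", simplified]) auto

lemma ev3_linear_form:
  assumes "type_hom h"
  shows "ev3 h U (linear_form a) = h (a$1) * U$1 + h (a$2) * U$2 + h (a$3) * U$3"
  using type_hom_ev3[OF assms, of U]
  by (simp add: linear_form_def type_hom.hom_add type_hom.hom_mult ev3_const3[OF assms] ev3_var[OF assms])

lemma homogeneous3_1_cases:
  assumes "homogeneous3 (Suc 0) p"
  obtains a where "p = linear_form a"
proof
  define a where "a = (vector [coeff (coeff (coeff p 0) 0) 1, coeff (coeff (coeff p 0) 1) 0,
     coeff (coeff (coeff p 1) 0) 0] :: 'a ^ 3)"
  have "coeff (coeff (coeff p l) j) i = coeff (coeff (coeff (linear_form a) l) j) i" for l j i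
  proof (cases "i + j + l = 1")
    case False
    then show ?thesis
      using assms homogeneous3_linear_form[of a] unfolding homogeneous3_def by (metis One_nat_def)
  next
    case True
    then consider "i = 1" "j = 0" "l = 0" | "i = 0" "j = 1" "l = 0" | "i = 0" "j = 0" "l = 1" by linarith
    then show ?thesis
      by cases (auto simp: linear_form_def a_def const3_def var_x_def var_y_def var_z_def one_pCons)
  qed
  then show "p = linear_form a" by (intro poly_eqI) auto
qed

section \<open>Frobenius\<close>

text \<open>Since x^q = x on the finite field, the middle part of (x + 1)^q vanishes at all q
  elements while its degree is less than q. This yields additivity of the q-th power without writing
  q as a power of a prime.\<close>

lemma of_nat_card_choose_eq_0:
  assumes "0 < i" "i < CARD('a::finite_field)"
  shows "of_nat (CARD('a) choose i) = (0::'a)"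
proof -
  define q where "q = CARD('a)"
  define p :: "'a poly" where "p = (\<Sum>j\<in>{1..<q}. monom (of_nat (q choose j)) j)"
  have q: "q \<noteq> 0" using assms by (auto simp: q_def)
  have root: "poly p x = 0" for x
  proof -
    have "{..q} = insert 0 (insert q {1..<q})" using q by auto
    moreover have "(x + 1) ^ q = (\<Sum>j\<le>q. of_nat (q choose j) * x ^ j)"
      by (simp add: binomial_ring)
    ultimately have "(x + 1) ^ q = 1 + x ^ q + poly p x"
      using q by (simp add: p_def poly_sum poly_monom)
    then show ?thesis
      by (simp add: q_def finite_field_power_card_eq_same)
  qed
  have "p = 0"
  proof (rule ccontr)
    assume p: "p \<noteq> 0"
    have "degree p < q"
      unfolding p_def using q
      by (intro degree_sum_less) (auto intro: le_less_trans[OF degree_monom_le])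
    moreover have "card {x. poly p x = 0} \<le> degree p"
      using p by (rule card_poly_roots_bound)
    ultimately show False by (simp add: root q_def)
  qed
  then have "coeff p i = 0" by simp
  moreover have "coeff p i = of_nat (q choose i)"
    unfolding p_def using assms by (simp add: coeff_sum q_def)
  ultimately show ?thesis by (simp add: q_def)
qed

lemma card_finite_field_ge_2: "2 \<le> CARD('a::finite_field)"
proof -
  have "card {0, 1 :: 'a} \<le> CARD('a)" by (intro card_mono) auto
  then show ?thesis by simp
qed

text \<open>The weakest setting in which the q-th power is additive: a commutative ring with a
  homomorphism from k. The locales \<open>kdomain\<close>, \<open>kfield\<close> and
  \<open>kplane\<close> strengthen the target.\<close>

locale kalgebra = type_hom emb for emb :: "'a::finite_field alg_closure \<Rightarrow> 'b::comm_ring_1" +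
  fixes q :: nat
  assumes q: "q = CARD('a)"
begin

lemma q_ge_2: "2 \<le> q"
  using card_finite_field_ge_2[where ?'a = 'a] q by simp

lemma q_gt_0 [simp]: "0 < q" and q_neq_0 [simp]: "q \<noteq> 0" and q_gt_1: "1 < q"
  using q_ge_2 by auto

lemma frob_add: "(x + y :: 'b) ^ q = x ^ q + y ^ q"
proof -
  have "of_nat (q choose j) * x ^ j * y ^ (q - j) = 0" if "j \<in> {1..<q}" for j
  proof -
    have "of_nat (q choose j) = (0::'a)"
      using that unfolding q by (intro of_nat_card_choose_eq_0) auto
    then have "emb (to_ac (of_nat (q choose j))) = 0"
      by (metis hom_0 to_ac_0)
    then show ?thesis by simp
  qed
  moreover have "{..q} = insert 0 (insert q {1..<q})" by auto
  ultimately show ?thesis by (simp add: binomial_ring)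
qed

lemma frob_uminus: "(- x :: 'b) ^ q = - (x ^ q)"
  using frob_add[of x "- x"] by (simp add: power_0_left eq_neg_iff_add_eq_0 add.commute)

lemma frob_diff: "(x - y :: 'b) ^ q = x ^ q - y ^ q"
  using frob_add[of x "- y"] by (simp add: frob_uminus)

lemma frob_n_add: "(x + y :: 'b) ^ (q ^ n) = x ^ (q ^ n) + y ^ (q ^ n)"
  by (induction n) (simp_all add: power_Suc2 power_mult frob_add del: power_Suc)

lemma frob_n_diff: "(x - y :: 'b) ^ (q ^ n) = x ^ (q ^ n) - y ^ (q ^ n)"
  by (induction n) (simp_all add: power_Suc2 power_mult frob_diff del: power_Suc)

lemma frob_n_sum: "(sum f A :: 'b) ^ (q ^ n) = (\<Sum>a\<in>A. f a ^ (q ^ n))"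
  by (induction A rule: infinite_finite_induct) (auto simp: frob_n_add power_0_left)

lemma emb_to_ac_power [simp]: "emb (to_ac a) ^ q = emb (to_ac a)"
proof -
  have "a ^ q = a" by (simp add: q finite_field_power_card_eq_same)
  then show ?thesis by (metis hom_power to_ac_power)
qed

lemma emb_to_ac_power_n [simp]: "emb (to_ac a) ^ (q ^ n) = emb (to_ac a)"
  by (induction n) (auto simp: power_mult)

end

text \<open>The equation x^q = x has at most q solutions, and the q elements of the finite field
  already solve it.\<close>

lemma range_to_ac: "(x::'a::finite_field alg_closure) \<in> range to_ac \<longleftrightarrow> x ^ CARD('a) = x"
proof -
  define p :: "'a alg_closure poly" where "p = monom 1 CARD('a) - [:0, 1:]"
  have c: "2 \<le> CARD('a)" by (rule card_finite_field_ge_2)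
  then have coeff1: "coeff p (CARD('a)) = 1"
    by (auto simp: p_def coeff_pCons split: nat.splits)
  then have "p \<noteq> 0" by auto
  have "degree p \<le> CARD('a)"
    unfolding p_def using c by (intro degree_diff_le degree_monom_le) auto
  have roots: "{x. poly p x = 0} = {x::'a alg_closure. x ^ CARD('a) = x}"
    by (auto simp: p_def poly_monom)
  have fin: "finite {x. poly p x = 0}" by (rule poly_roots_finite) fact
  have "card {x. poly p x = 0} \<le> degree p" by (rule card_poly_roots_bound) fact
  also have "\<dots> \<le> card (range (to_ac :: 'a \<Rightarrow> _))"
    using \<open>degree p \<le> _\<close> by (simp add: card_image inj_to_ac)
  finally have "card {x::'a alg_closure. x ^ CARD('a) = x} \<le> card (range (to_ac :: 'a \<Rightarrow> _))" by (simp add: roots)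
  moreover have "range to_ac \<subseteq> {x::'a alg_closure. x ^ CARD('a) = x}"
    by (auto simp flip: to_ac_power simp: finite_field_power_card_eq_same)
  ultimately have "range to_ac = {x::'a alg_closure. x ^ CARD('a) = x}"
    using fin roots by (intro card_seteq) auto
  then show ?thesis by blast
qed

section \<open>Dickson invariants\<close>

text \<open>The Moore determinant of two elements, which detects linear dependence over the finite
  field.\<close>

definition moore2 :: "nat \<Rightarrow> 'b::comm_ring_1 \<Rightarrow> 'b \<Rightarrow> 'b"
  where "moore2 q x y = x * y ^ q - x ^ q * y"

text \<open>The quotient of \<open>x y^(q^2) - x^(q^2) y\<close> by the Moore determinant, written
  as a geometric sum so that it makes sense in every commutative ring.\<close>

definition dickson :: "nat \<Rightarrow> 'b::comm_ring_1 \<Rightarrow> 'b \<Rightarrow> 'b"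
  where "dickson q x y = (\<Sum>i\<le>q. (x ^ (q - 1)) ^ i * (y ^ (q - 1)) ^ (q - i))"

text \<open>The polynomial \<open>V\<close> of the overview in expanded form, in which additivity in
  \<open>z\<close> is visible.\<close>

definition span_poly :: "nat \<Rightarrow> 'b::comm_ring_1 \<Rightarrow> 'b \<Rightarrow> 'b \<Rightarrow> 'b"
  where "span_poly q x y z = z ^ q ^ 2 - dickson q x y * z ^ q + moore2 q x y ^ (q - 1) * z"

text \<open>The closed form of \<open>F\<close>; unlike the quotient of determinants it can be
  evaluated where the denominator vanishes.\<close>

definition dgz :: "nat \<Rightarrow> 'b::comm_ring_1 \<Rightarrow> 'b \<Rightarrow> 'b \<Rightarrow> 'b"
  where "dgz q x y z = span_poly q x y z ^ (q - 1) + dickson q x y ^ q"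

context type_hom
begin

lemma hom_moore2 [simp]: "h (moore2 q x y) = moore2 q (h x) (h y)"
  by (simp add: moore2_def)

lemma hom_dickson [simp]: "h (dickson q x y) = dickson q (h x) (h y)"
  unfolding dickson_def hom_sum hom_mult hom_power ..

lemma hom_span_poly [simp]: "h (span_poly q x y z) = span_poly q (h x) (h y) (h z)"
  by (simp add: span_poly_def)

lemma hom_dgz [simp]: "h (dgz q x y z) = dgz q (h x) (h y) (h z)"
  by (simp add: dgz_def)

end

text \<open>With a = x^(q-1) and b = y^(q-1), the Moore determinant is x y (b - a) and the
  right-hand side is x y (b^(q+1) - a^(q+1)); the quotient is a geometric sum.\<close>

lemma moore2_mult_dickson:
  assumes "0 < q"
  shows "moore2 q x y * dickson q x y = x * y ^ q ^ 2 - x ^ q ^ 2 * (y::'b::comm_ring_1)"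
proof -
  define a where "a = x ^ (q - 1)"
  define b where "b = y ^ (q - 1)"
  have "(q - 1) * Suc q + 1 = q ^ 2"
    using assms by (cases q) (auto simp: power2_eq_square)
  then have "z ^ q ^ 2 = z ^ ((q - 1) * Suc q + 1)" for z :: 'b by simp
  then have pw: "z ^ q ^ 2 = z * (z ^ (q - 1)) ^ Suc q" for z :: 'b
    unfolding power_add power_mult power_one_right by (simp only: mult.commute)
  have pq: "z ^ q = z * z ^ (q - 1)" for z :: 'b
    using power_minus_mult[OF assms, of z] by (simp add: mult.commute)
  have "dickson q x y = (\<Sum>p<Suc q. a ^ p * b ^ (q - p))"
    by (simp add: dickson_def a_def b_def lessThan_Suc_atMost)
  then have "(a - b) * dickson q x y = a ^ Suc q - b ^ Suc q"
    using diff_power_eq_sum[of a q b] by simp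
  then have "(b - a) * dickson q x y = b ^ Suc q - a ^ Suc q"
    by (metis minus_diff_eq mult_minus_left)
  then have "x * y * ((b - a) * dickson q x y) = x * y * (b ^ Suc q - a ^ Suc q)"
    by simp
  then show ?thesis
    unfolding moore2_def pw pq a_def[symmetric] b_def[symmetric]
    by (simp add: algebra_simps)
qed

definition det3 :: "'b::comm_ring_1 ^ 3 \<Rightarrow> 'b ^ 3 \<Rightarrow> 'b ^ 3 \<Rightarrow> 'b"
  where "det3 u v w = u$1 * (v$2 * w$3 - v$3 * w$2) - u$2 * (v$1 * w$3 - v$3 * w$1)
    + u$3 * (v$1 * w$2 - v$2 * w$1)"

definition frob :: "nat \<Rightarrow> 'b::comm_ring_1 ^ 3 \<Rightarrow> 'b ^ 3"
  where "frob n u = (\<chi> i. u $ i ^ n)"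

lemma frob_nth [simp]: "frob n u $ i = u $ i ^ n"
  by (simp add: frob_def)

lemma frob_frob: "frob m (frob n u) = frob (n * m) u"
  by (simp add: frob_def power_mult vec_eq_iff)

definition dgz_den :: "nat \<Rightarrow> 'b::comm_ring_1 ^ 3 \<Rightarrow> 'b"
  where "dgz_den q u = det3 u (frob q u) (frob (q ^ 2) u)"

definition dgz_num :: "nat \<Rightarrow> 'b::comm_ring_1 ^ 3 \<Rightarrow> 'b"
  where "dgz_num q u = det3 u (frob q u) (frob (q ^ 3) u)"

definition dgz_at :: "nat \<Rightarrow> 'b::comm_ring_1 ^ 3 \<Rightarrow> 'b"
  where "dgz_at q u = dgz q (u$1) (u$2) (u$3)"

lemma (in type_hom) hom_det3 [simp]:
  "h (det3 u v w) = det3 (\<chi> i. h (u$i)) (\<chi> i. h (v$i)) (\<chi> i. h (w$i))"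
  by (simp add: det3_def)

lemma (in type_hom) hom_dgz_at [simp]:
  "h (dgz_den q u) = dgz_den q (\<chi> i. h (u$i))"
  "h (dgz_num q u) = dgz_num q (\<chi> i. h (u$i))"
  "h (dgz_at q u) = dgz_at q (\<chi> i. h (u$i))"
  by (simp_all add: dgz_den_def dgz_num_def dgz_at_def det3_def)

context kalgebra
begin

lemma moore2_frob: "moore2 q x (y::'b) ^ q = x ^ q * y ^ q ^ 2 - x ^ q ^ 2 * y ^ q"
  by (simp add: moore2_def frob_diff power_mult_distrib power2_eq_square power_mult)

lemma dgz_den_eq: "dgz_den q (u :: 'b ^ 3) = moore2 q (u$1) (u$2) * span_poly q (u$1) (u$2) (u$3)"
proof -
  define x y z where "x = u$1" "y = u$2" "z = u$3"
  define d where "d = moore2 q x y"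
  have dd: "d * d ^ (q - 1) = d ^ q"
    using power_minus_mult[of q d] by (simp add: mult.commute)
  have "d * span_poly q x y z = d * z ^ q ^ 2 - d * dickson q x y * z ^ q + d * d ^ (q - 1) * z"
    by (simp add: span_poly_def d_def algebra_simps)
  also have "\<dots> = d * z ^ q ^ 2 - (x * y ^ q ^ 2 - x ^ q ^ 2 * y) * z ^ q + d ^ q * z"
    using moore2_mult_dickson[of q x y] unfolding dd by (simp add: d_def[symmetric])
  also have "\<dots> = dgz_den q u"
    unfolding d_def moore2_frob unfolding moore2_def dgz_den_def det3_def
    by (simp add: x_y_z_def[symmetric] algebra_simps)
  finally show ?thesis by (simp add: x_y_z_def d_def)
qed

end

text \<open>All terms are 2x2 minors of the matrix with rows x, x^q, x^(q^2), x^(q^3) and y, y^q,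
  y^(q^2), y^(q^3). The last two are Frobenius powers of known minors. The first comes from the
  Pluecker relation between the six minors after cancelling the q-th power of the Moore determinant,
  which is why that must be nonzero.\<close>

lemma moore2_3:
  fixes emb :: "'a::finite_field alg_closure \<Rightarrow> 'b::idom" and x y :: 'b
  assumes "kalgebra emb q" and nz: "moore2 q x y \<noteq> 0"
  shows "x * y ^ q ^ 3 - x ^ q ^ 3 * y =
    dickson q x y ^ q * (x * y ^ q ^ 2 - x ^ q ^ 2 * y) - moore2 q x y * moore2 q x y ^ (q ^ 2 - q)"
    and "x ^ q * y ^ q ^ 3 - x ^ q ^ 3 * y ^ q = moore2 q x y ^ q * dickson q x y ^ q"
    and "x ^ q ^ 2 * y ^ q ^ 3 - x ^ q ^ 3 * y ^ q ^ 2 = moore2 q x y ^ q ^ 2"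
proof -
  interpret kalgebra emb q by fact
  define d e where "d = moore2 q x y" "e = dickson q x y"
  define A where "A = d ^ (q ^ 2 - q)"
  define E3 where "E3 = x * y ^ q ^ 3 - x ^ q ^ 3 * y"
  define E where "E = x * y ^ q ^ 2 - x ^ q ^ 2 * y"
  have de: "d * e = E" using moore2_mult_dickson[of q x y] by (simp add: d_e_def E_def)
  have q2: "q \<le> q ^ 2" using q_ge_2 by (simp add: power2_eq_square)
  have q3: "q ^ 2 * q = q ^ 3" by (simp add: power2_eq_square power3_eq_cube)
  have dA: "d ^ q * A = d ^ q ^ 2" using q2 by (simp add: A_def flip: power_add)
  have Eq: "d ^ q * e ^ q = x ^ q * y ^ q ^ 3 - x ^ q ^ 3 * y ^ q"
    unfolding power_mult_distrib[symmetric] de E_def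
    by (simp add: frob_diff power_mult_distrib power_mult[symmetric] q3)
  have dq: "d ^ q = x ^ q * y ^ q ^ 2 - x ^ q ^ 2 * y ^ q"
    unfolding d_e_def by (rule moore2_frob)
  have dqq: "d ^ q ^ 2 = x ^ q ^ 2 * y ^ q ^ 3 - x ^ q ^ 3 * y ^ q ^ 2"
  proof -
    have "d ^ q ^ 2 = (d ^ q) ^ q" by (simp add: power2_eq_square power_mult)
    then show ?thesis unfolding dq
      by (simp add: frob_diff power_mult_distrib power_mult[symmetric] q3 power2_eq_square[symmetric])
  qed
  have "d ^ q * (d * A - e ^ q * E) = d * d ^ q ^ 2 - (d ^ q * e ^ q) * E"
    by (simp add: dA[symmetric] algebra_simps)
  also have "\<dots> = - (d ^ q * E3)"
    unfolding Eq dqq unfolding dq unfolding d_e_def moore2_def E_def E3_def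
    by (simp add: algebra_simps)
  finally have "d ^ q * (d * A - e ^ q * E) = d ^ q * (- E3)" by simp
  moreover have "d ^ q \<noteq> 0" using nz by (simp add: d_e_def)
  ultimately have "d * A - e ^ q * E = - E3" by (metis mult_left_cancel)
  then have "E3 = e ^ q * E - d * A" by (simp add: algebra_simps)
  then show "x * y ^ q ^ 3 - x ^ q ^ 3 * y =
    dickson q x y ^ q * (x * y ^ q ^ 2 - x ^ q ^ 2 * y) - moore2 q x y * moore2 q x y ^ (q ^ 2 - q)"
    by (simp add: E3_def E_def A_def d_e_def)
  show "x ^ q * y ^ q ^ 3 - x ^ q ^ 3 * y ^ q = moore2 q x y ^ q * dickson q x y ^ q"
    "x ^ q ^ 2 * y ^ q ^ 3 - x ^ q ^ 3 * y ^ q ^ 2 = moore2 q x y ^ q ^ 2"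
    using Eq dqq by (simp_all add: d_e_def)
qed

lemma (in kalgebra) span_poly_frob:
  "span_poly q x y (z::'b) ^ q = z ^ q ^ 3 - dickson q x y ^ q * z ^ q ^ 2 + moore2 q x y ^ (q ^ 2 - q) * z ^ q"
proof -
  have "(q - 1) * q = q ^ 2 - q" by (simp add: diff_mult_distrib power2_eq_square)
  moreover have "q ^ 2 * q = q ^ 3" by (simp add: power2_eq_square power3_eq_cube)
  ultimately have "(moore2 q x y ^ (q - 1)) ^ q = moore2 q x y ^ (q ^ 2 - q)" "(z ^ q ^ 2) ^ q = z ^ q ^ 3"
    by (simp_all flip: power_mult)
  moreover have "(z ^ q) ^ q = z ^ q ^ 2" by (simp add: power2_eq_square flip: power_mult)
  ultimately show ?thesis unfolding span_poly_def frob_add frob_diff power_mult_distrib by simp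
qed

text \<open>Since \<open>V^(q-1) V = V^q\<close>, multiplying by \<open>D2 = d V\<close> turns
  \<open>F\<close> into a combination of \<open>V^q\<close> and \<open>V\<close>, in which the terms
  with z^(q^2) cancel. The remaining coefficients are the minors of \<open>moore2_3\<close>, those
  of \<open>D1\<close> expanded along z.\<close>

lemma dgz_at_mult_den_aux:
  fixes emb :: "'a::finite_field alg_closure \<Rightarrow> 'b::idom" and u :: "'b ^ 3"
  assumes A: "kalgebra emb q" and nz: "moore2 q (u$1) (u$2) \<noteq> 0"
  shows "dgz_at q u * dgz_den q u = dgz_num q u"
proof -
  interpret kalgebra emb q by fact
  define x y z where xyz: "x = u$1" "y = u$2" "z = u$3"
  define d e V where "d = moore2 q x y" "e = dickson q x y" "V = span_poly q x y z"
  define A where "A = d ^ (q ^ 2 - q)"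
  define E where "E = x * y ^ q ^ 2 - x ^ q ^ 2 * y"
  have Vq: "V ^ q = z ^ q ^ 3 - e ^ q * z ^ q ^ 2 + A * z ^ q"
    unfolding d_e_V_def A_def by (rule span_poly_frob)
  have VV: "V ^ (q - 1) * V = V ^ q" by (rule power_minus_mult) simp
  have den: "dgz_den q u = d * V" by (simp add: dgz_den_eq d_e_V_def xyz)
  have den': "d * V = d * z ^ q ^ 2 - E * z ^ q + d ^ q * z"
    unfolding den[symmetric] unfolding d_e_V_def moore2_frob E_def unfolding moore2_def dgz_den_def det3_def
    by (simp add: xyz[symmetric] algebra_simps)
  have "dgz_at q u * dgz_den q u = d * (V ^ (q - 1) * V) + e ^ q * (d * V)"
    unfolding dgz_at_def dgz_def den by (simp add: d_e_V_def xyz algebra_simps)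
  also have "\<dots> = d * z ^ q ^ 3 - (e ^ q * E - d * A) * z ^ q + (d ^ q * e ^ q) * z"
    unfolding VV Vq den' by (simp add: algebra_simps)
  also have "e ^ q * E - d * A = x * y ^ q ^ 3 - x ^ q ^ 3 * y"
    using moore2_3(1)[OF A, of x y] nz by (simp add: d_e_V_def A_def E_def xyz)
  also have "d ^ q * e ^ q = x ^ q * y ^ q ^ 3 - x ^ q ^ 3 * y ^ q"
    using moore2_3(2)[OF A, of x y] nz by (simp add: d_e_V_def xyz)
  finally show ?thesis
    unfolding dgz_num_def det3_def by (simp add: xyz d_e_V_def moore2_def algebra_simps)
qed

lemma vec3_cong: "(u::'b^3)$1 = v$1 \<Longrightarrow> u$2 = v$2 \<Longrightarrow> u$3 = v$3 \<Longrightarrow> u = v"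
  by (auto simp: vec_eq_iff forall_3)

definition vars3 :: "'k::field poly3 ^ 3"
  where "vars3 = vector [var_x, var_y, var_z]"

lemma vars3_nth [simp]: "vars3 $ 1 = var_x" "vars3 $ 2 = var_y" "vars3 $ 3 = var_z"
  by (auto simp: vars3_def)

lemma moore2_vars_neq_0:
  assumes "2 \<le> q"
  shows "moore2 q var_x var_y \<noteq> (0 :: 'k::field poly3)"
proof -
  define s :: "'k poly" where "s = [:0, 1:]"
  have Y: "[:0, 1:] = monom (1 :: 'k poly) 1"
    by (simp add: monom_altdef)
  have c: "[:a:] ^ n = [:a ^ n:]" for a :: "'k poly" and n
    using type_hom.hom_power[OF type_hom_const_poly, of a n] by simp
  have "coeff (moore2 q [:s:] [:0, 1:]) 1 = - (s ^ q)"
    using assms unfolding moore2_def Y c monom_power by (simp add: smult_monom mult.commute)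
  then have "moore2 q [:s:] [:0, 1:] \<noteq> 0" by (auto simp: s_def)
  moreover have "moore2 q var_x var_y = [:moore2 q [:s:] [:0, 1:]:]"
    using type_hom.hom_moore2[OF type_hom_const_poly, of q "[:s:]" "[:0, 1:]"]
    by (simp add: var_x_def var_y_def s_def)
  ultimately show ?thesis by simp
qed

lemma degree_span_poly:
  fixes x y :: "'c::idom"
  assumes q: "2 \<le> q"
  shows "degree (span_poly q [:x:] [:y:] [:0, 1:]) = q ^ 2"
    and "lead_coeff (span_poly q [:x:] [:y:] [:0, 1:]) = 1"
proof -
  have Y: "[:0, 1:] = monom (1 :: 'c) 1"
    by (simp add: monom_altdef)
  define r where "r = - monom (dickson q x y) q + monom (moore2 q x y ^ (q - 1)) 1"
  have eq: "span_poly q [:x:] [:y:] [:0, 1:] = monom 1 (q ^ 2) + r"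
    unfolding span_poly_def type_hom.hom_moore2[OF type_hom_const_poly, symmetric]
      type_hom.hom_dickson[OF type_hom_const_poly, symmetric] type_hom.hom_power[OF type_hom_const_poly, symmetric]
    by (simp add: Y r_def monom_power smult_monom)
  have "degree r \<le> q"
    unfolding r_def using q
    by (intro degree_add_le) (auto intro: order.trans[OF degree_monom_le])
  also have "q < q ^ 2" using q by (simp add: power2_eq_square)
  finally have lt: "degree r < q ^ 2" .
  then show d: "degree (span_poly q [:x:] [:y:] [:0, 1:]) = q ^ 2"
    unfolding eq by (subst degree_add_eq_left) (auto simp: degree_monom_eq)
  show "lead_coeff (span_poly q [:x:] [:y:] [:0, 1:]) = 1"
    unfolding d unfolding eq using lt by (simp add: coeff_eq_0)
qed

lemma degree_dgz:
  fixes x y :: "'c::idom"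
  assumes q: "2 \<le> q"
  shows "degree (dgz q [:x:] [:y:] [:0, 1:]) = q ^ 2 * (q - 1)"
    and "lead_coeff (dgz q [:x:] [:y:] [:0, 1:]) = 1"
proof -
  define V where "V = span_poly q [:x:] [:y:] [:0, 1:]"
  have eq: "dgz q [:x:] [:y:] [:0, 1:] = V ^ (q - 1) + [:dickson q x y ^ q:]"
    unfolding dgz_def type_hom.hom_dickson[OF type_hom_const_poly, symmetric]
      type_hom.hom_power[OF type_hom_const_poly, symmetric] V_def ..
  have V: "degree V = q ^ 2" "lead_coeff V = 1"
    unfolding V_def by (rule degree_span_poly[OF q])+
  then have "V \<noteq> 0" by auto
  then have dV: "degree (V ^ (q - 1)) = q ^ 2 * (q - 1)"
    by (simp add: degree_power_eq V mult.commute)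
  have pos: "0 < q ^ 2 * (q - 1)" using q by simp
  show d: "degree (dgz q [:x:] [:y:] [:0, 1:]) = q ^ 2 * (q - 1)"
    unfolding eq using pos by (subst degree_add_eq_left) (auto simp: dV simp del: One_nat_def)
  have "lead_coeff (V ^ (q - 1)) = 1" by (simp only: lead_coeff_power V(2) power_one)
  then show "lead_coeff (dgz q [:x:] [:y:] [:0, 1:]) = 1"
    unfolding d unfolding eq dV using pos by (simp add: coeff_eq_0 coeff_pCons split: nat.splits)
qed

lemma dgz_den_vars_neq_0:
  assumes "kalgebra (const3 :: 'a::finite_field alg_closure \<Rightarrow> _) q"
  shows "dgz_den q (vars3 :: 'a alg_closure poly3 ^ 3) \<noteq> 0"
proof -
  interpret kalgebra "const3 :: 'a::finite_field alg_closure \<Rightarrow> _" q by fact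
  have "span_poly q [:[:[:0, 1:]:]:] [:[:0, 1:]:] [:0, 1 :: 'a alg_closure poly poly:] \<noteq> 0"
    using degree_span_poly(2)[OF q_ge_2, of "[:[:0, 1 :: 'a alg_closure:]:]" "[:0, 1:]"] by fastforce
  then show ?thesis
    unfolding dgz_den_eq using moore2_vars_neq_0[OF q_ge_2]
    by (simp add: var_x_def var_y_def var_z_def)
qed

lemma DGZ_form_eq:
  assumes "kalgebra (const3 :: 'a::finite_field alg_closure \<Rightarrow> _) q"
  shows "DGZ_form q = dgz_at q (vars3 :: 'a alg_closure poly3 ^ 3)"
proof -
  interpret kalgebra "const3 :: 'a::finite_field alg_closure \<Rightarrow> _" q by fact
  have "DGZ_numerator q = dgz_num q (vars3 :: 'a alg_closure poly3 ^ 3)"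
    unfolding DGZ_numerator_def det_3 dgz_num_def det3_def by (simp add: algebra_simps)
  moreover have "DGZ_denominator q = dgz_den q (vars3 :: 'a alg_closure poly3 ^ 3)"
    unfolding DGZ_denominator_def det_3 dgz_den_def det3_def by (simp add: algebra_simps)
  moreover have "dgz_at q vars3 * dgz_den q (vars3 :: 'a alg_closure poly3 ^ 3) = dgz_num q vars3"
    by (rule dgz_at_mult_den_aux[OF assms]) (simp add: moore2_vars_neq_0 q_ge_2)
  ultimately show ?thesis
    unfolding DGZ_form_def using dgz_den_vars_neq_0[OF assms]
    by (metis nonzero_mult_div_cancel_right)
qed

context kalgebra
begin

lemma kalgebra_const3: "kalgebra (const3 :: 'a alg_closure \<Rightarrow> _) q"
  unfolding kalgebra_def kalgebra_axioms_def using q type_hom_const3 by auto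

lemma ev3_vars3: "(\<chi> i. ev3 emb u (vars3 $ i)) = u"
  using ev3_var[OF type_hom_axioms] by (intro vec3_cong) auto

text \<open>The identity holds for the three variables, whose Moore determinant is nonzero;
  evaluation carries it to every point over every k-algebra.\<close>

lemma dgz_at_mult_den: "dgz_at q (u :: 'b ^ 3) * dgz_den q u = dgz_num q u"
proof -
  interpret c: kalgebra "const3 :: 'a alg_closure \<Rightarrow> _" q by (rule kalgebra_const3)
  interpret e: type_hom "ev3 emb u" by (rule type_hom_ev3) unfold_locales
  have "dgz_at q vars3 * dgz_den q (vars3 :: 'a alg_closure poly3 ^ 3) = dgz_num q vars3"
    by (rule dgz_at_mult_den_aux[OF kalgebra_const3]) (simp add: moore2_vars_neq_0 q_ge_2)
  then have "ev3 emb u (dgz_at q vars3 * dgz_den q vars3) = ev3 emb u (dgz_num q vars3)"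
    by simp
  then show ?thesis by (simp add: ev3_vars3)
qed

lemma ev3_DGZ_form: "ev3 emb u (DGZ_form q) = dgz_at q u"
proof -
  interpret e: type_hom "ev3 emb u" by (rule type_hom_ev3) unfold_locales
  show ?thesis by (simp add: DGZ_form_eq[OF kalgebra_const3] ev3_vars3)
qed

section \<open>The action of matrices over the finite field\<close>

definition act :: "'a ^ 3 ^ 3 \<Rightarrow> 'b ^ 3 \<Rightarrow> 'b ^ 3"
  where "act M u = (\<chi> i. \<Sum>j\<in>UNIV. emb (to_ac (M $ i $ j)) * u $ j)"

lemma act_nth: "act M u $ i = emb (to_ac (M$i$1)) * u$1 + emb (to_ac (M$i$2)) * u$2 + emb (to_ac (M$i$3)) * u$3"
  by (simp add: act_def sum_3)

lemma det3_act: "det3 (act M u) (act M v) (act M w) = emb (to_ac (det M)) * det3 u v w"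
  unfolding det_3 det3_def act_nth by (simp add: algebra_simps)

text \<open>Frobenius fixes the entries of \<open>M\<close>. As a consequence \<open>D1\<close> and
  \<open>D2\<close> are both multiplied by \<open>det M\<close>, and their quotient \<open>F\<close>
  is invariant.\<close>

lemma frob_act: "frob (q ^ n) (act M u) = act M (frob (q ^ n) u)"
  by (simp add: vec_eq_iff act_def frob_n_sum power_mult_distrib)

lemma frob_act_1: "frob q (act M u) = act M (frob q u)"
  using frob_act[of 1] by simp

lemma dgz_den_act: "dgz_den q (act M u) = emb (to_ac (det M)) * dgz_den q u"
  unfolding dgz_den_def frob_act frob_act_1 det3_act ..

lemma dgz_num_act: "dgz_num q (act M u) = emb (to_ac (det M)) * dgz_num q u"
  unfolding dgz_num_def frob_act frob_act_1 det3_act ..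

end

section \<open>The orbit of a root\<close>

context kalgebra
begin

lemma span_poly_add: "span_poly q x y (z + w :: 'b) = span_poly q x y z + span_poly q x y w"
  by (simp add: span_poly_def frob_add frob_n_add algebra_simps)

lemma span_poly_scale: "span_poly q x y (emb (to_ac c) * z) = emb (to_ac c) * span_poly q x y z"
  by (simp add: span_poly_def power_mult_distrib algebra_simps)

definition aff :: "'b \<Rightarrow> 'b \<Rightarrow> 'a \<times> 'a \<times> 'a \<Rightarrow> 'b \<Rightarrow> 'b"
  where "aff x y g z = emb (to_ac (fst g)) * z + emb (to_ac (fst (snd g))) * x + emb (to_ac (snd (snd g))) * y"

lemma to_ac_power_minus_1: "c \<noteq> 0 \<Longrightarrow> to_ac (c::'a) ^ (q - 1) = 1"
proof -
  assume c: "c \<noteq> 0"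
  have "c ^ (q - 1) * c = 1 * c"
    using power_minus_mult[of q c] by (simp add: q finite_field_power_card_eq_same)
  then have "c ^ (q - 1) = 1" using c by (simp only: mult_right_cancel not_False_eq_True)
  then show ?thesis by (metis to_ac_1 to_ac_power)
qed

end

definition aff_group :: "('a::finite_field \<times> 'a \<times> 'a) set"
  where "aff_group = (UNIV - {0}) \<times> UNIV"

lemma finite_aff_group [simp]: "finite aff_group"
  by (rule finite_subset[OF subset_UNIV finite])

locale kdomain = kalgebra emb q for emb :: "'a::finite_field alg_closure \<Rightarrow> 'b::idom" and q
begin

lemma emb_eq_0_iff [simp]: "emb c = 0 \<longleftrightarrow> c = 0"
proof
  assume "emb c = 0"
  then have "emb (c * inverse c) = 0" by (simp only: hom_mult mult_zero_left)
  then show "c = 0" by (cases "c = 0") auto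
qed auto

lemma emb_eq_iff [simp]: "emb c = emb d \<longleftrightarrow> c = d"
  using emb_eq_0_iff[of "c - d"] by (simp del: emb_eq_0_iff)

lemma card_aff_group: "card (aff_group :: ('a \<times> 'a \<times> 'a) set) = q ^ 2 * (q - 1)"
proof -
  have "aff_group = (UNIV - {0}) \<times> (UNIV :: 'a set) \<times> (UNIV :: 'a set)"
    by (auto simp: aff_group_def)
  then have "card (aff_group :: ('a \<times> 'a \<times> 'a) set) = card ((UNIV - {0 :: 'a}) \<times> (UNIV :: 'a set) \<times> (UNIV :: 'a set))"
    by (rule arg_cong)
  also have "\<dots> = q ^ 2 * (q - 1)"
    unfolding card_cartesian_product by (simp add: card_Diff_singleton q power2_eq_square)
  finally show ?thesis .
qed

context
  fixes x y :: 'b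
  assumes nz: "moore2 q x y \<noteq> 0"
begin

lemma span_poly_self: "span_poly q x y x = 0" "span_poly q x y y = 0"
proof -
  have "moore2 q x y * span_poly q x y x = dgz_den q (vector [x, y, x])"
    by (simp add: dgz_den_eq)
  also have "\<dots> = 0" by (simp add: dgz_den_def det3_def algebra_simps)
  finally show "span_poly q x y x = 0" using nz by simp
  have "moore2 q x y * span_poly q x y y = dgz_den q (vector [x, y, y])"
    by (simp add: dgz_den_eq)
  also have "\<dots> = 0" by (simp add: dgz_den_def det3_def algebra_simps)
  finally show "span_poly q x y y = 0" using nz by simp
qed

lemma span_poly_comb: "span_poly q x y (emb (to_ac a) * x + emb (to_ac b) * y) = 0"
  by (simp add: span_poly_add span_poly_scale span_poly_self)

lemma span_poly_aff: "span_poly q x y (aff x y g z) = emb (to_ac (fst g)) * span_poly q x y z"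
  unfolding aff_def add.assoc by (subst span_poly_add) (simp add: span_poly_comb span_poly_scale)

text \<open>The relation and its q-th power form a linear system in the two scalars whose
  determinant is the Moore determinant; this is Cramer's rule.\<close>

lemma comb_eq_0: "emb (to_ac a) * x + emb (to_ac b) * y = 0 \<longleftrightarrow> a = 0 \<and> b = 0"
proof
  assume *: "emb (to_ac a) * x + emb (to_ac b) * y = 0"
  then have "(emb (to_ac a) * x + emb (to_ac b) * y) ^ q = 0" by simp
  then have **: "emb (to_ac a) * x ^ q + emb (to_ac b) * y ^ q = 0"
    by (simp add: frob_add power_mult_distrib)
  have "emb (to_ac a) * moore2 q x y = (emb (to_ac a) * x + emb (to_ac b) * y) * y ^ q -
     (emb (to_ac a) * x ^ q + emb (to_ac b) * y ^ q) * y"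
    unfolding moore2_def by (simp add: algebra_simps)
  then have "a = 0" unfolding * ** using nz by simp
  have "emb (to_ac b) * moore2 q x y = (emb (to_ac a) * x ^ q + emb (to_ac b) * y ^ q) * x -
    (emb (to_ac a) * x + emb (to_ac b) * y) * x ^ q"
    unfolding moore2_def by (simp add: algebra_simps)
  then have "b = 0" unfolding * ** using nz by simp
  then show "a = 0 \<and> b = 0" using \<open>a = 0\<close> by simp
qed auto

lemma dgz_aff:
  assumes "g \<in> aff_group" shows "dgz q x y (aff x y g z) = dgz q x y z"
  using assms to_ac_power_minus_1[of "fst g"]
  by (auto simp: dgz_def span_poly_aff power_mult_distrib aff_group_def simp flip: hom_power)

text \<open>Applying \<open>V\<close> recovers the linear part of the affine map; the translation
  part is then determined because x and y are independent over the finite field.\<close>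

lemma inj_on_aff:
  assumes z: "span_poly q x y z \<noteq> 0"
  shows "inj (\<lambda>g. aff x y g z)"
proof (rule injI)
  fix g h assume *: "aff x y g z = aff x y h z"
  then have "emb (to_ac (fst g)) * span_poly q x y z = emb (to_ac (fst h)) * span_poly q x y z"
    by (metis span_poly_aff)
  then have 1: "fst g = fst h" using z by simp
  then have "emb (to_ac (fst (snd g) - fst (snd h))) * x + emb (to_ac (snd (snd g) - snd (snd h))) * y = 0"
    using * by (simp add: aff_def algebra_simps)
  then have "fst (snd g) = fst (snd h) \<and> snd (snd g) = snd (snd h)"
    unfolding comb_eq_0 by simp
  then show "g = h" using 1 by (simp add: prod_eq_iff)
qed

lemma card_orbit:
  assumes z: "span_poly q x y z \<noteq> 0"
  shows "card ((\<lambda>g. aff x y g z) ` aff_group) = q ^ 2 * (q - 1)"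
  by (simp add: card_image inj_on_subset[OF inj_on_aff[OF z]] card_aff_group)

end

end

section \<open>Local computations\<close>

lemma order_power_eq:
  assumes "(p :: 'c::idom poly) \<noteq> 0"
  shows "order a (p ^ n) = n * order a p"
  using assms by (induction n) (auto simp: order_mult)

lemma order_add_eq_left:
  assumes "(p :: 'c::idom poly) \<noteq> 0" "r \<noteq> 0" "order a p < order a r"
  shows "p + r \<noteq> 0 \<and> order a (p + r) = order a p"
proof -
  define n where "n = order a p"
  have "[:- a, 1:] ^ Suc n dvd r" using assms by (simp add: order_divides n_def del: power_Suc)
  moreover have "\<not> [:- a, 1:] ^ Suc n dvd p" using assms by (simp add: order_divides n_def del: power_Suc)
  ultimately have 1: "\<not> [:- a, 1:] ^ Suc n dvd p + r"
    by (metis add.commute dvd_add_right_iff)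
  have "[:- a, 1:] ^ n dvd p" "[:- a, 1:] ^ n dvd r"
    using assms by (auto simp: order_divides n_def)
  then have "[:- a, 1:] ^ n dvd p + r" by (rule dvd_add)
  with 1 show ?thesis by (auto simp: order_divides n_def[symmetric] simp del: power_Suc)
qed

definition frob_poly :: "nat \<Rightarrow> 'c::idom poly"
  where "frob_poly n = [:0, 1:] - monom 1 n"

text \<open>The derivative of t - t^n is 1 in this characteristic, so all zeros are simple.\<close>

lemma order_frob_poly:
  assumes "of_nat n = (0::'c::idom)" "1 < n"
  shows "order a (frob_poly n :: 'c poly) \<le> 1"
proof (rule ccontr)
  define P :: "'c poly" where "P = frob_poly n"
  assume "\<not> order a (frob_poly n :: 'c poly) \<le> 1"
  then have "[:- a, 1:] ^ 2 dvd P" by (auto simp: order_divides P_def)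
  moreover define L where "L = [:- a, 1:]"
  ultimately obtain R where R: "P = L ^ 2 * R" by (auto elim: dvdE)
  have L: "poly L a = 0" by (simp add: L_def)
  have "pderiv P = 1"
    using assms by (simp add: P_def frob_poly_def pderiv_diff pderiv_monom pderiv_pCons)
  moreover have "poly (pderiv P) a = 0"
    by (simp add: R pderiv_mult power2_eq_square L)
  ultimately show False by simp
qed

lemma frob_poly_neq_0: "1 < n \<Longrightarrow> frob_poly n \<noteq> (0 :: 'c::idom poly)"
proof
  assume "1 < n" "frob_poly n = (0 :: 'c::idom poly)"
  then have "coeff (frob_poly n :: 'c poly) n = 0" by simp
  then show False using \<open>1 < n\<close> by (auto simp: frob_poly_def coeff_pCons split: nat.splits)
qed

lemma type_hom_to_fract: "type_hom to_fract"
  by unfold_locales auto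

lemmas to_fract_power [simp] = type_hom.hom_power[OF type_hom_to_fract]

text \<open>This lemma and the next compare orders of vanishing at a point of the line, of the equations that a
  non-trivial relation for a generic root would force in \<open>k(t)\<close>.\<close>

lemma kummer_obstruction:
  fixes r :: "'c::idom poly fract"
  assumes "r ^ m = (- (to_fract e ^ n)) ^ d" "order a e = 1" and e: "e \<noteq> 0"
  shows "m dvd n * d"
proof -
  obtain B D where r: "r = Fract B D" "D \<noteq> 0" by (cases r) auto
  have "r * to_fract D = to_fract B" using r by (simp add: Fract_conv_to_fract)
  then have "to_fract (B ^ m) = r ^ m * to_fract (D ^ m)"
    by (metis to_fract_power power_mult_distrib)
  also have "\<dots> = to_fract ((- (e ^ n)) ^ d * D ^ m)"
    by (simp add: assms(1))
  finally have eq: "B ^ m = (- (e ^ n)) ^ d * D ^ m" by (simp only: to_fract_eq_iff)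
  have nz: "(- (e ^ n)) ^ d \<noteq> 0" "D ^ m \<noteq> 0" using e r by auto
  then have "B ^ m \<noteq> 0" unfolding eq by simp
  have "m * order a B = order a (B ^ m)"
    using \<open>B ^ m \<noteq> 0\<close> by (cases "B = 0") (auto simp: order_power_eq power_0_left)
  also have "\<dots> = d * (n * order a e) + m * order a D"
    unfolding eq using nz e r by (simp add: order_mult order_power_eq)
  finally have "m * order a B = n * d + m * order a D" using assms(2) by (simp add: mult.commute)
  then show ?thesis by (metis dvd_add_left_iff dvd_triv_left)
qed

lemma artin_schreier_obstruction:
  fixes b :: "'c::idom poly fract"
  assumes eq: "(b * to_fract e) ^ n + to_fract th * b + 1 = 0"
    and frob: "\<And>u v :: 'c poly. (u + v) ^ n = u ^ n + v ^ n"
    and e: "poly e a \<noteq> 0" and th: "order a th = n - 1" "th \<noteq> 0" and n: "2 \<le> n"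
  shows False
proof -
  obtain B D where b: "b = Fract B D" "D \<noteq> 0" by (cases b) auto
  have tD: "to_fract D \<noteq> 0" using b by simp
  have bD: "b * to_fract D = to_fract B" using b by (simp add: Fract_conv_to_fract)
  have Dn: "to_fract D ^ n = to_fract D * to_fract D ^ (n - 1)"
    using n power_minus_mult[of n "to_fract D"] by (simp add: mult.commute)
  have "((b * to_fract e) ^ n + to_fract th * b + 1) * to_fract D ^ n =
     (b * to_fract D * to_fract e) ^ n + to_fract th * (b * to_fract D) * to_fract D ^ (n - 1) + to_fract D ^ n"
    by (simp add: Dn power_mult_distrib algebra_simps)
  then have "to_fract ((B * e) ^ n + th * B * D ^ (n - 1) + D ^ n) = 0"
    unfolding eq bD by simp
  then have "(B * e) ^ n + th * B * D ^ (n - 1) + D ^ n = 0" by (simp only: to_fract_eq_0_iff)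
  \<comment> \<open>With b = B/D, clearing denominators and additivity of the n-th power collect two
    terms into one n-th power, whose order at \<open>a\<close> is a multiple of n.\<close>
  then have main: "(B * e + D) ^ n = - (th * B * D ^ (n - 1))"
    unfolding frob by (simp add: algebra_simps eq_neg_iff_add_eq_0)
  have "B \<noteq> 0"
  proof
    assume "B = 0"
    then have "D ^ n = 0" using main by simp
    then show False using b by simp
  qed
  have e0: "e \<noteq> 0" "order a e = 0" using e by (auto simp: order_0I)
  define \<beta> \<delta> s where "\<beta> = order a B" "\<delta> = order a D" "s = order a (B * e + D)"
  have Be: "order a (B * e) = \<beta>" using \<open>B \<noteq> 0\<close> e0 by (simp add: order_mult \<beta>_\<delta>_s_def)
  have nz: "th * B * D ^ (n - 1) \<noteq> 0" using th \<open>B \<noteq> 0\<close> b by simp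
  then have "B * e + D \<noteq> 0" using main n by (auto simp: power_0_left)
  then have "n * s = order a ((B * e + D) ^ n)" by (simp add: order_power_eq \<beta>_\<delta>_s_def)
  also have "\<dots> = (n - 1) + \<beta> + (n - 1) * \<delta>"
    unfolding main using nz b by (simp add: order_mult order_power_eq th \<beta>_\<delta>_s_def)
  finally have ord: "n * s = (n - 1) + \<beta> + (n - 1) * \<delta>" .
  obtain m where m: "n = Suc m" "m \<noteq> 0" using n by (cases n) auto
  \<comment> \<open>If the orders of \<open>B\<close> and \<open>D\<close> differ, \<open>s\<close>
    is the smaller one and \<open>ord\<close> contradicts the inequality; if they agree,
    \<open>ord\<close> makes n divide n - 1.\<close>
  consider "\<beta> < \<delta>" | "\<delta> < \<beta>" | "\<beta> = \<delta>" by linarith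
  then show False
  proof cases
    case 1
    then have "s = \<beta>"
      using order_add_eq_left[of "B * e" D a] \<open>B \<noteq> 0\<close> e0 b Be by (simp add: \<beta>_\<delta>_s_def)
    then have "m * \<beta> = m * Suc \<delta>" using ord m by simp
    then have "\<beta> = Suc \<delta>" using m by (simp only: mult_cancel1) simp
    with 1 show False by simp
  next
    case 2
    then have "s = \<delta>"
      using order_add_eq_left[of D "B * e" a] \<open>B \<noteq> 0\<close> e0 b Be by (simp add: \<beta>_\<delta>_s_def add.commute)
    then show False using ord m 2 by simp
  next
    case 3
    then have "n * s = (n - 1) + n * \<delta>" using ord m by simp
    then have "n dvd n - 1" by (metis dvd_add_left_iff dvd_triv_left)
    then show False using n by (auto dest: dvd_imp_le)
  qed
qed

section \<open>Irreducibility\<close>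

lemma card_roots_le:
  fixes p :: "'c::idom poly"
  assumes "p \<noteq> 0" "A \<subseteq> {x. poly p x = 0}"
  shows "card A \<le> degree p"
proof -
  have "card A \<le> card {x. poly p x = 0}"
    by (rule card_mono[OF poly_roots_finite[OF assms(1)] assms(2)])
  also have "\<dots> \<le> degree p" by (rule card_poly_roots_bound[OF assms(1)])
  finally show ?thesis .
qed

text \<open>A nonzero root \<open>l\<close> of \<open>V\<close> splits it as a composition of
  additive polynomials, the inner one vanishing on all multiples of \<open>l\<close> by the finite
  field. The value of \<open>\<theta>\<close> is read off from the coefficient of z^q; the condition
  V(l) = 0 matches the coefficient of z.\<close>

lemma span_poly_factor:
  fixes x y z l :: "'b::idom"
  assumes "span_poly q x y l = 0" "l \<noteq> 0" and frob: "\<And>u v::'b. (u - v) ^ q = u ^ q - v ^ q" and q: "1 \<le> q"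
  defines "\<theta> \<equiv> dickson q x y - l ^ (q * (q - 1))"
  shows "\<theta> * l ^ (q - 1) = moore2 q x y ^ (q - 1)"
    and "span_poly q x y z = (z ^ q - l ^ (q - 1) * z) ^ q - \<theta> * (z ^ q - l ^ (q - 1) * z)"
proof -
  have e1: "l ^ q ^ 2 = l ^ (q * (q - 1)) * l ^ (q - 1) * l"
  proof -
    have "q ^ 2 = q * (q - 1) + (q - 1) + 1"
      using q by (cases q) (auto simp: power2_eq_square algebra_simps)
    then show ?thesis by (metis power_add power_one_right)
  qed
  have e2: "l ^ q = l ^ (q - 1) * l" using power_minus_mult[of q l] q by simp
  have "(\<theta> * l ^ (q - 1) - moore2 q x y ^ (q - 1)) * l = - span_poly q x y l"
    unfolding span_poly_def \<theta>_def e1 e2 by (simp add: algebra_simps)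
  then show 1: "\<theta> * l ^ (q - 1) = moore2 q x y ^ (q - 1)"
    using assms(1,2) by simp
  have e3: "(z ^ q - l ^ (q - 1) * z) ^ q = z ^ q ^ 2 - l ^ (q * (q - 1)) * z ^ q"
    unfolding frob power_mult_distrib by (simp add: power2_eq_square mult.commute flip: power_mult)
  show "span_poly q x y z = (z ^ q - l ^ (q - 1) * z) ^ q - \<theta> * (z ^ q - l ^ (q - 1) * z)"
    unfolding e3 span_poly_def 1[symmetric] by (simp add: \<theta>_def algebra_simps)
qed

text \<open>\<open>tvar\<close> stands for \<open>x / y\<close> on the chart \<open>y = 1\<close>.\<close>

abbreviation (input) tvar :: "'c::comm_ring_1 poly" where "tvar \<equiv> [:0, 1:]"

lemma kalgebra_iff: "kalgebra (h :: 'a::finite_field alg_closure \<Rightarrow> _) q \<longleftrightarrow> type_hom h \<and> q = CARD('a)"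
  unfolding kalgebra_def kalgebra_axioms_def ..

lemma moore2_t: "moore2 q tvar 1 = (frob_poly q :: 'c::idom poly)"
  by (simp add: moore2_def frob_poly_def monom_altdef)

lemma of_nat_q:
  assumes "kalgebra (h :: 'a::finite_field alg_closure \<Rightarrow> 'c::idom) q"
  shows "of_nat q = (0::'c)"
proof -
  interpret kalgebra h q by fact
  have "(1 + (-1) :: 'c) ^ q = 1 ^ q + (-1) ^ q" by (rule frob_add)
  have "of_nat (q choose 1) = (0::'a)"
    using q_gt_1 unfolding q by (intro of_nat_card_choose_eq_0) auto
  then have "of_nat q = (0::'a)" by simp
  then have "to_ac (of_nat q :: 'a) = to_ac 0" by (simp only:)
  then have "h (of_nat q) = h 0" by (simp only: to_ac_of_nat to_ac_0)
  then show ?thesis by simp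
qed

text \<open>With D = t - t^q one has t - t^(q^2) = D + D^q, and D can be cancelled. In particular
  the invariant takes the value 1 at every element of the finite field.\<close>

lemma dickson_t:
  assumes "kalgebra (h :: 'a::finite_field alg_closure \<Rightarrow> 'c::idom poly) q"
  shows "dickson q tvar 1 = 1 + (frob_poly q :: 'c poly) ^ (q - 1)"
proof -
  interpret kalgebra h q by fact
  have nz: "(frob_poly q :: 'c poly) \<noteq> 0" by (rule frob_poly_neq_0[OF q_gt_1])
  have "frob_poly q * dickson q tvar 1 = tvar * 1 ^ q ^ 2 - tvar ^ q ^ 2 * (1 :: 'c poly)"
    unfolding moore2_t[symmetric] by (rule moore2_mult_dickson[OF q_gt_0])
  also have "\<dots> = (tvar - tvar ^ q) + (tvar - tvar ^ q) ^ q"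
    by (simp add: frob_diff power2_eq_square flip: power_mult)
  also have "tvar - tvar ^ q = (frob_poly q :: 'c poly)"
    by (simp add: frob_poly_def monom_altdef)
  also have "frob_poly q + frob_poly q ^ q = (frob_poly q :: 'c poly) * (1 + frob_poly q ^ (q - 1))"
    using power_minus_mult[of q "frob_poly q :: 'c poly"] by (simp add: algebra_simps)
  finally show ?thesis using nz by simp
qed

text \<open>The product of the invariant with t - t^q is t - t^(q^2), which has only simple zeros;
  comparing degrees, the invariant is not constant. A simple zero is what the Kummer argument
  requires.\<close>

lemma dickson_t_root:
  assumes "kalgebra (\<lambda>c::'a::finite_field alg_closure. [:c:]) q"
  obtains a where "order a (dickson q tvar 1 :: 'a alg_closure poly) = 1"
proof -
  interpret kalgebra "\<lambda>c::'a::finite_field alg_closure. [:c:]" q by fact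
  have k: "kalgebra (\<lambda>c::'a alg_closure. c) q" by (simp add: kalgebra_iff q type_hom_id)
  let ?e = "dickson q tvar 1 :: 'a alg_closure poly"
  have prod: "frob_poly q * ?e = frob_poly (q ^ 2)"
    unfolding moore2_t[symmetric] using moore2_mult_dickson[OF q_gt_0, of tvar "1 :: 'a alg_closure poly"]
    by (simp add: moore2_def)
  have q2: "1 < q ^ 2" using q_gt_1 by (metis one_less_power zero_less_numeral)
  then have nz: "frob_poly q * ?e \<noteq> 0" unfolding prod by (rule frob_poly_neq_0)
  have dfrob: "degree (frob_poly n :: 'a alg_closure poly) = n" if "1 < n" for n
  proof -
    have "frob_poly n = - monom 1 n + ([:0, 1:] :: 'a alg_closure poly)" by (simp add: frob_poly_def)
    then show ?thesis using that by (simp only:, subst degree_add_eq_left) (auto simp: degree_monom_eq)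
  qed
  have "degree (frob_poly q * ?e) = degree (frob_poly q :: 'a alg_closure poly) + degree ?e"
    using nz by (intro degree_mult_eq) auto
  then have "q ^ 2 = q + degree ?e" unfolding prod dfrob[OF q2] dfrob[OF q_gt_1] .
  moreover have "q < q ^ 2" using q_gt_1 by (simp add: power2_eq_square)
  ultimately have "degree ?e > 0" by simp
  then obtain a where "poly ?e a = 0" using alg_closed_imp_poly_has_root by blast
  then have "order a ?e \<noteq> 0" using nz by (auto simp: order_root)
  moreover have "order a ?e \<le> order a (frob_poly (q ^ 2) :: 'a alg_closure poly)"
    unfolding prod[symmetric] using nz by (simp add: order_mult)
  moreover have "order a (frob_poly (q ^ 2) :: 'a alg_closure poly) \<le> 1"
    using of_nat_q[OF k] by (intro order_frob_poly q2) simp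
  ultimately have "order a ?e = 1" by simp
  then show ?thesis by (rule that)
qed

section \<open>The rational function field k(t) inside its algebraic closure\<close>

abbreviation (input) emb_rat :: "'c::field \<Rightarrow> 'c poly fract alg_closure"
  where "emb_rat c \<equiv> to_ac (to_fract [:c:])"

abbreviation (input) rat_t :: "'c::field poly fract alg_closure"
  where "rat_t \<equiv> to_ac (to_fract tvar)"

lemma type_hom_to_fract_const: "type_hom (\<lambda>c. to_fract [:c:])"
  by (intro type_hom_comp[OF type_hom_to_fract type_hom_const_poly])

lemma type_hom_emb_rat: "type_hom emb_rat"
  by (intro type_hom_comp[OF type_hom_to_ac type_hom_to_fract_const])

text \<open>This is the irreducibility of \<open>F\<close>. If the degree were smaller, the
  conjugates of \<open>w\<close> would come from a proper subgroup H of the affine group. The Kummer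
  equation v^(q-1) = -e^q for v = V(w) forces every linear part to occur in H, so the translations
  in H lie on a line. Factoring \<open>V\<close> through this line produces an equation over k(t) of
  Artin-Schreier type without solution.\<close>

lemma generic_root_degree:
  fixes w :: "'a::finite_field alg_closure poly fract alg_closure"
    and g :: "'a alg_closure poly fract poly"
  assumes q: "q = CARD('a)" and w: "dgz q rat_t 1 w = 0"
    and g: "g \<noteq> 0" "poly (map_poly to_ac g) w = 0"
  shows "q ^ 2 * (q - 1) \<le> degree g"
proof (rule ccontr)
  assume small: "\<not> q ^ 2 * (q - 1) \<le> degree g"
  define N where "N = q ^ 2 * (q - 1)"
  interpret E: kdomain "emb_rat :: 'a alg_closure \<Rightarrow> _" q
    unfolding kdomain_def kalgebra_iff using q type_hom_emb_rat by blast
  interpret K: kdomain "\<lambda>c :: 'a alg_closure. to_fract [:c:]" q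
    unfolding kdomain_def kalgebra_iff using q type_hom_to_fract_const by blast
  interpret P: kdomain "\<lambda>c :: 'a alg_closure. [:c:]" q
    unfolding kdomain_def kalgebra_iff using q type_hom_const_poly by blast
  interpret j: type_hom "to_ac :: 'a alg_closure poly fract \<Rightarrow> _" by (rule type_hom_to_ac)
  define t where "t = (to_fract tvar :: 'a alg_closure poly fract)"
  define ev where "ev = (\<lambda>z. ev1 (to_ac :: 'a alg_closure poly fract \<Rightarrow> _) z)"
  have ev_hom: "type_hom (ev z)" for z unfolding ev_def by (rule j.type_hom_ev1)
  have ev_pCons: "ev z (pCons a p) = to_ac a + z * ev z p" for z a p
    unfolding ev_def by (rule j.ev1_pCons)
  have ev_0: "ev z 0 = 0" for z unfolding ev_def by (rule j.ev1_0)
  define aff where "aff = (\<lambda>\<gamma>. E.aff rat_t 1 \<gamma>)"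
  have nzE: "moore2 q (rat_t :: 'a alg_closure poly fract alg_closure) 1 \<noteq> 0"
  proof -
    have "moore2 q (rat_t :: 'a alg_closure poly fract alg_closure) 1 = to_ac (to_fract (moore2 q tvar 1))"
      unfolding type_hom.hom_moore2[OF type_hom_to_fract] j.hom_moore2 by simp
    then show ?thesis unfolding moore2_t using frob_poly_neq_0[OF E.q_gt_1] by simp
  qed
  define e where "e = (dickson q tvar 1 :: 'a alg_closure poly)"
  have eE: "dickson q rat_t 1 = (to_ac (to_fract e) :: 'a alg_closure poly fract alg_closure)"
    unfolding e_def type_hom.hom_dickson[OF type_hom_to_fract] j.hom_dickson by simp
  obtain a where a: "order a e = 1" unfolding e_def by (rule dickson_t_root[OF P.kalgebra_axioms])
  have "e \<noteq> 0" unfolding e_def dickson_t[OF P.kalgebra_axioms]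
  proof
    assume "1 + (frob_poly q :: 'a alg_closure poly) ^ (q - 1) = 0"
    then have "poly (1 + (frob_poly q :: 'a alg_closure poly) ^ (q - 1)) 0 = 0" by simp
    then show False using E.q_gt_1 by (simp add: frob_poly_def poly_monom power_0_left)
  qed
  define v where "v = span_poly q rat_t 1 w"
  have veq: "v ^ (q - 1) = - (to_ac (to_fract e) ^ q)"
    using w unfolding dgz_def v_def eE by (simp add: eq_neg_iff_add_eq_0)
  have "v \<noteq> 0"
  proof
    assume "v = 0"
    then show False using veq E.q_gt_1 \<open>e \<noteq> 0\<close> by (simp add: power_0_left)
  qed
  have inj: "inj (\<lambda>\<gamma>. aff \<gamma> w)"
    unfolding aff_def using E.inj_on_aff[OF nzE] \<open>v \<noteq> 0\<close> v_def by simp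

  \<comment> \<open>A relation of least degree serves as the minimal polynomial of \<open>w\<close>
    over k(t).\<close>
  define m where "m = (LEAST n. \<exists>p. p \<noteq> 0 \<and> ev w p = 0 \<and> degree p = n)"
  have g': "ev w g = 0" using g by (simp add: ev_def ev1_def)
  then have "\<exists>p. p \<noteq> 0 \<and> ev w p = 0 \<and> degree p = m"
    unfolding m_def using g(1) by (intro LeastI_ex[of "\<lambda>n. \<exists>p. p \<noteq> 0 \<and> ev w p = 0 \<and> degree p = n"]) blast
  then obtain p where p: "p \<noteq> 0" "ev w p = 0" "degree p = m" by blast
  have least: "m \<le> degree r" if "r \<noteq> 0" "ev w r = 0" for r
    unfolding m_def using that by (intro Least_le) blast
  have mN: "m < N" using least[OF g(1) g'] small by (simp add: N_def)
  have m0: "m > 0"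
  proof (rule ccontr)
    assume "\<not> m > 0"
    then obtain c where "p = [:c:]" using p(3) by (auto elim: degree_eq_zeroE)
    then show False using p(1,2) by (simp add: ev_pCons ev_0)
  qed
  have mdvd: "p dvd r" if "ev w r = 0" for r
  proof -
    interpret w: type_hom "ev w" by (rule ev_hom)
    have "ev w (r mod p) = ev w (r - r div p * p)" by (simp add: minus_div_mult_eq_mod)
    also have "\<dots> = 0" using that p(2) by simp
    finally have "r mod p = 0"
      using least[of "r mod p"] degree_mod_less[OF p(1), of r] p(3) by fastforce
    then show ?thesis by (simp add: dvd_eq_mod_eq_0)
  qed
  have transfer: "ev z r = 0" if rz: "ev w r = 0" "ev z p = 0" for r z
  proof -
    interpret z: type_hom "ev z" by (rule ev_hom)
    obtain s where "r = p * s" using mdvd[OF rz(1)] by (elim dvdE)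
    then show ?thesis using rz(2) by simp
  qed
  have deg_map: "degree (map_poly to_ac r) = degree r" for r :: "'a alg_closure poly fract poly"
    by (intro degree_map_poly) auto
  define V where "V = span_poly q [:t:] [:1:] [:0, 1:]"
  have evC: "ev z [:c:] = to_ac c" "ev z [:0, 1:] = z" for z c by (simp_all add: ev_pCons ev_0)
  have evV: "ev z V = span_poly q rat_t 1 z" for z
    unfolding V_def type_hom.hom_span_poly[OF ev_hom] evC by (simp add: t_def)
  define f where "f = dgz q [:t:] [:1:] [:0, 1:]"
  have evf: "ev z f = dgz q rat_t 1 z" for z
    unfolding f_def type_hom.hom_dgz[OF ev_hom] evC by (simp add: t_def)
  have f: "degree f = N" "lead_coeff f = 1"
    unfolding f_def N_def by (rule degree_dgz[OF E.q_ge_2])+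
  then have "f \<noteq> 0" by auto

  \<comment> \<open>H plays the role of the Galois group of \<open>w\<close>. It has at least
    \<open>m\<close> elements, because the remaining points of the orbit are roots of the cofactor
    of \<open>p\<close> in \<open>F\<close>, which has degree N - m.\<close>
  define H where "H = {\<gamma>\<in>aff_group. ev (aff \<gamma> w) p = 0}"
  have finH: "finite H" unfolding H_def by (rule finite_subset[OF _ finite_aff_group]) auto
  have cardG: "card (aff_group :: ('a \<times> 'a \<times> 'a) set) = N"
    unfolding N_def by (rule E.card_aff_group)
  have card_img: "card ((\<lambda>\<gamma>. aff \<gamma> w) ` S) = card S" for S
    by (rule card_image) (rule inj_on_subset[OF inj], simp)
  have cardH: "card H \<ge> m"
  proof -
    obtain s where s: "f = p * s" using mdvd[of f] w evf by (auto elim: dvdE)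
    then have s0: "s \<noteq> 0" using \<open>f \<noteq> 0\<close> by auto
    have "degree f = m + degree s" unfolding s using p s0 by (simp add: degree_mult_eq)
    have "(\<lambda>\<gamma>. aff \<gamma> w) ` (aff_group - H) \<subseteq> {z. poly (map_poly to_ac s) z = 0}"
    proof safe
      fix \<gamma> :: "'a \<times> 'a \<times> 'a" assume \<gamma>: "\<gamma> \<in> aff_group" "\<gamma> \<notin> H"
      interpret z: type_hom "ev (aff \<gamma> w)" by (rule ev_hom)
      have "ev (aff \<gamma> w) f = 0"
        unfolding evf aff_def E.dgz_aff[OF nzE \<gamma>(1)] by (rule w)
      moreover have "ev (aff \<gamma> w) p \<noteq> 0" using \<gamma> by (simp add: H_def)
      ultimately have "ev (aff \<gamma> w) s = 0" unfolding s by simp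
      then show "poly (map_poly to_ac s) (aff \<gamma> w) = 0" by (simp add: ev_def ev1_def)
    qed
    then have "card ((\<lambda>\<gamma>. aff \<gamma> w) ` (aff_group - H)) \<le> degree (map_poly to_ac s)"
      using s0 by (intro card_roots_le) (auto simp: map_poly_eq_0_iff)
    then have "card (aff_group - H) \<le> degree s" by (simp add: card_img deg_map)
    moreover have "card (aff_group - H) = N - card H"
      unfolding cardG[symmetric] by (rule card_Diff_subset[OF finH]) (auto simp: H_def)
    ultimately show ?thesis using \<open>degree f = m + degree s\<close> f(1) by linarith
  qed
  \<comment> \<open>Descent to k(t): reduced modulo \<open>p\<close>, an expression has degree less
    than \<open>m\<close>; if it takes one value at the \<open>m\<close> or more conjugates it is
    constant.\<close>
  have fixed: "c \<in> range to_ac" if "\<And>\<gamma>. \<gamma> \<in> H \<Longrightarrow> ev (aff \<gamma> w) r = c" for r c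
  proof -
    define r' where "r' = map_poly to_ac (r mod p) - [:c:]"
    have "ev (aff \<gamma> w) (r mod p) = c" if "\<gamma> \<in> H" for \<gamma>
    proof -
      interpret z: type_hom "ev (aff \<gamma> w)" by (rule ev_hom)
      have "ev (aff \<gamma> w) (r mod p) = ev (aff \<gamma> w) (r - r div p * p)" by (simp add: minus_div_mult_eq_mod)
      also have "\<dots> = c" using that \<open>\<And>\<gamma>. \<gamma> \<in> H \<Longrightarrow> ev (aff \<gamma> w) r = c\<close> by (simp add: H_def)
      finally show ?thesis .
    qed
    then have sub: "(\<lambda>\<gamma>. aff \<gamma> w) ` H \<subseteq> {z. poly r' z = 0}"
      by (auto simp: r'_def ev_def ev1_def)
    have "degree (r mod p) < m"
      using degree_mod_less'[of p r] p m0 by (cases "r mod p = 0") auto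
    then have "degree r' < m"
      unfolding r'_def using m0 by (intro degree_diff_less) (auto simp: deg_map)
    then have "r' = 0"
      using card_roots_le[OF _ sub] cardH by (force simp: card_img)
    then have "coeff r' 0 = 0" by simp
    then have "c = to_ac (coeff (r mod p) 0)" by (simp add: r'_def coeff_map_poly)
    then show ?thesis by blast
  qed
  define comp where "comp = (\<lambda>(c::'a, a, b) (c', a', b'). (c * c', c * a' + a, c * b' + b))"
  have comp: "comp \<gamma> \<delta> \<in> H" if "\<gamma> \<in> H" "\<delta> \<in> H" for \<gamma> \<delta>
  proof -
    obtain c a b where \<gamma>: "\<gamma> = (c, a, b)" by (cases \<gamma>)
    obtain c' a' b' where \<delta>: "\<delta> = (c', a', b')" by (cases \<delta>)
    \<comment> \<open>The composition of \<open>p\<close> with the affine map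
      \<open>\<gamma>\<close>. Since it is defined over k(t) and vanishes at \<open>w\<close>, it
      vanishes at every root of \<open>p\<close>.\<close>
    define r where "r = pcompose p [:to_fract [:to_ac a:] * t + to_fract [:to_ac b:], to_fract [:to_ac c:]:]"
    have evr: "ev z r = ev (aff \<gamma> z) p" for z
    proof -
      interpret z: type_hom "ev z" by (rule ev_hom)
      have "ev z (pcompose p s) = ev (ev z s) p" for s
        by (induction p) (simp_all add: pcompose_pCons ev_pCons ev_0 evC)
      then show ?thesis
        unfolding r_def by (simp add: ev_pCons ev_0 aff_def E.aff_def \<gamma> t_def algebra_simps)
    qed
    have "ev w r = 0" unfolding evr using that(1) by (simp add: H_def)
    moreover have "ev (aff \<delta> w) p = 0" using that(2) by (simp add: H_def)
    ultimately have "ev (aff \<delta> w) r = 0" by (rule transfer)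
    then have "ev (aff \<gamma> (aff \<delta> w)) p = 0" unfolding evr .
    moreover have "aff \<gamma> (aff \<delta> w) = aff (comp \<gamma> \<delta>) w"
      unfolding \<gamma> \<delta> comp_def prod.case aff_def E.aff_def fst_conv snd_conv to_ac_add to_ac_mult
        E.hom_add E.hom_mult by (simp only: algebra_simps)
    ultimately show ?thesis using that by (auto simp: H_def aff_group_def comp_def \<gamma> \<delta>)
  qed
  have one: "(1, 0, 0) \<in> H" using p(2) by (simp add: H_def aff_group_def aff_def E.aff_def)
  \<comment> \<open>Right translation maps the finite set H injectively to itself, hence onto; this
    replaces closure under inverses.\<close>
  have quot: "(1, a - a', b - b') \<in> H" if "(c, a, b) \<in> H" "(c, a', b') \<in> H" for a b c a' b'
  proof -
    have c: "c \<noteq> 0" using that by (simp add: H_def aff_group_def)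
    have inj: "inj_on (\<lambda>\<gamma>. comp \<gamma> (c, a', b')) H"
      using c by (auto simp: inj_on_def comp_def)
    have sub: "(\<lambda>\<gamma>. comp \<gamma> (c, a', b')) ` H \<subseteq> H" using comp[OF _ that(2)] by blast
    have "(\<lambda>\<gamma>. comp \<gamma> (c, a', b')) ` H = H" by (rule endo_inj_surj[OF finH sub inj])
    then have "(c, a, b) \<in> (\<lambda>\<gamma>. comp \<gamma> (c, a', b')) ` H" using that(1) by (simp only:)
    then obtain \<gamma> where "\<gamma> \<in> H" "(c, a, b) = comp \<gamma> (c, a', b')" by (rule imageE)
    then show ?thesis using c by (cases \<gamma>) (auto simp: comp_def)
  qed

  \<comment> \<open>The linear parts form a subgroup of the multiplicative group of the finite
    field, so c^d = 1 for its order d, and v^d is invariant under H.\<close>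
  define C where "C = fst ` H"
  define d where "d = card C"
  have finC: "finite C" and C0: "0 \<notin> C" and C1: "1 \<in> C"
    using finH one by (auto simp: C_def H_def aff_group_def image_iff)
  have power_d: "c ^ d = 1" if "c \<in> C" for c
  proof -
    have sub: "(\<lambda>x. c * x) ` C \<subseteq> C"
    proof
      fix y assume "y \<in> (\<lambda>x. c * x) ` C"
      then obtain \<delta> where "y = c * fst \<delta>" "\<delta> \<in> H" unfolding C_def by blast
      moreover obtain \<gamma> where "c = fst \<gamma>" "\<gamma> \<in> H" using \<open>c \<in> C\<close> unfolding C_def by blast
      ultimately have y: "y = c * fst \<delta>" "\<delta> \<in> H" "c = fst \<gamma>" "\<gamma> \<in> H" by blast+
      then have "y = fst (comp \<gamma> \<delta>)" by (simp add: comp_def split: prod.split)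
      then show "y \<in> C" using comp[OF y(4,2)] by (simp add: C_def)
    qed
    have inj: "inj_on (\<lambda>x. c * x) C" using that C0 by (auto simp: inj_on_def)
    have *: "(\<lambda>x. c * x) ` C = C" by (rule endo_inj_surj[OF finC sub inj])
    have "\<Prod>C = (\<Prod>x\<in>C. c * x)"
      using prod.reindex[OF inj, of "\<lambda>x. x"] unfolding * by simp
    also have "\<dots> = c ^ d * \<Prod>C" by (simp add: prod.distrib d_def)
    finally show ?thesis using finC C0 by (auto simp: prod_zero_iff)
  qed
  have "v ^ d \<in> range to_ac"
  proof (rule fixed)
    fix \<gamma> assume \<gamma>: "\<gamma> \<in> H"
    have "ev (aff \<gamma> w) (V ^ d) = (emb_rat (to_ac (fst \<gamma>)) * v) ^ d"
      unfolding type_hom.hom_power[OF ev_hom] evV v_def aff_def E.span_poly_aff[OF nzE] ..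
    also have "\<dots> = emb_rat (to_ac (fst \<gamma> ^ d)) * v ^ d"
      by (simp only: power_mult_distrib E.hom_power to_ac_power)
    also have "\<dots> = v ^ d" using power_d[of "fst \<gamma>"] \<gamma> by (simp add: C_def)
    finally show "ev (aff \<gamma> w) (V ^ d) = v ^ d" .
  qed
  then obtain \<rho> where \<rho>: "v ^ d = to_ac \<rho>" by blast
  have "to_ac (\<rho> ^ (q - 1)) = (v ^ d) ^ (q - 1)" by (simp add: \<rho>)
  also have "\<dots> = (v ^ (q - 1)) ^ d" by (simp add: mult.commute flip: power_mult)
  also have "\<dots> = to_ac ((- (to_fract e ^ q)) ^ d)" unfolding veq by simp
  finally have "\<rho> ^ (q - 1) = (- (to_fract e ^ q)) ^ d" by (simp only: to_ac_eq_iff)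
  \<comment> \<open>Orders at a simple zero of \<open>e\<close> are compared here; q is coprime to q
    - 1, so d is divisible by q - 1 and all linear parts occur.\<close>
  then have "q - 1 dvd q * d" using a \<open>e \<noteq> 0\<close> by (rule kummer_obstruction)
  then have "q - 1 dvd d"
    using coprime_diff_one_left_nat[OF E.q_gt_0] by (simp add: coprime_dvd_mult_right_iff)
  moreover have "d > 0" using C1 finC by (auto simp: d_def card_gt_0_iff)
  ultimately have "q - 1 \<le> d" by (rule dvd_imp_le)
  then have "card (UNIV - {0 :: 'a}) \<le> card C" by (simp add: d_def card_Diff_singleton q)
  then have "C = UNIV - {0}" using C0 by (intro card_seteq) auto
  then have full: "\<exists>a b. (c, a, b) \<in> H" if "c \<noteq> 0" for c
  proof -
    have "c \<in> C" using that \<open>C = UNIV - {0}\<close> by blast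
    then obtain \<gamma> where "\<gamma> \<in> H" "c = fst \<gamma>" unfolding C_def by blast
    then show ?thesis by (cases \<gamma>) auto
  qed

  have scale: "(1, c * a, c * b) \<in> H" if "(1, a, b) \<in> H" for a b c
  proof (cases "c = 0")
    case False
    then obtain m n where mn: "(c, m, n) \<in> H" using full by blast
    have "(c, c * a + m, c * b + n) \<in> H" using comp[OF mn that] by (simp add: comp_def)
    from quot[OF this mn] show ?thesis by simp
  qed (use one in simp)
  have add: "(1, a' + a, b' + b) \<in> H" if "(1, a, b) \<in> H" "(1, a', b') \<in> H" for a b a' b'
    using comp[OF that] by (simp add: comp_def)
  \<comment> \<open>If all translations were in H, then H would be the full group, and
    \<open>p\<close> would have N roots, more than its degree.\<close>
  have "\<exists>a b. (1, a, b) \<notin> H"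
  proof (rule ccontr)
    assume all: "\<nexists>a b. (1, a, b) \<notin> H"
    have "(c, a, b) \<in> H" if c: "c \<noteq> 0" for c a b
    proof -
      obtain m n where mn: "(c, m, n) \<in> H" using full[OF c] by blast
      have "(1, a - m, b - n) \<in> H" using all by blast
      from comp[OF this mn] have "comp (1, a - m, b - n) (c, m, n) \<in> H" .
      then show ?thesis by (simp add: comp_def)
    qed
    then have "aff_group \<subseteq> H" by (auto simp: aff_group_def)
    then have "N \<le> card H" unfolding cardG[symmetric] by (intro card_mono finH)
    moreover have "card H \<le> m"
    proof -
      have sub: "(\<lambda>\<gamma>. aff \<gamma> w) ` H \<subseteq> {z. poly (map_poly to_ac p) z = 0}"
        by (auto simp: H_def ev_def ev1_def)
      have "map_poly to_ac p \<noteq> 0" using p(1,3) m0 deg_map[of p] by auto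
      from card_roots_le[OF this sub] show ?thesis by (simp only: card_img deg_map p(3))
    qed
    ultimately show False using mN by simp
  qed
  then obtain a0 b0 where ab0: "(1, a0, b0) \<notin> H" by blast
  \<comment> \<open>A proper subspace of a plane lies in a line. If H contains no translation but
    the identity, any line will do.\<close>
  have "\<exists>l1 l2. (l1, l2) \<noteq> (0, 0) \<and> (\<forall>a b. (1, a, b) \<in> H \<longrightarrow> (\<exists>s. a = s * l1 \<and> b = s * l2))"
  proof (cases "\<exists>l1 l2. (l1, l2) \<noteq> (0, 0) \<and> (1, l1, l2) \<in> H")
    case True
    then obtain l1 l2 where l: "(l1, l2) \<noteq> (0, 0)" "(1, l1, l2) \<in> H" by blast
    have "\<exists>s. a = s * l1 \<and> b = s * l2" if ab: "(1, a, b) \<in> H" for a b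
    proof -
      have D: "a * l2 - b * l1 = 0"
      proof (rule ccontr)
        assume D: "a * l2 - b * l1 \<noteq> 0"
        define r s where "r = (a0 * l2 - b0 * l1) / (a * l2 - b * l1)"
          and "s = (a * b0 - b * a0) / (a * l2 - b * l1)"
        have "a0 = r * a + s * l1" "b0 = r * b + s * l2"
          using D by (simp_all add: r_def s_def divide_simps) (simp_all add: algebra_simps)
        then show False using add[OF scale[OF l(2), of s] scale[OF ab, of r]] ab0 by simp
      qed
      show ?thesis
      proof (cases "l1 = 0")
        case True
        then show ?thesis using D l(1) by (intro exI[of _ "b / l2"]) auto
      next
        case False
        then show ?thesis using D by (intro exI[of _ "a / l1"]) (auto simp: field_simps)
      qed
    qed
    then show ?thesis using l(1) by blast
  next
    case False
    show ?thesis
    proof (rule exI[of _ 0], rule exI[of _ 1], intro conjI allI impI)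
      fix a b assume "(1, a, b) \<in> H"
      then have "(a, b) = (0, 0)" using False by blast
      then show "\<exists>s. a = s * 0 \<and> b = s * 1" by simp
    qed simp
  qed
  then obtain l1 l2 where l0: "(l1, l2) \<noteq> (0, 0)"
    and l: "\<And>a b. (1, a, b) \<in> H \<Longrightarrow> \<exists>s. a = s * l1 \<and> b = s * l2" by blast
  \<comment> \<open>The linear parts commute, so the two products of an element having linear part z
    with any other element of H differ by a translation in H. Hence the fixed point of one element
    with z different from 1 is fixed by all of H modulo the line. For q = 2 only c = 1
    occurs.\<close>
  have "\<exists>k1 k2. \<forall>c a b. (c, a, b) \<in> H \<longrightarrow> (\<exists>s. a - (1 - c) * k1 = s * l1 \<and> b - (1 - c) * k2 = s * l2)"
  proof (cases "\<exists>z::'a. z \<noteq> 0 \<and> z \<noteq> 1")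
    case True
    then obtain z :: 'a where z: "z \<noteq> 0" "1 - z \<noteq> 0" by auto
    obtain m n where mn: "(z, m, n) \<in> H" using full[OF z(1)] by blast
    have "\<exists>s. a - (1 - c) * (m / (1 - z)) = s * l1 \<and> b - (1 - c) * (n / (1 - z)) = s * l2"
      if "(c, a, b) \<in> H" for c a b
    proof -
      have "(z * c, z * a + m, z * b + n) \<in> H" "(z * c, c * m + a, c * n + b) \<in> H"
        using comp[OF mn that] comp[OF that mn] by (auto simp: comp_def mult.commute)
      from l[OF quot[OF this]] obtain s where
        s: "z * a + m - (c * m + a) = s * l1" "z * b + n - (c * n + b) = s * l2" by blast
      have "a - (1 - c) * (m / (1 - z)) = - (z * a + m - (c * m + a)) / (1 - z)"
        "b - (1 - c) * (n / (1 - z)) = - (z * b + n - (c * n + b)) / (1 - z)"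
        using z by (simp_all add: divide_simps) (simp_all add: algebra_simps)
      then show ?thesis unfolding s by (intro exI[of _ "- s / (1 - z)"]) auto
    qed
    then show ?thesis by blast
  next
    case False
    have "\<exists>s. a - (1 - c) * 0 = s * l1 \<and> b - (1 - c) * 0 = s * l2" if "(c, a, b) \<in> H" for c a b
    proof -
      have "c = 1" using that False by (auto simp: H_def aff_group_def)
      then show ?thesis using l that by simp
    qed
    then show ?thesis by blast
  qed
  then obtain k1 k2 where k: "\<And>c a b. (c, a, b) \<in> H \<Longrightarrow>
    \<exists>s. a - (1 - c) * k1 = s * l1 \<and> b - (1 - c) * k2 = s * l2" by blast

  define lP where "lP = [:to_ac l1:] * tvar + [:to_ac l2:] * 1"
  define kP where "kP = [:to_ac k1:] * tvar + [:to_ac k2:] * 1"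
  define lE where "lE = (to_ac (to_fract lP) :: 'a alg_closure poly fract alg_closure)"
  define kE where "kE = (to_ac (to_fract kP) :: 'a alg_closure poly fract alg_closure)"
  have nzP: "moore2 q tvar (1 :: 'a alg_closure poly) \<noteq> 0"
    unfolding moore2_t by (rule frob_poly_neq_0[OF E.q_gt_1])
  have lP0: "lP \<noteq> 0" unfolding lP_def using l0 by (subst P.comb_eq_0[OF nzP]) auto
  have lE: "lE = emb_rat (to_ac l1) * rat_t + emb_rat (to_ac l2) * 1"
    and kE: "kE = emb_rat (to_ac k1) * rat_t + emb_rat (to_ac k2) * 1"
    unfolding lE_def lP_def kE_def kP_def by (simp_all only: to_fract_add to_fract_mult to_fract_1 to_ac_add to_ac_mult to_ac_1)
  \<comment> \<open>\<open>L\<close> vanishes on the line, so an element of H with linear part c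
    multiplies L(w - k) by c.\<close>
  define L where "L = (\<lambda>z. z ^ q - lE ^ (q - 1) * z)"
  have L_add: "L (y + z) = L y + L z" for y z by (simp add: L_def E.frob_add algebra_simps)
  have L_scale: "L (emb_rat (to_ac c) * z) = emb_rat (to_ac c) * L z" for c z
    unfolding L_def power_mult_distrib E.emb_to_ac_power by (simp add: algebra_simps)
  have L_l: "L lE = 0" unfolding L_def using power_minus_mult[OF E.q_gt_0, of lE] by simp
  define LP where "LP = ([:0, 1:] - [:to_fract kP:]) ^ q - [:to_fract lP ^ (q - 1):] * ([:0, 1:] - [:to_fract kP:])"
  have evLP: "ev z LP = L (z - kE)" for z
    unfolding LP_def type_hom.hom_diff[OF ev_hom] type_hom.hom_mult[OF ev_hom]
      type_hom.hom_power[OF ev_hom] evC L_def by (simp add: kE_def lE_def)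
  define w1 where "w1 = L (w - kE)"
  have pow2: "y ^ (q - 2) * y = y ^ (q - 1)" for y :: "'a alg_closure poly fract alg_closure"
    using power_minus_mult[of "q - 1" y] E.q_gt_1 by (simp add: numeral_2_eq_2)
  \<comment> \<open>The factor v^(q-2) is multiplied by c^(q-2), and c^(q-1) = 1 makes the product
    invariant. So \<open>w1\<close> is a multiple of \<open>v\<close> by an element of k(t).\<close>
  have "w1 * v ^ (q - 2) \<in> range to_ac"
  proof (rule fixed)
    fix \<gamma> assume \<gamma>: "\<gamma> \<in> H"
    obtain c a b where cab: "\<gamma> = (c, a, b)" by (cases \<gamma>)
    obtain s where s: "a - (1 - c) * k1 = s * l1" "b - (1 - c) * k2 = s * l2"
      using k \<gamma> cab by blast
    have ab: "a = s * l1 + k1 - c * k1" "b = s * l2 + k2 - c * k2"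
      using s by (simp_all add: algebra_simps)
    have "aff \<gamma> w - kE = emb_rat (to_ac c) * (w - kE) + emb_rat (to_ac s) * lE"
      unfolding cab aff_def E.aff_def kE lE fst_conv snd_conv unfolding ab to_ac_add to_ac_diff to_ac_mult
        E.hom_add E.hom_diff E.hom_mult by (simp only: algebra_simps)
    then have "ev (aff \<gamma> w) LP = emb_rat (to_ac c) * w1"
      unfolding evLP w1_def by (simp only: L_add L_scale L_l mult_zero_right add_0_right)
    moreover have "ev (aff \<gamma> w) (V ^ (q - 2)) = emb_rat (to_ac c) ^ (q - 2) * v ^ (q - 2)"
      unfolding type_hom.hom_power[OF ev_hom] evV v_def aff_def E.span_poly_aff[OF nzE] cab
      by (simp add: power_mult_distrib)
    ultimately have "ev (aff \<gamma> w) (LP * V ^ (q - 2)) =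
       (emb_rat (to_ac c) ^ (q - 2) * emb_rat (to_ac c)) * (w1 * v ^ (q - 2))"
      unfolding type_hom.hom_mult[OF ev_hom] by (simp add: mult_ac)
    also have "emb_rat (to_ac c) ^ (q - 2) * emb_rat (to_ac c) = emb_rat (to_ac c) ^ (q - 1)"
      by (rule pow2)
    also have "\<dots> = emb_rat (to_ac c ^ (q - 1))" by (simp only: E.hom_power)
    also have "to_ac c ^ (q - 1) = 1"
      using \<gamma> cab by (intro E.to_ac_power_minus_1) (auto simp: H_def aff_group_def)
    finally show "ev (aff \<gamma> w) (LP * V ^ (q - 2)) = w1 * v ^ (q - 2)" by simp
  qed
  then obtain b' where b': "w1 * v ^ (q - 2) = to_ac b'" by blast
  define b where "b = - b' / to_fract e ^ q"
  have "v ^ (q - 2) * v = v ^ (q - 1)"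
    by (rule pow2)
  then have "w1 * v ^ (q - 1) = to_ac b' * v" by (metis b' mult.assoc)
  then have w1: "w1 = to_ac b * v"
    unfolding veq using \<open>e \<noteq> 0\<close> by (simp add: b_def field_simps) (metis minus_minus)
  define th where "th = e - lP ^ (q * (q - 1))"
  have "span_poly q rat_t 1 lE = 0" unfolding lE by (rule E.span_poly_comb[OF nzE])
  moreover have "lE \<noteq> 0" using lP0 by (simp add: lE_def)
  ultimately have fac: "span_poly q rat_t 1 z = L z ^ q - (dickson q rat_t 1 - lE ^ (q * (q - 1))) * L z" for z
    unfolding L_def using E.frob_diff E.q_gt_1 by (intro span_poly_factor(2)) auto
  have th: "dickson q rat_t 1 - lE ^ (q * (q - 1)) = to_ac (to_fract th)"
    unfolding eE th_def lE_def by simp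
  \<comment> \<open>Substituting \<open>w1 = b v\<close> into the factorization of \<open>V\<close>
    and dividing by \<open>v\<close> leaves an equation for \<open>b\<close> in k(t).\<close>
  have "v = span_poly q rat_t 1 (w - kE) + span_poly q rat_t 1 kE"
    unfolding v_def E.span_poly_add[symmetric] by simp
  also have "span_poly q rat_t 1 kE = 0" unfolding kE by (rule E.span_poly_comb[OF nzE])
  also have "span_poly q rat_t 1 (w - kE) = w1 ^ q - to_ac (to_fract th) * w1"
    unfolding fac th w1_def ..
  also have "\<dots> + 0 = (to_ac b ^ q * v ^ (q - 1) - to_ac (to_fract th) * to_ac b) * v"
    unfolding w1 power_mult_distrib using power_minus_mult[OF E.q_gt_0, of v] by (simp add: algebra_simps)
  finally have "to_ac b ^ q * v ^ (q - 1) - to_ac (to_fract th) * to_ac b = 1"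
    using \<open>v \<noteq> 0\<close> by simp
  note one = this[unfolded veq]
  have "to_ac ((b * to_fract e) ^ q + to_fract th * b + 1) =
    - (to_ac b ^ q * (- (to_ac (to_fract e) ^ q)) - to_ac (to_fract th) * to_ac b) + 1"
    by (simp add: power_mult_distrib algebra_simps)
  also have "\<dots> = 0" unfolding one by simp
  finally have "to_ac ((b * to_fract e) ^ q + to_fract th * b + 1) = 0" .
  then have eq: "(b * to_fract e) ^ q + to_fract th * b + 1 = 0" by (simp only: to_ac_eq_0_iff)
  \<comment> \<open>At a value in the finite field where the linear form \<open>l\<close> does not
    vanish, \<open>e\<close> is 1, and \<open>th\<close> has order q - 1 because its product with
    l^(q-1) is (t - t^q)^(q-1).\<close>
  obtain t1 :: 'a where t1: "l1 * t1 + l2 \<noteq> 0"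
  proof (cases "l1 = 0")
    case True then show ?thesis using l0 that[of 0] by auto
  next
    case False then show ?thesis using that[of "(1 - l2) / l1"] by simp
  qed
  have "poly lP (to_ac t1) = to_ac (l1 * t1 + l2)" by (simp add: lP_def)
  then have lPt: "poly lP (to_ac t1) \<noteq> 0" using t1 by (simp del: to_ac_add to_ac_mult)
  have froot: "poly (frob_poly q) (to_ac t1) = 0"
    by (simp add: frob_poly_def poly_monom q finite_field_power_card_eq_same flip: to_ac_power)
  have "poly e (to_ac t1) = 1"
    unfolding e_def dickson_t[OF P.kalgebra_axioms] using E.q_gt_1 by (simp add: froot power_0_left)
  then have "poly e (to_ac t1) \<noteq> 0" by simp
  have thl: "th * lP ^ (q - 1) = frob_poly q ^ (q - 1)"
    unfolding th_def e_def moore2_t[symmetric]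
    using P.frob_diff E.q_gt_1 lP0 P.span_poly_comb[OF nzP]
    by (intro span_poly_factor(1)) (auto simp: lP_def)
  have f0: "frob_poly q \<noteq> (0 :: 'a alg_closure poly)" by (rule frob_poly_neq_0[OF E.q_gt_1])
  have th0: "th \<noteq> 0" using thl f0 by auto
  have kk: "kalgebra (\<lambda>c::'a alg_closure. c) q" by (simp add: kalgebra_iff q type_hom_id)
  have "order (to_ac t1) (frob_poly q :: 'a alg_closure poly) = 1"
    using order_frob_poly[OF of_nat_q[OF kk] E.q_gt_1, of "to_ac t1"] froot f0 order_root[of "frob_poly q" "to_ac t1"]
    by fastforce
  then have "order (to_ac t1) (th * lP ^ (q - 1)) = q - 1"
    unfolding thl using f0 by (simp add: order_power_eq)
  then have "order (to_ac t1) th = q - 1"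
    using th0 lP0 lPt by (simp add: order_mult order_power_eq order_0I)
  from artin_schreier_obstruction[OF eq P.frob_add \<open>poly e (to_ac t1) \<noteq> 0\<close> this th0 E.q_ge_2]
  show False .
qed

section \<open>Generic points\<close>

lemma monic_division:
  fixes f p :: "'c::idom poly"
  assumes "lead_coeff f = 1"
  obtains s r where "p = f * s + r" "r = 0 \<or> degree r < degree f"
proof -
  obtain s r where sr: "pseudo_divmod p f = (s, r)" by fastforce
  have "f \<noteq> 0" using assms by auto
  from pseudo_divmod[OF this sr] show ?thesis
    using assms by (intro that[of s r]) auto
qed

lemma monic_dvd_degree_less:
  fixes f r :: "'c::idom poly"
  assumes "f dvd r" "r = 0 \<or> degree r < degree f"
  shows "r = 0"
  using assms by (metis dvd_imp_degree_le not_less)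

lemma infinite_alg_closed: "infinite (UNIV :: 'c::alg_closed_field set)"
proof
  assume fin: "finite (UNIV :: 'c set)"
  define p :: "'c poly" where "p = (\<Prod>a\<in>UNIV. [:- a, 1:])"
  have deg: "degree p = card (UNIV :: 'c set)"
    unfolding p_def by (subst degree_prod_eq_sum_degree) auto
  have "card (UNIV :: 'c set) > 0" using fin by (simp add: card_gt_0_iff)
  then have "degree (p + 1) > 0" using deg by (subst degree_add_eq_left) auto
  then obtain x where "poly (p + 1) x = 0" using alg_closed_imp_poly_has_root by blast
  moreover have "poly p x = 0" using fin by (auto simp: p_def poly_prod prod_zero_iff)
  ultimately show False by simp
qed

lemma poly_eq_0_if_infinite:
  fixes p :: "'c::idom poly"
  assumes "infinite S" "\<And>x. x \<in> S \<Longrightarrow> poly p x = 0"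
  shows "p = 0"
proof (rule ccontr)
  assume "p \<noteq> 0"
  then have "finite {x. poly p x = 0}" by (rule poly_roots_finite)
  moreover have "S \<subseteq> {x. poly p x = 0}" using assms(2) by auto
  ultimately show False using assms(1) finite_subset by blast
qed

abbreviation (input) dgz_t :: "nat \<Rightarrow> 'c::comm_ring_1 poly poly"
  where "dgz_t q \<equiv> dgz q [:tvar:] [:1:] [:0, 1:]"

lemma ev1_emb_rat: "ev1 emb_rat rat_t p = to_ac (to_fract p)"
proof (induction p)
  case (pCons a p)
  have "pCons a p = [:a:] + tvar * p" by simp
  then have "to_ac (to_fract (pCons a p)) = emb_rat a + rat_t * to_ac (to_fract p)"
    by (simp only: to_fract_add to_fract_mult to_ac_add to_ac_mult)
  then show ?case by (simp add: type_hom.ev1_pCons[OF type_hom_emb_rat] pCons)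
qed (simp add: type_hom.ev1_0[OF type_hom_emb_rat])

lemma ev1_generic:
  fixes r :: "'c::field poly poly"
  shows "ev1 (ev1 emb_rat rat_t) w r = poly (map_poly to_ac (map_poly to_fract r)) w"
proof -
  have "ev1 emb_rat rat_t = (\<lambda>p :: 'c poly. to_ac (to_fract p))" by (rule ext) (rule ev1_emb_rat)
  then have "ev1 (ev1 emb_rat rat_t) w r = ev1 (\<lambda>p. to_ac (to_fract p)) w r" by (simp only:)
  then show ?thesis by (simp add: ev1_def map_poly_map_poly o_def)
qed

lemma obtain_generic_root:
  assumes "2 \<le> q"
  obtains w :: "'c::field poly fract alg_closure" where "dgz q rat_t 1 w = 0"
proof -
  let ?f = "dgz q [:rat_t:] [:1:] [:0, 1:] :: 'c poly fract alg_closure poly"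
  have "degree ?f > 0" using assms by (simp add: degree_dgz)
  then obtain w where w: "poly ?f w = 0" using alg_closed_imp_poly_has_root by blast
  have hom: "type_hom (\<lambda>p. poly p w)" by unfold_locales auto
  from w have "dgz q rat_t 1 w = 0"
    unfolding type_hom.hom_dgz[OF hom] by simp
  then show ?thesis by (rule that)
qed

section \<open>The coordinate ring of the chart y = 1, evaluated at a root over k(t)\<close>

locale generic_root =
  fixes q :: nat and w :: "'a::finite_field alg_closure poly fract alg_closure"
  assumes q: "q = CARD('a)" and w: "dgz q rat_t 1 w = 0"
begin

sublocale E: kdomain "emb_rat :: 'a alg_closure \<Rightarrow> _" q
  unfolding kdomain_def kalgebra_iff using q type_hom_emb_rat by blast

abbreviation evw :: "'a alg_closure poly fract alg_closure \<Rightarrow> 'a alg_closure poly poly \<Rightarrow> 'a alg_closure poly fract alg_closure"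
  where "evw \<equiv> ev1 (ev1 emb_rat rat_t)"

lemma type_hom_evw: "type_hom (evw z)"
  by (intro type_hom.type_hom_ev1 type_hom_emb_rat)

lemma evw_dgz: "evw z (dgz_t q) = dgz q rat_t 1 z"
proof -
  note h = type_hom.type_hom_ev1[OF type_hom_emb_rat]
  show ?thesis
    unfolding type_hom.hom_dgz[OF type_hom_evw]
    by (simp add: type_hom.ev1_pCons[OF h] type_hom.ev1_0[OF h] ev1_emb_rat)
qed

lemma evw_const: "evw z [:c:] = to_ac (to_fract c)"
proof -
  note h = type_hom.type_hom_ev1[OF type_hom_emb_rat]
  show ?thesis
    by (simp add: type_hom.ev1_pCons[OF h] type_hom.ev1_0[OF h] ev1_emb_rat)
qed

lemma dgz_t: "degree (dgz_t q :: 'a alg_closure poly poly) = q ^ 2 * (q - 1)"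
  "lead_coeff (dgz_t q :: 'a alg_closure poly poly) = 1"
  by (rule degree_dgz[OF E.q_ge_2])+

text \<open>The remainder modulo the monic polynomial \<open>dgz_t q\<close> would be a relation for
  \<open>w\<close> of degree less than q^2 (q - 1).\<close>

lemma evw_eq_0_imp_dvd:
  assumes "evw w h = 0"
  shows "dgz_t q dvd h"
proof -
  obtain s r where sr: "h = dgz_t q * s + r" "r = 0 \<or> degree r < degree (dgz_t q :: 'a alg_closure poly poly)"
    by (rule monic_division[OF dgz_t(2)])
  interpret w: type_hom "evw w" by (rule type_hom_evw)
  have "evw w r = 0" using assms unfolding sr(1) by (simp add: evw_dgz w)
  define g where "g = map_poly to_fract r"
  have "degree g = degree r" unfolding g_def by (intro degree_map_poly) auto
  have "r = 0"
  proof (rule ccontr)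
    assume "r \<noteq> 0"
    then have "g \<noteq> 0" by (simp add: g_def map_poly_eq_0_iff)
    moreover have "poly (map_poly to_ac g) w = 0"
      using \<open>evw w r = 0\<close> unfolding ev1_generic g_def .
    ultimately have "q ^ 2 * (q - 1) \<le> degree g" by (rule generic_root_degree[OF q w])
    then show False using sr(2) \<open>r \<noteq> 0\<close> \<open>degree g = degree r\<close> dgz_t(1) by simp
  qed
  then show ?thesis using sr(1) by simp
qed

lemma evw_eq_0_iff: "evw w h = 0 \<longleftrightarrow> dgz_t q dvd h"
proof
  interpret w: type_hom "evw w" by (rule type_hom_evw)
  assume "dgz_t q dvd h"
  then show "evw w h = 0" by (auto simp: evw_dgz w)
qed (rule evw_eq_0_imp_dvd)

text \<open>The constant term of an algebraic equation for a non-zero element is a multiple of it.\<close>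

lemma dgz_t_norm:
  fixes h :: "'a alg_closure poly poly"
  assumes "\<not> dgz_t q dvd h"
  obtains h' c r where "c \<noteq> 0" "h * h' = [:c:] + dgz_t q * r"
proof -
  interpret w: type_hom "evw w" by (rule type_hom_evw)
  define y where "y = evw w h"
  have y: "y \<noteq> 0" using assms by (simp add: y_def evw_eq_0_iff)
  obtain p :: "'a alg_closure poly fract poly" where p: "p \<noteq> 0" "poly (map_poly to_ac p) y = 0"
    by (rule alg_closure_algebraic)
  obtain c p' where p': "p = smult c (map_poly to_fract p')" using content_decompose_fract[of p] by metis
  have "p' \<noteq> 0" "c \<noteq> 0" using p(1) by (auto simp: p')
  have ev_p': "ev1 (\<lambda>a. to_ac (to_fract a)) y p' = 0"
  proof -
    have "map_poly to_ac p = smult (to_ac c) (map_poly to_ac (map_poly to_fract p'))"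
      unfolding p' by (rule poly_eqI) (simp add: coeff_map_poly)
    then show ?thesis using p(2) \<open>c \<noteq> 0\<close> by (simp add: ev1_def map_poly_map_poly o_def)
  qed
  \<comment> \<open>Powers of the variable are divided out of the equation, which is possible
    because \<open>y\<close> is nonzero; the constant term \<open>c0\<close> of what remains is
    nonzero.\<close>
  obtain s where s: "p' = [:- 0, 1:] ^ order 0 p' * s" "\<not> [:- 0, 1:] dvd s"
    using order_decomp[OF \<open>p' \<noteq> 0\<close>] by blast
  have hom2: "type_hom (\<lambda>a. to_ac (to_fract a))"
    by (intro type_hom_comp[OF type_hom_to_ac type_hom_to_fract])
  interpret e: type_hom "ev1 (\<lambda>a :: 'a alg_closure poly. to_ac (to_fract a)) y"
    by (rule type_hom.type_hom_ev1[OF hom2])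
  have "ev1 (\<lambda>a. to_ac (to_fract a)) y ([:- 0, 1:] ^ order 0 p' * s) = 0"
    using ev_p' s(1) by (simp only:)
  then have ev_s: "ev1 (\<lambda>a. to_ac (to_fract a)) y s = 0"
    using y by (simp add: type_hom.ev1_pCons[OF hom2] type_hom.ev1_0[OF hom2])
  obtain c0 s' where s': "s = pCons c0 s'" by (cases s)
  have "c0 \<noteq> 0"
  proof
    assume "c0 = 0"
    then have "s = [:- 0, 1:] * s'" by (simp add: s')
    then show False using s(2) by (metis dvd_triv_left)
  qed
  define h' where "h' = - ev1 (\<lambda>a. [:a:]) h s'"
  have "evw w (ev1 (\<lambda>a. [:a:]) h s') = ev1 (\<lambda>a. to_ac (to_fract a)) y s'"
    unfolding ev1_comp[OF type_hom_evw type_hom_const_poly] evw_const y_def ..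
  then have "evw w (h * h' - [:c0:]) = - ev1 (\<lambda>a. to_ac (to_fract a)) y s"
    by (simp add: h'_def evw_const s' y_def type_hom.ev1_pCons[OF hom2])
  then have "evw w (h * h' - [:c0:]) = 0" unfolding ev_s by simp
  then have "dgz_t q dvd h * h' - [:c0:]" by (rule evw_eq_0_imp_dvd)
  then obtain r where "h * h' - [:c0:] = dgz_t q * r" by (elim dvdE)
  then have "h * h' = [:c0:] + dgz_t q * r" by (simp add: algebra_simps)
  then show ?thesis using \<open>c0 \<noteq> 0\<close> that by blast
qed

text \<open>The remainder modulo \<open>F\<close> has degree less than the number of points in the
  orbit, so taking one value on the orbit makes it constant. Division by a monic polynomial
  introduces no denominators, hence the value is a polynomial in t.\<close>

lemma aff_orbit_fixed:
  fixes h :: "'a alg_closure poly poly"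
  assumes "\<And>g. g \<in> aff_group \<Longrightarrow> evw (E.aff rat_t 1 g w) h = evw w h"
  obtains c where "evw w h = to_ac (to_fract c)"
proof -
  obtain s r where sr: "h = dgz_t q * s + r" "r = 0 \<or> degree r < degree (dgz_t q :: 'a alg_closure poly poly)"
    by (rule monic_division[OF dgz_t(2)])
  have nz: "moore2 q (rat_t :: 'a alg_closure poly fract alg_closure) 1 \<noteq> 0"
  proof -
    have "moore2 q (rat_t :: 'a alg_closure poly fract alg_closure) 1 = to_ac (to_fract (moore2 q tvar 1))"
      unfolding type_hom.hom_moore2[OF type_hom_to_fract] type_hom.hom_moore2[OF type_hom_to_ac] by simp
    then show ?thesis unfolding moore2_t using frob_poly_neq_0[OF E.q_gt_1] by simp
  qed
  have evr: "evw z r = evw z h" if "dgz q rat_t 1 z = 0" for z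
  proof -
    interpret z: type_hom "evw z" by (rule type_hom_evw)
    show ?thesis unfolding sr(1) by (simp add: evw_dgz that)
  qed
  define p where "p = map_poly to_ac (map_poly to_fract r) - [:evw w h:]"
  have "degree r < q ^ 2 * (q - 1)"
    using sr(2) dgz_t(1) E.q_gt_1 by auto
  then have deg: "degree p < q ^ 2 * (q - 1)"
    unfolding p_def using E.q_gt_1
    by (intro degree_diff_less) (auto intro: le_less_trans[OF map_poly_degree_leq])
  have roots: "(\<lambda>g. E.aff rat_t 1 g w) ` aff_group \<subseteq> {z. poly p z = 0}"
  proof safe
    fix g :: "'a \<times> 'a \<times> 'a" assume g: "g \<in> aff_group"
    have "evw (E.aff rat_t 1 g w) r = evw w h"
      using E.dgz_aff[OF nz g, of w] w assms[OF g] evr by simp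
    then show "poly p (E.aff rat_t 1 g w) = 0" by (simp add: p_def ev1_generic)
  qed
  have "span_poly q rat_t 1 w \<noteq> 0"
  proof
    assume "span_poly q rat_t 1 w = 0"
    then have "dickson q rat_t 1 = (0 :: 'a alg_closure poly fract alg_closure)"
      using w E.q_gt_1 by (simp add: dgz_def power_0_left)
    moreover have "dickson q rat_t 1 = (to_ac (to_fract (dickson q tvar 1)) :: 'a alg_closure poly fract alg_closure)"
      unfolding type_hom.hom_dickson[OF type_hom_to_fract] type_hom.hom_dickson[OF type_hom_to_ac] by simp
    ultimately have "dickson q tvar 1 = (0 :: 'a alg_closure poly)" by simp
    moreover have kp: "kalgebra (\<lambda>c :: 'a alg_closure. [:c:]) q"
      using q type_hom_const_poly by (simp add: kalgebra_iff)
    ultimately have "poly (1 + (frob_poly q :: 'a alg_closure poly) ^ (q - 1)) 0 = 0"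
      using dickson_t[OF kp] by simp
    then show False using E.q_gt_1 by (simp add: frob_poly_def poly_monom power_0_left)
  qed
  then have "card ((\<lambda>g. E.aff rat_t 1 g w) ` aff_group) = q ^ 2 * (q - 1)"
    by (rule E.card_orbit[OF nz])
  then have "p = 0" using card_roots_le[OF _ roots] deg by force
  then have "coeff p 0 = 0" by simp
  then have "evw w h = to_ac (to_fract (coeff r 0))" by (simp add: p_def coeff_map_poly)
  then show ?thesis by (rule that)
qed

end

section \<open>Homogeneity of the Dickson forms\<close>

lemma moore2_homogeneous: "moore2 q (s * x) (s * y) = s ^ (q + 1) * moore2 q x (y::'b::comm_ring_1)"
  by (simp add: moore2_def power_mult_distrib algebra_simps)

lemma dickson_homogeneous: "dickson q (s * x) (s * y) = s ^ ((q - 1) * q) * dickson q x (y::'b::comm_ring_1)"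
proof -
  have "((s * x) ^ (q - 1)) ^ i * ((s * y) ^ (q - 1)) ^ (q - i) =
    s ^ ((q - 1) * q) * ((x ^ (q - 1)) ^ i * (y ^ (q - 1)) ^ (q - i))" if "i \<le> q" for i
  proof -
    have "(q - 1) * q = (q - 1) * i + (q - 1) * (q - i)" using that by (simp flip: add_mult_distrib2)
    then have "s ^ ((q - 1) * q) = (s ^ (q - 1)) ^ i * (s ^ (q - 1)) ^ (q - i)"
      by (simp only: power_add power_mult)
    then show ?thesis by (simp only: power_mult_distrib mult_ac)
  qed
  then show ?thesis unfolding dickson_def sum_distrib_left by (intro sum.cong) auto
qed

lemma span_poly_homogeneous:
  assumes "0 < q"
  shows "span_poly q (s * x) (s * y) (s * z) = s ^ q ^ 2 * span_poly q x y (z::'b::comm_ring_1)"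
proof -
  obtain m where m: "q = Suc m" using assms by (cases q) auto
  have a: "s ^ ((q - 1) * q) * s ^ q = s ^ q ^ 2" "(s ^ (q + 1)) ^ (q - 1) * s = s ^ q ^ 2"
    unfolding m by (simp_all add: power2_eq_square algebra_simps flip: power_add power_mult power_Suc power_Suc2)
  have "span_poly q (s * x) (s * y) (s * z) = s ^ q ^ 2 * z ^ q ^ 2 -
    (s ^ ((q - 1) * q) * s ^ q) * (dickson q x y * z ^ q) + ((s ^ (q + 1)) ^ (q - 1) * s) * (moore2 q x y ^ (q - 1) * z)"
    unfolding span_poly_def moore2_homogeneous dickson_homogeneous power_mult_distrib by (simp only: mult_ac)
  then show ?thesis unfolding a span_poly_def by (simp add: algebra_simps)
qed

lemma dgz_scale: "dgz q (s * x) (s * y) (s * z) = s ^ (q ^ 2 * (q - 1)) * dgz q x y (z::'b::comm_ring_1)"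
  if q: "0 < q"
proof -
  have e: "(s ^ q ^ 2) ^ (q - 1) = s ^ (q ^ 2 * (q - 1))" "(s ^ ((q - 1) * q)) ^ q = s ^ (q ^ 2 * (q - 1))"
    by (simp_all add: power2_eq_square mult_ac flip: power_mult)
  show ?thesis
    unfolding dgz_def span_poly_homogeneous[OF q] dickson_homogeneous power_mult_distrib e by (simp add: algebra_simps)
qed

lemma hom_field_eq_0_iff:
  fixes h :: "'c::field \<Rightarrow> 'e::idom"
  assumes "type_hom h"
  shows "h c = 0 \<longleftrightarrow> c = 0"
proof
  interpret type_hom h by fact
  assume "h c = 0"
  then have "h (c * inverse c) = 0" by (simp only: hom_mult mult_zero_left)
  then show "c = 0" by (cases "c = 0") auto
qed (simp add: type_hom.hom_0[OF assms])

text \<open>Over an algebraically closed field the polynomial splits into linear factors, and one of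
  them vanishes at \<open>x\<close>.\<close>

lemma root_in_range:
  fixes h :: "'c::alg_closed_field \<Rightarrow> 'e::idom"
  assumes h: "type_hom h" and "p \<noteq> 0" "ev1 h x p = 0"
  shows "x \<in> range h"
  using assms(2,3)
proof (induction "degree p" arbitrary: p rule: less_induct)
  case less
  interpret type_hom h by fact
  interpret e: type_hom "ev1 h x" by (rule type_hom_ev1)
  show ?case
  proof (cases "degree p = 0")
    case True
    then obtain a where "p = [:a:]" by (rule degree_eq_zeroE)
    then show ?thesis using less.prems by (simp add: hom_field_eq_0_iff[OF h])
  next
    case False
    then obtain a where "poly p a = 0" using alg_closed_imp_poly_has_root by blast
    then obtain r where r: "p = [:- a, 1:] * r" by (auto simp: poly_eq_0_iff_dvd elim: dvdE)
    then have "r \<noteq> 0" using less.prems by auto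
    then have "degree p = Suc (degree r)" unfolding r by (subst degree_mult_eq) auto
    have "ev1 h x p = (x - h a) * ev1 h x r" unfolding r by (simp only: e.hom_mult) simp
    then consider "x = h a" | "ev1 h x r = 0" using less.prems by auto
    then show ?thesis
    proof cases
      case 2
      then show ?thesis using \<open>r \<noteq> 0\<close> less.hyps[of r] \<open>degree p = Suc (degree r)\<close> by simp
    qed auto
  qed
qed

lemma DGZ_form_degree:
  assumes "q = CARD('a::finite_field)"
  shows "degree (DGZ_form q :: 'a alg_closure poly3) = q ^ 2 * (q - 1)"
    and "lead_coeff (DGZ_form q :: 'a alg_closure poly3) = 1"
proof -
  have k: "kalgebra (const3 :: 'a alg_closure \<Rightarrow> _) q"
    using assms type_hom_const3 by (simp add: kalgebra_iff)
  have "DGZ_form q = (dgz q [:[:[:0, 1:]:]:] [:[:0, 1:]:] [:0, 1:] :: 'a alg_closure poly3)"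
    unfolding DGZ_form_eq[OF k] dgz_at_def vars3_nth var_x_def var_y_def var_z_def ..
  then show "degree (DGZ_form q :: 'a alg_closure poly3) = q ^ 2 * (q - 1)"
    and "lead_coeff (DGZ_form q :: 'a alg_closure poly3) = 1"
    using degree_dgz[OF kalgebra.q_ge_2[OF k], of "[:[:0, 1 :: 'a alg_closure:]:]" "[:0, 1:]"]
    by (simp_all only:)
qed

section \<open>Passage between forms and the affine chart\<close>

definition dehom :: "'c::field poly3 \<Rightarrow> 'c poly poly"
  where "dehom = ev3 (\<lambda>a. [:[:a:]:]) (vector [[:[:0, 1:]:], 1, [:0, 1:]])"

lemma type_hom_const2: "type_hom (\<lambda>a. [:[:a:]:])"
  by (rule type_hom_comp[OF type_hom_const_poly type_hom_const_poly])

lemma ev1_dehom: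
  assumes h: "type_hom h"
  shows "ev1 (ev1 h T) Z (dehom b) = ev3 h (vector [T, 1, Z]) b"
proof -
  note h1 = type_hom.type_hom_ev1[OF h]
  note h2 = type_hom.type_hom_ev1[OF h1]
  have "(\<lambda>a. ev1 (ev1 h T) Z [:[:a:]:]) = h"
    by (rule ext) (simp add: type_hom.ev1_pCons[OF h1] type_hom.ev1_pCons[OF h] type_hom.ev1_0[OF h1]
       type_hom.ev1_0[OF h])
  moreover have "(\<chi> i. ev1 (ev1 h T) Z (vector [[:[:0, 1:]:], 1, [:0, 1:]] $ i)) = (vector [T, 1, Z] :: _ ^ 3)"
    by (rule vec3_cong) (simp_all add: type_hom.hom_1[OF h2] type_hom.ev1_pCons[OF h1] type_hom.ev1_pCons[OF h]
      type_hom.ev1_0[OF h1] type_hom.ev1_0[OF h] type_hom.hom_0[OF h] type_hom.hom_1[OF h] type_hom.hom_1[OF h1])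
  ultimately show ?thesis
    unfolding dehom_def ev3_comp[OF h2 type_hom_const2] by (simp only:)
qed

text \<open>Compare remainders modulo \<open>F\<close> on all the vertical lines \<open>(x, y) = const\<close>.\<close>

lemma dvd_dehom_imp_dvd:
  fixes b :: "'a::finite_field alg_closure poly3"
  assumes q: "q = CARD('a)" and b: "homogeneous3 d b" and dvd: "dgz_t q dvd dehom b"
  shows "DGZ_form q dvd b"
proof -
  have P: "kalgebra (\<lambda>c :: 'a alg_closure. [:c:]) q"
    unfolding kalgebra_iff using q type_hom_const_poly by blast
  obtain s r where sr: "b = DGZ_form q * s + r"
    "r = 0 \<or> degree r < degree (DGZ_form q :: 'a alg_closure poly3)"
    by (rule monic_division[OF DGZ_form_degree(2)[OF q]])
  have main: "poly (poly (coeff r i) [:y0:]) x0 = 0" if y0: "y0 \<noteq> 0" for i x0 y0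
  proof -
    \<comment> \<open>\<open>\<Phi>\<close> restricts forms to the vertical line over (x0, y0), and
      \<open>\<Psi>\<close> restricts polynomials in the chart to the same line. For nonzero y0 they
      differ by a power of y0, which is a unit.\<close>
    define \<Phi> where "\<Phi> = ev3 (\<lambda>c :: 'a alg_closure. [:c:]) (vector [[:x0:], [:y0:], [:0, 1:]])"
    define \<Psi> where "\<Psi> = ev1 (ev1 (\<lambda>c :: 'a alg_closure. [:c:]) [:x0 / y0:]) [:0, 1 / y0:]"
    have Phi: "type_hom \<Phi>" unfolding \<Phi>_def by (rule type_hom_ev3[OF type_hom_const_poly])
    have Psi1: "type_hom (ev1 (\<lambda>c :: 'a alg_closure. [:c:]) [:x0 / y0:])"
      by (rule type_hom.type_hom_ev1[OF type_hom_const_poly])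
    then have Psi: "type_hom \<Psi>" unfolding \<Psi>_def by (rule type_hom.type_hom_ev1)
    have vec: "vector [[:x0:], [:y0:], [:0, 1:]] = [:y0:] *s (vector [[:x0 / y0:], 1, [:0, 1 / y0:]] :: 'a alg_closure poly ^ 3)"
      using y0 by (intro vec3_cong) (simp_all add: vector_scalar_mult_def)
    define n where "n = q ^ 2 * (q - 1)"
    define G where "G = dgz q [:x0 / y0:] 1 ([:0, 1 / y0:] :: 'a alg_closure poly)"
    have Phib: "\<Phi> b = [:y0:] ^ d * \<Psi> (dehom b)"
      unfolding \<Phi>_def \<Psi>_def vec ev3_scale[OF type_hom_const_poly b] ev1_dehom[OF type_hom_const_poly] ..
    have "\<Psi> [:[:0, 1:]:] = [:x0 / y0:]" "\<Psi> [:1:] = 1" "\<Psi> [:0, 1:] = [:0, 1 / y0:]"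
      by (simp_all add: \<Psi>_def type_hom.ev1_pCons[OF Psi1] type_hom.ev1_0[OF Psi1] type_hom.ev1_pCons[OF type_hom_const_poly]
         type_hom.ev1_0[OF type_hom_const_poly] type_hom.hom_1[OF Psi1] type_hom.hom_0[OF Psi1])
    then have PsiF: "\<Psi> (dgz_t q) = G"
      unfolding type_hom.hom_dgz[OF Psi] G_def by (simp only:)
    have PhiF: "\<Phi> (DGZ_form q) = [:y0:] ^ n * G"
      unfolding \<Phi>_def kalgebra.ev3_DGZ_form[OF P] vec dgz_at_def vector_smult_component dgz_scale[OF kalgebra.q_gt_0[OF P]] n_def G_def
      by (simp only: vector_3)
    obtain K where "dehom b = dgz_t q * K" using dvd by (elim dvdE)
    then have "\<Psi> (dehom b) = G * \<Psi> K" by (simp only: type_hom.hom_mult[OF Psi] PsiF)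
    have "[:y0:] * [:1 / y0:] = 1" using y0 by simp
    then have unit: "[:y0:] ^ n * [:1 / y0:] ^ n = 1" by (metis power_mult_distrib power_one)
    have "\<Phi> b = ([:y0:] ^ n * [:1 / y0:] ^ n) * [:y0:] ^ d * (G * \<Psi> K)"
      unfolding unit Phib \<open>\<Psi> (dehom b) = G * \<Psi> K\<close> by (simp only: mult_1_left)
    also have "\<dots> = ([:y0:] ^ n * G) * ([:1 / y0:] ^ n * [:y0:] ^ d * \<Psi> K)"
      by (simp only: mult_ac)
    finally have "\<Phi> (DGZ_form q) dvd \<Phi> b" unfolding PhiF by (rule dvdI)
    then have "\<Phi> (DGZ_form q) dvd \<Phi> b - \<Phi> (DGZ_form q) * \<Phi> s" by simp
    also have "\<Phi> b - \<Phi> (DGZ_form q) * \<Phi> s = \<Phi> r"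
      unfolding sr(1) by (simp add: type_hom.hom_add[OF Phi] type_hom.hom_mult[OF Phi])
    finally have dvdr: "\<Phi> (DGZ_form q) dvd \<Phi> r" .
    have "\<Phi> (DGZ_form q) = dgz q [:x0:] [:y0:] [:0, 1:]"
      unfolding \<Phi>_def kalgebra.ev3_DGZ_form[OF P] dgz_at_def by simp
    then have degF: "degree (\<Phi> (DGZ_form q)) = q ^ 2 * (q - 1)"
      by (simp only: degree_dgz[OF kalgebra.q_ge_2[OF P]])
    define \<psi> where "\<psi> = (\<lambda>a. poly (poly a [:y0:]) x0)"
    have 1: "ev1 (\<lambda>c :: 'a alg_closure. [:c:]) [:x0:] = (\<lambda>p. [:poly p x0:])"
    proof
      show "ev1 (\<lambda>c :: 'a alg_closure. [:c:]) [:x0:] p = [:poly p x0:]" for p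
        by (induction p) (simp_all add: type_hom.ev1_pCons[OF type_hom_const_poly] type_hom.ev1_0[OF type_hom_const_poly])
    qed
    note h1 = type_hom.type_hom_ev1[OF type_hom_const_poly, of "[:x0:]", unfolded 1]
    have 2: "ev1 (\<lambda>p. [:poly p x0:]) [:y0:] = (\<lambda>a. [:\<psi> a:])"
    proof
      show "ev1 (\<lambda>p. [:poly p x0:]) [:y0:] a = [:\<psi> a:]" for a
        by (induction a) (simp_all add: \<psi>_def type_hom.ev1_pCons[OF h1] type_hom.ev1_0[OF h1])
    qed
    note h2 = type_hom.type_hom_ev1[OF h1, of "[:y0:]", unfolded 2]
    have "\<psi> 0 = 0" by (simp add: \<psi>_def)
    then have "ev1 (\<lambda>a. [:\<psi> a:]) [:0, 1:] p = map_poly \<psi> p" for p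
      by (induction p) (simp_all add: type_hom.ev1_pCons[OF h2] type_hom.ev1_0[OF h2] map_poly_pCons)
    then have Phir: "\<Phi> r = map_poly \<psi> r"
      unfolding \<Phi>_def ev3_def by (simp add: 1 2)
    have "\<Phi> r = 0"
    proof (rule monic_dvd_degree_less[OF dvdr])
      show "\<Phi> r = 0 \<or> degree (\<Phi> r) < degree (\<Phi> (DGZ_form q))"
        using sr(2) map_poly_degree_leq[of \<psi> r] unfolding degF DGZ_form_degree(1)[OF q] Phir by auto
    qed
    then have "coeff (map_poly \<psi> r) i = 0" by (simp add: Phir)
    then show ?thesis using \<open>\<psi> 0 = 0\<close> by (simp add: coeff_map_poly \<psi>_def)
  qed
  have "coeff r i = 0" for i
  proof (rule poly_eq_0_if_infinite)
    have "inj (\<lambda>y0 :: 'a alg_closure. [:y0:])" by (auto simp: inj_def)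
    then show "infinite ((\<lambda>y0 :: 'a alg_closure. [:y0:]) ` (UNIV - {0}))"
      using infinite_alg_closed by (auto dest!: finite_imageD intro: inj_on_subset)
    fix y assume "y \<in> (\<lambda>y0 :: 'a alg_closure. [:y0:]) ` (UNIV - {0})"
    then obtain y0 where y0: "y = [:y0:]" "y0 \<noteq> 0" by auto
    show "poly (coeff r i) y = 0"
      unfolding y0(1) by (rule poly_eq_0_if_infinite[OF infinite_alg_closed]) (rule main[OF y0(2)])
  qed
  then have "r = 0" by (intro poly_eqI) simp
  then show ?thesis using sr(1) by simp
qed

text \<open>Proportionality rather than equality is excluded, since coordinates are homogeneous. The
  factor \<open>s\<close> may be zero, so a nonconstant vector is also nonzero.\<close>

definition nonconstant :: "('k \<Rightarrow> 'e::comm_ring_1) \<Rightarrow> 'e ^ 3 \<Rightarrow> bool"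
  where "nonconstant h U \<longleftrightarrow> \<not> (\<exists>s v. \<forall>i. U $ i = s * h (v $ i :: 'k))"

locale kfield = kdomain emb q for emb :: "'a::finite_field alg_closure \<Rightarrow> 'e::field" and q
begin

lemma type_hom_emb: "type_hom emb" by unfold_locales

text \<open>If \<open>F\<close> does not divide \<open>b\<close>, the norm of \<open>b\<close> on
  the chart is a nonzero polynomial c(t) that vanishes at T = x/y, so T lies in k; then Z = z/y
  satisfies a monic equation over k and lies in k as well. On the line y = 0 the equation F(1, 0, Z)
  = 0 alone makes the point constant.\<close>

lemma generic_point:
  assumes F: "dgz_at q U = 0" and nc: "nonconstant emb U" and b: "homogeneous3 d b"
  shows "ev3 emb U b = 0 \<longleftrightarrow> DGZ_form q dvd b"
proof
  interpret U: type_hom "ev3 emb U" by (rule type_hom_ev3) unfold_locales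
  assume "DGZ_form q dvd b"
  then show "ev3 emb U b = 0" using F by (auto simp: ev3_DGZ_form)
next
  assume bU: "ev3 emb U b = 0"
  obtain w :: "'a alg_closure poly fract alg_closure" where w: "dgz q rat_t 1 w = 0"
    by (rule obtain_generic_root[OF q_ge_2])
  interpret w: generic_root q w using q w by unfold_locales
  show "DGZ_form q dvd b"
  proof (rule ccontr)
    assume "\<not> DGZ_form q dvd b"
    then have "\<not> dgz_t q dvd dehom b" using dvd_dehom_imp_dvd[OF q b] by blast
    then obtain h' c r where cr: "c \<noteq> 0" "dehom b * h' = [:c:] + dgz_t q * r"
      by (rule w.dgz_t_norm)
    show False
    proof (cases "U $ 2 = 0")
      case False
      define T Z where "T = U $ 1 / U $ 2" "Z = U $ 3 / U $ 2"
      have UTZ: "U = U $ 2 *s vector [T, 1, Z]"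
        using False by (intro vec3_cong) (simp_all add: T_Z_def vector_scalar_mult_def)
      have "(U $ 2) ^ d * ev3 emb (vector [T, 1, Z]) b = 0"
        using bU ev3_scale[OF type_hom_emb b, of "U $ 2" "vector [T, 1, Z]"] UTZ by simp
      then have bTZ: "ev3 emb (vector [T, 1, Z]) b = 0" using False by simp
      have "(U $ 2) ^ (q ^ 2 * (q - 1)) * dgz q T 1 Z = dgz q (U $ 1) (U $ 2) (U $ 3)"
        using False dgz_scale[OF q_gt_0, of "U $ 2" T 1 Z] by (simp add: T_Z_def)
      then have "(U $ 2) ^ (q ^ 2 * (q - 1)) * dgz q T 1 Z = 0"
        using F unfolding dgz_at_def by simp
      then have FTZ: "dgz q T 1 Z = 0" using False by simp
      note h1 = type_hom.type_hom_ev1[OF type_hom_emb, of T]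
      note h2 = type_hom.type_hom_ev1[OF h1, of Z]
      have "ev1 (ev1 emb T) Z (dgz_t q) = dgz q T 1 Z"
        unfolding type_hom.hom_dgz[OF h2]
        by (simp add: type_hom.ev1_pCons[OF h1] type_hom.ev1_0[OF h1] type_hom.hom_1[OF h1])
      then have "ev1 (ev1 emb T) Z ([:c:] + dgz_t q * r) = ev1 emb T c"
        unfolding type_hom.hom_add[OF h2] type_hom.hom_mult[OF h2]
        by (simp add: FTZ type_hom.ev1_pCons[OF h1] type_hom.ev1_0[OF h1])
      moreover have "ev1 (ev1 emb T) Z (dehom b * h') = 0"
        unfolding type_hom.hom_mult[OF h2] ev1_dehom[OF type_hom_emb] bTZ by simp
      ultimately have "ev1 emb T c = 0" unfolding cr(2) by simp
      then obtain t0 where t0: "T = emb t0" using root_in_range[OF type_hom_emb cr(1)] by auto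
      have "ev1 emb Z (dgz q [:t0:] [:1:] [:0, 1:]) = dgz q T 1 Z"
        unfolding type_hom.hom_dgz[OF type_hom.type_hom_ev1[OF type_hom_emb]] by (simp add: t0)
      moreover have "dgz q [:t0:] [:1:] [:0, 1:] \<noteq> (0 :: 'a alg_closure poly)"
        using degree_dgz(2)[OF q_ge_2, of t0 1] by fastforce
      ultimately obtain z0 where z0: "Z = emb z0"
        using root_in_range[OF type_hom_emb] FTZ by auto
      have "\<forall>i. U $ i = U $ 2 * emb (vector [t0, 1, z0] $ i)"
        unfolding forall_3 using False t0 z0 by (simp add: T_Z_def divide_simps mult.commute)
      then show False using nc unfolding nonconstant_def by blast
    next
      case True
      have FU: "dgz q (U $ 1) 0 (U $ 3) = 0" using F True by (simp add: dgz_at_def)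
      show False
      proof (cases "U $ 1 = 0")
        case True1: True
        have "dgz q 0 0 (U $ 3) = (U $ 3 ^ q ^ 2) ^ (q - 1)"
        proof -
          have "dickson q 0 (0 :: 'e) = 0"
            unfolding dickson_def using q_gt_1 by (intro sum.neutral) (auto simp: power_0_left)
          then show ?thesis
            using q_gt_1 by (simp add: dgz_def span_poly_def moore2_def power_0_left)
        qed
        then have "U $ 3 = 0" using FU True1 by simp
        then have "\<forall>i. U $ i = 0 * emb (0 $ i)" unfolding forall_3 using True True1 by simp
        then show False using nc unfolding nonconstant_def by blast
      next
        case False
        define Z where "Z = U $ 3 / U $ 1"
        have "U $ 1 ^ (q ^ 2 * (q - 1)) * dgz q 1 0 Z = dgz q (U $ 1) 0 (U $ 3)"
          using False dgz_scale[OF q_gt_0, of "U $ 1" 1 0 Z] by (simp add: Z_def)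
        then have FZ: "dgz q 1 0 Z = 0" using FU False by simp
        have e1: "ev1 emb Z (dgz q [:1:] [:0:] [:0, 1:]) = dgz q 1 0 Z"
          unfolding type_hom.hom_dgz[OF type_hom.type_hom_ev1[OF type_hom_emb]] by simp
        have e2: "dgz q [:1:] [:0:] [:0, 1:] \<noteq> (0 :: 'a alg_closure poly)"
          using degree_dgz(2)[OF q_ge_2, of 1 "0 :: 'a alg_closure"] by fastforce
        obtain z0 where z0: "Z = emb z0"
          using root_in_range[OF type_hom_emb e2 e1[unfolded FZ]] by blast
        have "\<forall>i. U $ i = U $ 1 * emb (vector [1, 0, z0] $ i)"
          unfolding forall_3 using False True z0 by (simp add: Z_def divide_simps mult.commute)
        then show False using nc unfolding nonconstant_def by blast
      qed
    qed
  qed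
qed

end

section \<open>The function field\<close>

lemma ring_of_type_simps [simp]:
  "carrier ring_of_type_algebra = UNIV"
  "x \<otimes>\<^bsub>ring_of_type_algebra\<^esub> y = x * y"
  "x \<oplus>\<^bsub>ring_of_type_algebra\<^esub> y = x + y"
  "\<one>\<^bsub>ring_of_type_algebra\<^esub> = 1"
  "\<zero>\<^bsub>ring_of_type_algebra\<^esub> = 0"
  by (simp_all add: ring_of_type_algebra_def)

lemma a_inv_ring_of_type: "\<ominus>\<^bsub>ring_of_type_algebra\<^esub> x = - (x :: 'c::comm_ring_1)"
proof -
  interpret ring "ring_of_type_algebra :: 'c ring" by (rule ring_from_type_algebra)
  show ?thesis by (rule minus_equality) simp_all
qed

definition curve_frac :: "nat \<Rightarrow> 'a::finite_field alg_closure poly3 \<Rightarrow> 'a alg_closure poly3 \<Rightarrow> bool"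
  where "curve_frac q a b \<longleftrightarrow> (\<exists>d. homogeneous3 d a \<and> homogeneous3 d b \<and> \<not> DGZ_form q dvd b)"

definition curve_class :: "nat \<Rightarrow> 'a::finite_field alg_closure poly3 \<Rightarrow> 'a alg_closure poly3 \<Rightarrow> 'a alg_closure poly3 fract set"
  where "curve_class q a b = restrict_to_curve (DGZ_form q) (Fract a b)"

lemma carrier_local_ring: "carrier (local_ring_of_curve (DGZ_form q)) = {Fract a b |a b. curve_frac q a b}"
  unfolding local_ring_of_curve_def curve_frac_def by auto

lemma local_ring_simps:
  "x \<otimes>\<^bsub>local_ring_of_curve f\<^esub> y = x * y"
  "x \<oplus>\<^bsub>local_ring_of_curve f\<^esub> y = x + y"
  "\<one>\<^bsub>local_ring_of_curve f\<^esub> = 1"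
  "\<zero>\<^bsub>local_ring_of_curve f\<^esub> = 0"
  by (simp_all add: local_ring_of_curve_def ring_of_type_algebra_def)

lemma curve_frac_denom_neq_0: "curve_frac q a b \<Longrightarrow> b \<noteq> 0"
  unfolding curve_frac_def by auto

section \<open>Evaluation of rational functions at a generic point\<close>

context kfield
begin

definition generic :: "'e ^ 3 \<Rightarrow> bool"
  where "generic U \<longleftrightarrow> dgz_at q U = 0 \<and> nonconstant emb U"

lemma generic_ev3: "generic U \<Longrightarrow> homogeneous3 d b \<Longrightarrow> ev3 emb U b = 0 \<longleftrightarrow> DGZ_form q dvd b"
  unfolding generic_def by (intro generic_point) auto

lemma curve_frac_ev3: "generic U \<Longrightarrow> curve_frac q a b \<Longrightarrow> ev3 emb U b \<noteq> 0"
  using generic_ev3 unfolding curve_frac_def by blast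

lemma curve_fracI: "generic U \<Longrightarrow> homogeneous3 d a \<Longrightarrow> homogeneous3 d b \<Longrightarrow> ev3 emb U b \<noteq> 0 \<Longrightarrow> curve_frac q a b"
  using generic_ev3 unfolding curve_frac_def by blast

text \<open>Defined by a choice of numerator and denominator, because a rational function has no
  canonical ones here; at a generic point \<open>evf_Fract\<close> shows that the value is
  independent of the choice.\<close>

definition evf :: "'e ^ 3 \<Rightarrow> 'a alg_closure poly3 fract \<Rightarrow> 'e"
  where "evf U r = (SOME v. \<exists>a b. curve_frac q a b \<and> r = Fract a b \<and> v = ev3 emb U a / ev3 emb U b)"

lemma type_hom_ev3_emb: "type_hom (ev3 emb U)"
  by (rule type_hom_ev3[OF type_hom_emb])

lemma evf_Fract:
  assumes U: "generic U" and ab: "curve_frac q a b"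
  shows "evf U (Fract a b) = ev3 emb U a / ev3 emb U b"
proof -
  interpret U: type_hom "ev3 emb U" by (rule type_hom_ev3_emb)
  have "\<exists>v a' b'. curve_frac q a' b' \<and> Fract a b = Fract a' b' \<and> v = ev3 emb U a' / ev3 emb U b'"
    using ab by blast
  then have "\<exists>a' b'. curve_frac q a' b' \<and> Fract a b = Fract a' b' \<and> evf U (Fract a b) = ev3 emb U a' / ev3 emb U b'"
    unfolding evf_def by (rule someI_ex)
  then obtain a' b' where *: "curve_frac q a' b'" "Fract a b = Fract a' b'"
    "evf U (Fract a b) = ev3 emb U a' / ev3 emb U b'" by blast
  have "a * b' = a' * b"
    using *(2) curve_frac_denom_neq_0[OF ab] curve_frac_denom_neq_0[OF *(1)] by (simp add: eq_fract)
  then have "ev3 emb U a * ev3 emb U b' = ev3 emb U a' * ev3 emb U b" by (metis U.hom_mult)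
  then show ?thesis
    unfolding *(3) using curve_frac_ev3[OF U ab] curve_frac_ev3[OF U *(1)] by (simp add: frac_eq_eq)
qed

text \<open>The generic point witnesses that \<open>F\<close> is prime on forms: divisibility by
  \<open>F\<close> means vanishing at the point, so products of admissible denominators are
  admissible.\<close>

lemma cring_local_ring:
  assumes "\<exists>U. generic U"
  shows "cring (local_ring_of_curve (DGZ_form q :: 'a alg_closure poly3))"
proof -
  obtain U where U: "generic U" using assms by blast
  interpret U: type_hom "ev3 emb U" by (rule type_hom_ev3_emb)
  interpret T: cring "ring_of_type_algebra :: 'a alg_closure poly3 fract ring"
    by (rule cring_from_type_algebra)
  define C where "C = {Fract a b |a b. curve_frac q a (b :: 'a alg_closure poly3)}"
  have CI: "Fract a b \<in> C" if "homogeneous3 d a" "homogeneous3 d b" "ev3 emb U b \<noteq> 0" for a b d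
    using curve_fracI[OF U that] unfolding C_def by blast
  have CE: "\<exists>a b d. x = Fract a b \<and> homogeneous3 d a \<and> homogeneous3 d b \<and> ev3 emb U b \<noteq> 0 \<and> b \<noteq> 0" if xC: "x \<in> C" for x
  proof -
    obtain a b where ab: "x = Fract a b" "curve_frac q a b" using xC unfolding C_def by blast
    then show ?thesis using curve_frac_ev3[OF U ab(2)] curve_frac_denom_neq_0[OF ab(2)]
      unfolding curve_frac_def by blast
  qed
  have "subring C (ring_of_type_algebra :: 'a alg_closure poly3 fract ring)"
  proof (rule T.subringI)
    show "\<one>\<^bsub>ring_of_type_algebra\<^esub> \<in> C"
      using CI[of 0 1 1] by (simp add: One_fract_def)
  next
    fix x assume "x \<in> C"
    then obtain a b d where x: "x = Fract a b" "homogeneous3 d a" "homogeneous3 d b" "ev3 emb U b \<noteq> 0" using CE by blast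
    then show "\<ominus>\<^bsub>ring_of_type_algebra\<^esub> x \<in> C"
      unfolding a_inv_ring_of_type using CI[of d "- a" b] by auto
  next
    fix x y assume "x \<in> C" "y \<in> C"
    obtain a b d where x: "x = Fract a b" "homogeneous3 d a" "homogeneous3 d b" "ev3 emb U b \<noteq> 0" "b \<noteq> 0" using CE[OF \<open>x \<in> C\<close>] by blast
    obtain a' b' d' where y: "y = Fract a' b'" "homogeneous3 d' a'" "homogeneous3 d' b'" "ev3 emb U b' \<noteq> 0" "b' \<noteq> 0" using CE[OF \<open>y \<in> C\<close>] by blast
    have b: "homogeneous3 (d + d') (b * b')" "ev3 emb U (b * b') \<noteq> 0" using x y by auto
    have "homogeneous3 (d + d') (a * a')" using x y by auto
    then show "x \<otimes>\<^bsub>ring_of_type_algebra\<^esub> y \<in> C" using CI[OF _ b] x y by simp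
    have "homogeneous3 (d' + d) (a' * b)" "homogeneous3 (d + d') (a * b')" using x y by auto
    then have "homogeneous3 (d + d') (a * b' + a' * b)" by (metis homogeneous3_add add.commute)
    then show "x \<oplus>\<^bsub>ring_of_type_algebra\<^esub> y \<in> C" using CI[OF _ b] x y by simp
  qed auto
  then have "subcring C (ring_of_type_algebra :: 'a alg_closure poly3 fract ring)" by (rule T.subcringI')
  then have "cring ((ring_of_type_algebra :: 'a alg_closure poly3 fract ring)\<lparr>carrier := C\<rparr>)"
    by (subst (asm) T.subcring_iff) auto
  moreover have "local_ring_of_curve (DGZ_form q) = (ring_of_type_algebra :: 'a alg_closure poly3 fract ring)\<lparr>carrier := C\<rparr>"
    unfolding local_ring_of_curve_def C_def curve_frac_def by (rule arg_cong[where f = "\<lambda>c. ring_of_type_algebra\<lparr>carrier := c\<rparr>"]) blast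
  ultimately show ?thesis by simp
qed

lemma evf_ring_hom_ring:
  assumes U: "generic U"
  shows "ring_hom_ring (local_ring_of_curve (DGZ_form q)) (ring_of_type_algebra :: 'e ring) (evf U)"
proof -
  interpret U: type_hom "ev3 emb U" by (rule type_hom_ev3_emb)
  interpret L: cring "local_ring_of_curve (DGZ_form q :: 'a alg_closure poly3)"
    using cring_local_ring U by blast
  interpret T: cring "ring_of_type_algebra :: 'e ring" by (rule cring_from_type_algebra)
  show ?thesis
  proof (rule ring_hom_ringI)
    show "ring (local_ring_of_curve (DGZ_form q :: 'a alg_closure poly3))" "ring (ring_of_type_algebra :: 'e ring)"
      by (rule L.ring_axioms T.ring_axioms)+
    show "evf U \<one>\<^bsub>local_ring_of_curve (DGZ_form q)\<^esub> = \<one>\<^bsub>ring_of_type_algebra\<^esub>"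
      using evf_Fract[OF U curve_fracI[OF U homogeneous3_1 homogeneous3_1]] by (simp add: local_ring_simps One_fract_def)
  next
    fix x y assume xy: "x \<in> carrier (local_ring_of_curve (DGZ_form q :: 'a alg_closure poly3))"
      "y \<in> carrier (local_ring_of_curve (DGZ_form q :: 'a alg_closure poly3))"
    obtain a b where x: "x = Fract a b" "curve_frac q a b" using xy(1) unfolding carrier_local_ring by blast
    obtain a' b' where y: "y = Fract a' b'" "curve_frac q a' b'" using xy(2) unfolding carrier_local_ring by blast
    obtain d where d: "homogeneous3 d a" "homogeneous3 d b" using x(2) unfolding curve_frac_def by blast
    obtain d' where d': "homogeneous3 d' a'" "homogeneous3 d' b'" using y(2) unfolding curve_frac_def by blast
    note nz = curve_frac_ev3[OF U x(2)] curve_frac_ev3[OF U y(2)]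
    note nz' = curve_frac_denom_neq_0[OF x(2)] curve_frac_denom_neq_0[OF y(2)]
    have b: "homogeneous3 (d + d') (b * b')" "ev3 emb U (b * b') \<noteq> 0" using d d' nz by auto
    have "homogeneous3 (d + d') (a * a')" using d d' by auto
    from evf_Fract[OF U curve_fracI[OF U this b]]
    show "evf U (x \<otimes>\<^bsub>local_ring_of_curve (DGZ_form q)\<^esub> y) = evf U x \<otimes>\<^bsub>ring_of_type_algebra\<^esub> evf U y"
      using evf_Fract[OF U x(2)] evf_Fract[OF U y(2)] by (simp add: x(1) y(1) local_ring_simps)
    have "homogeneous3 (d' + d) (a' * b)" "homogeneous3 (d + d') (a * b')" using d d' by auto
    then have "homogeneous3 (d + d') (a * b' + a' * b)" by (metis homogeneous3_add add.commute)
    from evf_Fract[OF U curve_fracI[OF U this b]]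
    have "evf U (Fract (a * b' + a' * b) (b * b')) = evf U (Fract a b) + evf U (Fract a' b')"
      unfolding evf_Fract[OF U x(2)] evf_Fract[OF U y(2)] using nz by (simp add: add_frac_eq)
    then show "evf U (x \<oplus>\<^bsub>local_ring_of_curve (DGZ_form q)\<^esub> y) = evf U x \<oplus>\<^bsub>ring_of_type_algebra\<^esub> evf U y"
      using nz' by (simp add: x(1) y(1) local_ring_simps)
  qed simp
qed

lemma ideal_of_curve_eq_kernel:
  assumes U: "generic U"
  shows "ideal_of_curve (DGZ_form q) = a_kernel (local_ring_of_curve (DGZ_form q)) (ring_of_type_algebra :: 'e ring) (evf U)"
proof -
  have "x \<in> ideal_of_curve (DGZ_form q) \<longleftrightarrow>
    x \<in> carrier (local_ring_of_curve (DGZ_form q)) \<and> evf U x = 0" for x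
  proof
    assume "x \<in> ideal_of_curve (DGZ_form q)"
    then obtain a b d where x: "x = Fract a b" "homogeneous3 d a" "homogeneous3 d b" "DGZ_form q dvd a" "\<not> DGZ_form q dvd b"
      unfolding ideal_of_curve_def by blast
    then have ab: "curve_frac q a b" unfolding curve_frac_def by blast
    then show "x \<in> carrier (local_ring_of_curve (DGZ_form q)) \<and> evf U x = 0"
      using x evf_Fract[OF U ab] generic_ev3[OF U x(2)] unfolding carrier_local_ring by auto
  next
    assume x: "x \<in> carrier (local_ring_of_curve (DGZ_form q)) \<and> evf U x = 0"
    then obtain a b where ab: "x = Fract a b" "curve_frac q a b" unfolding carrier_local_ring by blast
    then obtain d where d: "homogeneous3 d a" "homogeneous3 d b" "\<not> DGZ_form q dvd b" unfolding curve_frac_def by blast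
    have "ev3 emb U a = 0" using x evf_Fract[OF U ab(2)] curve_frac_ev3[OF U ab(2)] ab(1) by simp
    then show "x \<in> ideal_of_curve (DGZ_form q)"
      using d ab(1) generic_ev3[OF U d(1)] unfolding ideal_of_curve_def by blast
  qed
  then show ?thesis unfolding a_kernel_def' by auto
qed

text \<open>For a generic point the ideal of the curve is the kernel of \<open>evf U\<close>, so
  every coset has a single value.\<close>

definition point_hom :: "'e ^ 3 \<Rightarrow> 'a alg_closure poly3 fract set \<Rightarrow> 'e"
  where "point_hom U x = the_elem (evf U ` x)"

lemma function_field_eq:
  assumes U: "generic U"
  shows "function_field (DGZ_form q) = local_ring_of_curve (DGZ_form q) Quot
     a_kernel (local_ring_of_curve (DGZ_form q)) (ring_of_type_algebra :: 'e ring) (evf U)"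
  unfolding function_field_def ideal_of_curve_eq_kernel[OF U] ..

lemma point_hom_ring_hom:
  assumes U: "generic U"
  shows "point_hom U \<in> ring_hom (function_field (DGZ_form q)) (ring_of_type_algebra :: 'e ring)"
  unfolding function_field_eq[OF U] point_hom_def[abs_def]
  by (rule ring_hom_ring.the_elem_hom[OF evf_ring_hom_ring[OF U]])

lemma point_hom_inj:
  assumes U: "generic U" and "x \<in> carrier (function_field (DGZ_form q))" "y \<in> carrier (function_field (DGZ_form q))"
    "point_hom U x = point_hom U y"
  shows "x = y"
  using assms(2-4) unfolding function_field_eq[OF U] point_hom_def
  by (rule ring_hom_ring.the_elem_inj[OF evf_ring_hom_ring[OF U]])

lemma carrier_function_field:
  "carrier (function_field (DGZ_form q)) = {curve_class q a b |a b. curve_frac q a (b :: 'a alg_closure poly3)}"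
  unfolding function_field_def FactRing_def curve_class_def restrict_to_curve_def A_RCOSETS_def'
    carrier_local_ring by auto

lemma point_hom_class:
  assumes U: "generic U" and ab: "curve_frac q a b"
  shows "point_hom U (curve_class q a b) = ev3 emb U a / ev3 emb U b"
proof -
  have "Fract a b \<in> carrier (local_ring_of_curve (DGZ_form q))"
    using ab unfolding carrier_local_ring by blast
  from ring_hom_ring.the_elem_simp[OF evf_ring_hom_ring[OF U] this]
  show ?thesis
    unfolding point_hom_def curve_class_def restrict_to_curve_def ideal_of_curve_eq_kernel[OF U]
    by (simp only: evf_Fract[OF U ab])
qed

text \<open>A nonzero class a/b has a numerator that does not vanish at the generic point, so b/a is
  again an admissible fraction.\<close>

lemma field_function_field:
  assumes U: "generic U"
  shows "field (function_field (DGZ_form q :: 'a alg_closure poly3))"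
proof -
  interpret L: cring "local_ring_of_curve (DGZ_form q :: 'a alg_closure poly3)"
    using cring_local_ring U by blast
  interpret h: ring_hom_ring "local_ring_of_curve (DGZ_form q :: 'a alg_closure poly3)" "ring_of_type_algebra :: 'e ring" "evf U"
    by (rule evf_ring_hom_ring[OF U])
  interpret Q: cring "function_field (DGZ_form q :: 'a alg_closure poly3)"
    unfolding function_field_eq[OF U] by (rule ideal.quotient_is_cring[OF h.kernel_is_ideal L.is_cring])
  note hom = point_hom_ring_hom[OF U]
  have one: "point_hom U \<one>\<^bsub>function_field (DGZ_form q)\<^esub> = 1" using ring_hom_one[OF hom] by simp
  have zero: "point_hom U \<zero>\<^bsub>function_field (DGZ_form q)\<^esub> = 0"
    using ring_hom_zero[OF hom Q.ring_axioms ring_from_type_algebra] by simp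
  show ?thesis
  proof (rule Q.cring_fieldI2)
    show "\<zero>\<^bsub>function_field (DGZ_form q :: 'a alg_closure poly3)\<^esub> \<noteq> \<one>\<^bsub>function_field (DGZ_form q)\<^esub>"
      using one zero by auto
  next
    fix x assume x: "x \<in> carrier (function_field (DGZ_form q :: 'a alg_closure poly3))" "x \<noteq> \<zero>\<^bsub>function_field (DGZ_form q)\<^esub>"
    then obtain a b where ab: "x = curve_class q a b" "curve_frac q a b" unfolding carrier_function_field by blast
    then obtain d where d: "homogeneous3 d a" "homogeneous3 d b" unfolding curve_frac_def by blast
    have "point_hom U x \<noteq> 0" using x zero point_hom_inj[OF U x(1) Q.zero_closed] by auto
    then have a: "ev3 emb U a \<noteq> 0" using point_hom_class[OF U ab(2)] ab(1) by auto
    have ba: "curve_frac q b a" by (rule curve_fracI[OF U d(2,1) a])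
    have y: "curve_class q b a \<in> carrier (function_field (DGZ_form q))"
      using ba unfolding carrier_function_field by blast
    have "point_hom U (x \<otimes>\<^bsub>function_field (DGZ_form q)\<^esub> curve_class q b a) = point_hom U x * point_hom U (curve_class q b a)"
      using ring_hom_mult[OF hom x(1) y] by simp
    also have "\<dots> = 1"
      unfolding ab(1) point_hom_class[OF U ab(2)] point_hom_class[OF U ba]
      using a curve_frac_ev3[OF U ab(2)] by simp
    finally have "x \<otimes>\<^bsub>function_field (DGZ_form q)\<^esub> curve_class q b a = \<one>\<^bsub>function_field (DGZ_form q)\<^esub>"
      using x(1) y by (intro point_hom_inj[OF U]) (auto simp: one)
    then show "\<exists>y\<in>carrier (function_field (DGZ_form q)). x \<otimes>\<^bsub>function_field (DGZ_form q)\<^esub> y = \<one>\<^bsub>function_field (DGZ_form q)\<^esub>"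
      using y by blast
  qed
qed

end

section \<open>Homomorphisms into type-class fields\<close>

lemma poly_Poly_snoc: "poly (Poly (xs @ [a])) (x :: 'c::comm_ring_1) = poly (Poly xs) x + a * x ^ length xs"
  by (induction xs) (auto simp: algebra_simps)

lemma Poly_rev_neq_0: "a \<noteq> 0 \<Longrightarrow> Poly (rev (a # xs)) \<noteq> 0"
proof
  assume a: "a \<noteq> 0" and "Poly (rev (a # xs)) = 0"
  then have "coeff (Poly (rev (a # xs))) (length xs) = 0" by simp
  then show False using a by (simp add: nth_default_append)
qed

text \<open>Such homomorphisms are injective, so identities in a field given by a carrier can be
  verified after evaluation in a type class, where the simplifier works.\<close>

locale field_to_type = field R for R (structure) +
  fixes h :: "_ \<Rightarrow> 'e::Fields.field"
  assumes hom: "h \<in> ring_hom R (ring_of_type_algebra :: 'e ring)"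
begin

lemma h_add [simp]: "x \<in> carrier R \<Longrightarrow> y \<in> carrier R \<Longrightarrow> h (x \<oplus> y) = h x + h y"
  using ring_hom_add[OF hom] by simp

lemma h_mult [simp]: "x \<in> carrier R \<Longrightarrow> y \<in> carrier R \<Longrightarrow> h (x \<otimes> y) = h x * h y"
  using ring_hom_mult[OF hom] by simp

lemma h_one [simp]: "h \<one> = 1"
  using ring_hom_one[OF hom] by simp

lemma h_zero [simp]: "h \<zero> = 0"
  using ring_hom_zero[OF hom ring_axioms ring_from_type_algebra] by simp

lemma h_a_inv [simp]: "x \<in> carrier R \<Longrightarrow> h (\<ominus> x) = - h x"
proof -
  assume x: "x \<in> carrier R"
  have "h x + h (\<ominus> x) = h (x \<oplus> \<ominus> x)" using x by simp
  also have "\<dots> = 0" using x by (simp add: r_neg)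
  finally show ?thesis by (simp add: eq_neg_iff_add_eq_0 add.commute)
qed

lemma h_mult_inv: "x \<in> carrier R \<Longrightarrow> x \<noteq> \<zero> \<Longrightarrow> h x * h (inv x) = 1"
proof -
  assume "x \<in> carrier R" "x \<noteq> \<zero>"
  then have x: "x \<in> Units R" using field_Units by auto
  then have "h x * h (inv x) = h (x \<otimes> inv x)" by (intro h_mult[symmetric]) auto
  also have "\<dots> = 1" using x by simp
  finally show ?thesis .
qed

lemma h_eq_0_iff [simp]: "x \<in> carrier R \<Longrightarrow> h x = 0 \<longleftrightarrow> x = \<zero>"
  using h_mult_inv[of x] by (cases "x = \<zero>") auto

lemma h_inj: "x \<in> carrier R \<Longrightarrow> y \<in> carrier R \<Longrightarrow> h x = h y \<Longrightarrow> x = y"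
proof -
  assume xy: "x \<in> carrier R" "y \<in> carrier R" "h x = h y"
  then have "h (x \<oplus> \<ominus> y) = 0" by simp
  then have "x \<oplus> \<ominus> y = \<zero>" using xy by (simp del: h_add)
  then show "x = y" using xy r_right_minus_eq unfolding a_minus_def by blast
qed

lemma inv_closed': "x \<in> carrier R \<Longrightarrow> x \<noteq> \<zero> \<Longrightarrow> inv x \<in> carrier R"
  using field_Units by auto

lemma h_inv [simp]: "x \<in> carrier R \<Longrightarrow> x \<noteq> \<zero> \<Longrightarrow> h (inv x) = inverse (h x)"
  using h_mult_inv[of x] by (simp add: inverse_unique)

lemma h_nat_pow: "x \<in> carrier R \<Longrightarrow> h (x [^] (n::nat)) = h x ^ n"
  by (induction n) auto

lemma h_eval: "set p \<subseteq> carrier R \<Longrightarrow> x \<in> carrier R \<Longrightarrow> h (eval p x) = poly (Poly (rev (map h p))) (h x)"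
  by (induction p) (auto simp: poly_Poly_snoc h_nat_pow eval_in_carrier)

text \<open>Algebraicity is defined through lists of coefficients in descending order; the
  coefficients of \<open>p\<close> are pulled back to \<open>K\<close> and reversed.\<close>

lemma poly_imp_algebraic:
  assumes K: "subring K R" and x: "x \<in> carrier R"
    and p: "p \<noteq> 0" "\<And>n. poly.coeff p n \<in> h ` K" "poly p (h x) = 0"
  shows "(algebraic over K) x"
proof -
  have KR: "K \<subseteq> carrier R" using subringE(1)[OF K] .
  define f where "f = inv_into K h"
  have f: "f c \<in> K" "h (f c) = c" if "c \<in> set (coeffs p)" for c
  proof -
    have "c \<in> h ` K" using that p(2) by (auto simp: coeffs_def split: if_splits)
    then show "f c \<in> K" "h (f c) = c" unfolding f_def by (auto intro: inv_into_into f_inv_into_f)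
  qed
  define xs where "xs = rev (map f (coeffs p))"
  have sub: "set xs \<subseteq> K" using f by (auto simp: xs_def)
  then have sub': "set xs \<subseteq> carrier R" using KR by blast
  have map: "map h (map f (coeffs p)) = coeffs p" using f by (simp add: map_idI)
  have ne: "coeffs p \<noteq> []" using p(1) by simp
  have "h (hd xs) = last (coeffs p)"
    using f(2)[of "last (coeffs p)"] ne by (simp add: xs_def hd_rev last_map)
  then have "hd xs \<noteq> \<zero>" using p(1) last_coeffs_eq_coeff_degree[OF p(1)] leading_coeff_neq_0[OF p(1)] by auto
  then have "polynomial K xs" using sub unfolding polynomial_def by auto
  then have "xs \<in> carrier (K[X])" using univ_poly_carrier by blast
  moreover have "xs \<noteq> []" using ne by (simp add: xs_def)
  moreover have "eval xs x = \<zero>"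
  proof -
    have "h (eval xs x) = poly (Poly (coeffs p)) (h x)"
      unfolding h_eval[OF sub' x] by (simp add: xs_def rev_map[symmetric] map[simplified])
    then have "h (eval xs x) = 0" using p(3) by simp
    then show ?thesis using h_eq_0_iff[OF eval_in_carrier[OF sub' x]] by simp
  qed
  ultimately show ?thesis by (rule algebraicI)
qed

end

section \<open>Rational points are Galois points\<close>

context kalgebra
begin

lemma act_mult: "act (A ** B) u = act A (act B u)"
  unfolding vec_eq_iff act_nth by (simp add: forall_3 matrix_matrix_mult_def sum_3 algebra_simps)

lemma act_mat_1 [simp]: "act (mat 1) u = u"
  unfolding vec_eq_iff act_nth by (simp add: forall_3 mat_def)

lemma act_scale: "act M (s *s u) = s *s act M u"
  by (rule vec3_cong) (simp_all add: act_nth algebra_simps)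

end

context kdomain
begin

text \<open>Both determinants are multiplied by \<open>det M\<close>; the nonzero denominator at
  \<open>u\<close> permits cancellation.\<close>

lemma dgz_at_act:
  assumes "det M \<noteq> 0" "dgz_den q u \<noteq> 0"
  shows "dgz_at q (act M u) = dgz_at q u"
proof -
  have "dgz_at q (act M u) * (emb (to_ac (det M)) * dgz_den q u) = emb (to_ac (det M)) * dgz_num q u"
    using dgz_at_mult_den[of "act M u"] unfolding dgz_den_act dgz_num_act .
  also have "\<dots> = dgz_at q u * (emb (to_ac (det M)) * dgz_den q u)"
    unfolding dgz_at_mult_den[of u, symmetric] by (simp add: mult_ac)
  finally show ?thesis using assms by simp
qed

end

lemma obtain_inverse_matrix:
  fixes M :: "'a::field ^ 3 ^ 3"
  assumes "det M \<noteq> 0"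
  obtains M' where "M ** M' = mat 1" "M' ** M = mat 1" "det M' \<noteq> 0"
proof -
  obtain M' where "M ** M' = mat 1" "M' ** M = mat 1"
    using assms unfolding invertible_det_nz[symmetric] invertible_def by blast
  moreover from this have "det M * det M' = 1" by (metis det_I det_mul)
  ultimately show ?thesis using that by force
qed

text \<open>Such a matrix moves (0 : 0 : 1) to the point \<open>a\<close>, which reduces an
  arbitrary rational point to the standard one. Its transpose moves an arbitrary rational line to z
  = 0.\<close>

lemma obtain_matrix_third_column:
  fixes a :: "'a::field ^ 3"
  assumes "a \<noteq> 0"
  obtains B where "det B \<noteq> 0" "\<And>i. B $ i $ 3 = a $ i"
proof -
  consider "a $ 3 \<noteq> 0" | "a $ 2 \<noteq> 0" | "a $ 1 \<noteq> 0" using assms by (auto simp: vec_eq_iff forall_3)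
  then show ?thesis
  proof cases
    case 1
    define B where "B = (vector [vector [1, 0, a$1], vector [0, 1, a$2], vector [0, 0, a$3]] :: 'a ^ 3 ^ 3)"
    have "\<forall>i. B $ i $ 3 = a $ i" by (simp add: forall_3 B_def)
    then show ?thesis using that[of B] 1 by (simp add: B_def det_3)
  next
    case 2
    define B where "B = (vector [vector [1, 0, a$1], vector [0, 0, a$2], vector [0, 1, a$3]] :: 'a ^ 3 ^ 3)"
    have "\<forall>i. B $ i $ 3 = a $ i" by (simp add: forall_3 B_def)
    then show ?thesis using that[of B] 2 by (simp add: B_def det_3)
  next
    case 3
    define B where "B = (vector [vector [0, 0, a$1], vector [1, 0, a$2], vector [0, 1, a$3]] :: 'a ^ 3 ^ 3)"
    have "\<forall>i. B $ i $ 3 = a $ i" by (simp add: forall_3 B_def)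
    then show ?thesis using that[of B] 3 by (simp add: B_def det_3)
  qed
qed

definition subst_form :: "'a::finite_field ^ 3 ^ 3 \<Rightarrow> 'a alg_closure poly3 \<Rightarrow> 'a alg_closure poly3"
  where "subst_form M = ev3 const3 (\<chi> i. linear_form (\<chi> j. to_ac (M $ i $ j)))"

lemma homogeneous3_subst_form: "homogeneous3 d b \<Longrightarrow> homogeneous3 d (subst_form M b)"
  unfolding subst_form_def by (rule homogeneous3_ev3) (auto simp: homogeneous3_linear_form)

context kfield
begin

lemma nonconstant_act:
  assumes "det M \<noteq> 0" "nonconstant emb U"
  shows "nonconstant emb (act M U)"
  unfolding nonconstant_def
proof
  assume "\<exists>s v. \<forall>i. act M U $ i = s * emb (v $ i)"
  then obtain s v where sv: "act M U = s *s (\<chi> i. emb (v $ i))" by (auto simp: vec_eq_iff)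
  obtain M' where M': "M' ** M = mat 1" using obtain_inverse_matrix[OF assms(1)] by metis
  have "U = act M' (act M U)" by (simp flip: act_mult add: M')
  also have "\<dots> = s *s act M' (\<chi> i. emb (v $ i))" unfolding sv act_scale ..
  finally have "\<forall>i. U $ i = s * emb ((\<chi> i. \<Sum>j\<in>UNIV. to_ac (M' $ i $ j) * v $ j) $ i)"
    by (simp add: vec_eq_iff act_def hom_sum)
  then show False using assms(2) unfolding nonconstant_def by blast
qed

lemma ev3_subst_form: "ev3 emb U (subst_form M b) = ev3 emb (act M U) b"
proof -
  have "(\<lambda>a. ev3 emb U (const3 a)) = emb" by (rule ext) (rule ev3_const3[OF type_hom_emb])
  moreover have "(\<chi> i. ev3 emb U ((\<chi> i. linear_form (\<chi> j. to_ac (M $ i $ j))) $ i)) = act M U"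
    unfolding vec_eq_iff act_nth by (simp add: ev3_linear_form[OF type_hom_emb])
  ultimately show ?thesis
    unfolding subst_form_def ev3_comp[OF type_hom_ev3_emb type_hom_const3] by (simp only:)
qed

text \<open>Pulling a function back along \<open>M\<close> gives a function whose value at
  \<open>U\<close> is the old value at \<open>M U\<close>; hence evaluation at \<open>U\<close>
  takes all values that evaluation at \<open>M U\<close> takes.\<close>

lemma point_hom_act:
  assumes U: "generic U" "generic (act M U)" and x: "x \<in> carrier (function_field (DGZ_form q))"
  obtains y where "y \<in> carrier (function_field (DGZ_form q))" "point_hom U y = point_hom (act M U) x"
proof -
  obtain a b where ab: "x = curve_class q a b" "curve_frac q a b"
    using x unfolding carrier_function_field by blast
  then obtain d where d: "homogeneous3 d a" "homogeneous3 d b" unfolding curve_frac_def by blast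
  have "ev3 emb (act M U) b \<noteq> 0" by (rule curve_frac_ev3[OF U(2) ab(2)])
  then have c: "curve_frac q (subst_form M a) (subst_form M b)"
    using d by (intro curve_fracI[OF U(1)] homogeneous3_subst_form) (auto simp: ev3_subst_form)
  show ?thesis
  proof (rule that)
    show "curve_class q (subst_form M a) (subst_form M b) \<in> carrier (function_field (DGZ_form q))"
      using c unfolding carrier_function_field by blast
    show "point_hom U (curve_class q (subst_form M a) (subst_form M b)) = point_hom (act M U) x"
      unfolding ab(1) point_hom_class[OF U(1) c] point_hom_class[OF U(2) ab(2)] ev3_subst_form ..
  qed
qed

lemma curve_class_closed: "curve_frac q a (b :: 'a alg_closure poly3) \<Longrightarrow> curve_class q a b \<in> carrier (function_field (DGZ_form q))"
  unfolding carrier_function_field by blast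

lemma curve_frac_const: "generic U \<Longrightarrow> curve_frac q (const3 (c :: 'a alg_closure)) 1"
  by (rule curve_fracI[of U 0]) (auto simp: type_hom.hom_1[OF type_hom_ev3_emb])

lemma point_hom_field_to_type: "generic U \<Longrightarrow> field_to_type (function_field (DGZ_form q)) (point_hom U)"
  by (intro field_to_type.intro field_to_type_axioms.intro field_function_field point_hom_ring_hom)

section \<open>Generators of the subfield of the projection\<close>

definition proj_gens :: "('a alg_closure ^ 3) set \<Rightarrow> 'a alg_closure poly3 fract set set"
  where "proj_gens P = {curve_class q (const3 c) 1 |c. True} \<union>
    {curve_class q l m |l m. l \<in> linear_forms_through P \<and> m \<in> linear_forms_through P \<and> \<not> DGZ_form q dvd m}"

lemma projection_subfield_eq: "projection_subfield (DGZ_form q) P = generate_field (function_field (DGZ_form q)) (proj_gens P)"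
  unfolding projection_subfield_def proj_gens_def curve_class_def ..

lemma proj_gens_cases:
  assumes U: "generic U" and x: "x \<in> proj_gens P"
  obtains c where "x = curve_class q (const3 c) 1" "curve_frac q (const3 c) 1"
  | l m where "x = curve_class q l m" "curve_frac q l m" "l \<in> linear_forms_through P" "m \<in> linear_forms_through P"
  using x curve_frac_const[OF U] unfolding proj_gens_def curve_frac_def linear_forms_through_def by blast

lemma proj_gens_closed: "generic U \<Longrightarrow> proj_gens P \<subseteq> carrier (function_field (DGZ_form q))"
  by (rule subsetI, erule (1) proj_gens_cases) (auto intro: curve_class_closed)

lemma subfield_projection: "generic U \<Longrightarrow> subfield (projection_subfield (DGZ_form q) (P :: ('a alg_closure ^ 3) set)) (function_field (DGZ_form q))"
  unfolding projection_subfield_eq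
  by (intro field.generate_field_is_subfield field_function_field proj_gens_closed)

end

lemma linear_forms_throughE:
  assumes "l \<in> linear_forms_through (proj_point v)"
  obtains c where "l = linear_form c" "c$1 * v$1 + c$2 * v$2 + c$3 * v$3 = 0"
proof -
  have l: "homogeneous3 (Suc 0) l" "\<forall>u\<in>proj_point v. eval3 l u = 0"
    using assms unfolding linear_forms_through_def by auto
  obtain c where c: "l = linear_form c" by (rule homogeneous3_1_cases[OF l(1)])
  have "1 *s v \<in> proj_point v" unfolding proj_point_def by (rule CollectI, rule exI[of _ 1]) simp
  then have "eval3 l v = 0" using l(2) by simp
  moreover have "eval3 l v = c$1 * v$1 + c$2 * v$2 + c$3 * v$3"
    unfolding c eval3_eq_ev3 ev3_linear_form[OF type_hom_id] ..
  ultimately show ?thesis using that[OF c] by simp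
qed

lemma linear_form_through:
  assumes "c$1 * v$1 + c$2 * v$2 + c$3 * v$3 = 0"
  shows "linear_form c \<in> linear_forms_through (proj_point v)"
proof -
  have "eval3 (linear_form c) (s *s v) = s * (c$1 * v$1 + c$2 * v$2 + c$3 * v$3)" for s
    unfolding eval3_eq_ev3 ev3_linear_form[OF type_hom_id] by (simp add: algebra_simps)
  then show ?thesis
    using homogeneous3_linear_form[of c] assms unfolding linear_forms_through_def proj_point_def by auto
qed

lemma to_ac_rat_t_notin: "rat_t \<noteq> emb_rat (c :: 'c::field)"
proof
  assume "rat_t = emb_rat c"
  then have "[:0, 1:] = [:c:]" by (simp only: to_ac_eq_iff to_fract_eq_iff)
  then show False by simp
qed

context generic_root
begin

sublocale E: kfield "emb_rat :: 'a alg_closure \<Rightarrow> _" q ..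

definition std_point :: "'a \<times> 'a \<times> 'a \<Rightarrow> 'a alg_closure poly fract alg_closure ^ 3"
  where "std_point g = vector [rat_t, 1, E.aff rat_t 1 g w]"

lemma moore2_rat_t: "moore2 q (rat_t :: 'a alg_closure poly fract alg_closure) 1 \<noteq> 0"
proof -
  have "moore2 q (rat_t :: 'a alg_closure poly fract alg_closure) 1 = to_ac (to_fract (moore2 q tvar 1))"
    unfolding type_hom.hom_moore2[OF type_hom_to_fract] type_hom.hom_moore2[OF type_hom_to_ac] by simp
  then show ?thesis unfolding moore2_t using frob_poly_neq_0[OF E.q_gt_1] by simp
qed

lemma dickson_rat_t: "dickson q rat_t 1 \<noteq> (0 :: 'a alg_closure poly fract alg_closure)"
proof
  assume "dickson q rat_t 1 = (0 :: 'a alg_closure poly fract alg_closure)"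
  moreover have "dickson q rat_t 1 = (to_ac (to_fract (dickson q tvar 1)) :: 'a alg_closure poly fract alg_closure)"
    unfolding type_hom.hom_dickson[OF type_hom_to_fract] type_hom.hom_dickson[OF type_hom_to_ac] by simp
  ultimately have "dickson q tvar 1 = (0 :: 'a alg_closure poly)" by simp
  moreover have kp: "kalgebra (\<lambda>c :: 'a alg_closure. [:c:]) q"
    using q type_hom_const_poly by (simp add: kalgebra_iff)
  ultimately have "poly (1 + (frob_poly q :: 'a alg_closure poly) ^ (q - 1)) 0 = 0"
    using dickson_t[OF kp] by simp
  then show False using E.q_gt_1 by (simp add: frob_poly_def poly_monom power_0_left)
qed

lemma dgz_aff_w: "g \<in> aff_group \<Longrightarrow> dgz q rat_t 1 (E.aff rat_t 1 g w) = 0"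
  using E.dgz_aff[OF moore2_rat_t, of g w] w by simp

text \<open>On the curve V(z) = 0 would force the Dickson invariant to vanish, so \<open>D2\<close>
  is nonzero and \<open>F\<close> is invariant under \<open>M\<close> at this point. The ratio t of
  the first two coordinates is not in k.\<close>

lemma generic_act_std_point:
  assumes g: "g \<in> aff_group" and M: "det M \<noteq> 0"
  shows "E.generic (E.act M (std_point g))"
proof -
  define z where "z = E.aff rat_t 1 g w"
  have z: "dgz q rat_t 1 z = 0" unfolding z_def by (rule dgz_aff_w[OF g])
  have "span_poly q rat_t 1 z \<noteq> 0"
  proof
    assume "span_poly q rat_t 1 z = 0"
    then show False using z dickson_rat_t E.q_gt_1 by (simp add: dgz_def power_0_left)
  qed
  then have "dgz_den q (std_point g) \<noteq> 0"
    unfolding E.dgz_den_eq std_point_def z_def using moore2_rat_t by simp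
  then have "dgz_at q (E.act M (std_point g)) = dgz_at q (std_point g)" by (rule E.dgz_at_act[OF M])
  also have "\<dots> = 0" using z by (simp add: dgz_at_def std_point_def z_def)
  finally have "dgz_at q (E.act M (std_point g)) = 0" .
  moreover have "nonconstant emb_rat (std_point g)"
    unfolding nonconstant_def
  proof
    assume "\<exists>s v. \<forall>i. std_point g $ i = s * emb_rat (v $ i)"
    then obtain s v where "\<forall>i. std_point g $ i = s * emb_rat (v $ i)" by blast
    then have sv: "rat_t = s * emb_rat (v $ 1)" "1 = s * emb_rat (v $ 2)"
      unfolding forall_3 by (simp_all add: std_point_def)
    then have v2: "emb_rat (v $ 2) \<noteq> 0" by auto
    have "rat_t * emb_rat (v $ 2) = emb_rat (v $ 1)"
      using sv by (metis (no_types, lifting) mult.assoc mult.commute mult_1)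
    then have "rat_t = emb_rat (v $ 1) / emb_rat (v $ 2)" using v2 by (simp only: eq_divide_eq) auto
    also have "\<dots> = emb_rat (v $ 1 / v $ 2)"
    proof -
      have "emb_rat (v $ 1 / v $ 2 * v $ 2) = emb_rat (v $ 1 / v $ 2) * emb_rat (v $ 2)" by (rule E.hom_mult)
      moreover have "v $ 1 / v $ 2 * v $ 2 = v $ 1" using v2 by auto
      ultimately have eq: "emb_rat (v $ 1) = emb_rat (v $ 1 / v $ 2) * emb_rat (v $ 2)" by (simp only:)
      show ?thesis unfolding eq using v2 by (rule nonzero_mult_div_cancel_right)
    qed
    finally show False using to_ac_rat_t_notin by blast
  qed
  then have "nonconstant emb_rat (E.act M (std_point g))" by (rule E.nonconstant_act[OF M])
  ultimately show ?thesis unfolding E.generic_def by blast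
qed

end

text \<open>The points \<open>U g\<close>, one for each affine map g, lie on one line through the
  rational point, so their evaluations agree on the subfield of the projection. Any two of them have
  the same image, which gives an automorphism for each g, and \<open>aff_orbit_fixed\<close> bounds
  the field of common fixed elements.\<close>

lemma galois_rational:
  fixes a :: "'a::finite_field ^ 3"
  assumes q: "q = CARD('a)" and a: "a \<noteq> 0"
  shows "ring.galois_over (function_field (DGZ_form q))
    (projection_subfield (DGZ_form q) (proj_point (\<chi> i. to_ac (a $ i))))"
proof -
  have "kalgebra (\<lambda>c :: 'a alg_closure. c) q"
    unfolding kalgebra_iff using q type_hom_id by blast
  then have "2 \<le> q" by (rule kalgebra.q_ge_2)
  obtain w :: "'a alg_closure poly fract alg_closure" where w: "dgz q rat_t 1 w = 0"
    by (rule obtain_generic_root[OF \<open>2 \<le> q\<close>])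
  interpret generic_root q w using q w by unfold_locales
  obtain B where B: "det B \<noteq> 0" "\<And>i. B $ i $ 3 = a $ i" by (rule obtain_matrix_third_column[OF a]) blast
  obtain B' where B': "B ** B' = mat 1" "B' ** B = mat 1" "det B' \<noteq> 0"
    by (rule obtain_inverse_matrix[OF B(1)])
  define R where "R = function_field (DGZ_form q :: 'a alg_closure poly3)"
  define PP where "PP = proj_point ((\<chi> i. to_ac (a $ i)) :: 'a alg_closure ^ 3)"
  define K where "K = projection_subfield (DGZ_form q) PP"
  define U where "U = (\<lambda>g. E.act B (std_point g))"
  define e where "e = (1 :: 'a, 0 :: 'a, 0 :: 'a)"
  have e: "e \<in> aff_group" by (simp add: e_def aff_group_def)
  have aff_e: "E.aff rat_t 1 e w = w" by (simp add: e_def E.aff_def)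
  have gen: "E.generic (U g)" if "g \<in> aff_group" for g
    unfolding U_def by (rule generic_act_std_point[OF that B(1)])
  define h where "h = (\<lambda>g. E.point_hom (U g))"
  have hom: "field_to_type R (h g)" if "g \<in> aff_group" for g
    unfolding h_def R_def by (rule E.point_hom_field_to_type[OF gen[OF that]])
  interpret he: field_to_type R "h e" by (rule hom[OF e])
  have classR: "\<exists>a b. x = curve_class q a b \<and> curve_frac q a (b :: 'a alg_closure poly3)" if "x \<in> carrier R" for x
    using that unfolding R_def E.carrier_function_field by blast
  have h_class: "h g (curve_class q l m) = ev3 emb_rat (U g) l / ev3 emb_rat (U g) m"
    if "g \<in> aff_group" "curve_frac q l m" for g l m
    unfolding h_def by (rule E.point_hom_class[OF gen[OF that(1)] that(2)])

  have gensR: "E.proj_gens PP \<subseteq> carrier R" unfolding R_def by (rule E.proj_gens_closed[OF gen[OF e]])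
  have K_eq: "K = generate_field R (E.proj_gens PP)" unfolding K_def R_def by (rule E.projection_subfield_eq)
  have Ksub: "subfield K R" unfolding K_def R_def by (rule E.subfield_projection[OF gen[OF e]])
  have KR: "K \<subseteq> carrier R" using Ksub subfieldE(3) by blast

  \<comment> \<open>The third column of \<open>B\<close> is the point \<open>a\<close>, where
    \<open>l\<close> vanishes, so the coordinate g w does not enter the value.\<close>
  have l_const: "ev3 emb_rat (U g) l = ev3 emb_rat (U e) l"
    if g: "g \<in> aff_group" and l: "l \<in> linear_forms_through PP" for g l
  proof -
    obtain c where c: "l = linear_form c" "c$1 * to_ac (a$1) + c$2 * to_ac (a$2) + c$3 * to_ac (a$3) = 0"
      using l unfolding PP_def by (elim linear_forms_throughE) simp
    have "ev3 emb_rat (U g) l = emb_rat (c$1) * (emb_rat (to_ac (B$1$1)) * rat_t + emb_rat (to_ac (B$1$2)))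
      + emb_rat (c$2) * (emb_rat (to_ac (B$2$1)) * rat_t + emb_rat (to_ac (B$2$2)))
      + emb_rat (c$3) * (emb_rat (to_ac (B$3$1)) * rat_t + emb_rat (to_ac (B$3$2)))
      + emb_rat (c$1 * to_ac (a$1) + c$2 * to_ac (a$2) + c$3 * to_ac (a$3)) * E.aff rat_t 1 g w" for g
      unfolding c(1) ev3_linear_form[OF E.type_hom_emb] U_def E.act_nth B(2) std_point_def vector_3 E.hom_add E.hom_mult
      by (simp only: algebra_simps mult_1_left)
    then show ?thesis unfolding c(2) by simp
  qed

  have h_K: "h g x = h e x" if g: "g \<in> aff_group" and x: "x \<in> K" for g x
  proof -
    interpret hg: field_to_type R "h g" by (rule hom[OF g])
    have "x \<in> carrier R \<and> h g x = h e x"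
      using x unfolding K_eq
    proof (induction rule: generate_field.induct)
      case (incl x)
      then have "x \<in> carrier R" using gensR by blast
      from gen[OF e] incl have "h g x = h e x"
      proof (cases rule: E.proj_gens_cases)
        case (1 c)
        then show ?thesis
          using h_class[OF g 1(2)] h_class[OF e 1(2)] ev3_const3[OF E.type_hom_emb] type_hom.hom_1[OF E.type_hom_ev3_emb] by simp
      next
        case (2 l m)
        then show ?thesis
          using h_class[OF g 2(2)] h_class[OF e 2(2)] l_const[OF g 2(3)] l_const[OF g 2(4)] by simp
      qed
      with \<open>x \<in> carrier R\<close> show ?case by blast
    next
      case (m_inv x)
      then show ?case using he.inv_closed' by simp
    qed auto
    then show ?thesis by blast
  qed

  \<comment> \<open>The affine map g as a matrix over the finite field; it links \<open>U g\<close>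
    with \<open>U e\<close> by an invertible matrix.\<close>
  define NM where "NM = (\<lambda>g :: 'a \<times> 'a \<times> 'a. vector [vector [1, 0, 0], vector [0, 1, 0],
    vector [fst (snd g), snd (snd g), fst g]] :: 'a ^ 3 ^ 3)"
  have NM: "E.act (NM g) (std_point e) = std_point g" for g
  proof (rule vec3_cong)
    show "E.act (NM g) (std_point e) $ 3 = std_point g $ 3"
      unfolding E.act_nth std_point_def aff_e by (simp add: NM_def E.aff_def algebra_simps)
  qed (simp_all add: E.act_nth NM_def std_point_def)
  have transfer: "\<exists>M. U g = E.act M (U e) \<and> det M \<noteq> 0" if g: "g \<in> aff_group" for g
  proof (intro exI conjI)
    show "U g = E.act (B ** NM g ** B') (U e)"
      unfolding U_def E.act_mult[symmetric] matrix_mul_assoc[symmetric] B'(2) matrix_mul_rid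
      unfolding E.act_mult NM ..
    have "det (NM g) = fst g" by (simp add: NM_def det_3)
    then show "det (B ** NM g ** B') \<noteq> 0" using g B(1) B'(3) by (auto simp: det_mul aff_group_def)
  qed
  have to_e: "\<exists>y\<in>carrier R. h e y = h g x" if g: "g \<in> aff_group" and x: "x \<in> carrier R" for g x
  proof -
    obtain M where M: "U g = E.act M (U e)" using transfer[OF g] by blast
    have "E.generic (E.act M (U e))" using gen[OF g] M by simp
    from E.point_hom_act[OF gen[OF e] this x[unfolded R_def]] show ?thesis
      unfolding h_def R_def M by metis
  qed
  have from_e: "\<exists>y\<in>carrier R. h g y = h e x" if g: "g \<in> aff_group" and x: "x \<in> carrier R" for g x
  proof -
    obtain M where M: "U g = E.act M (U e)" "det M \<noteq> 0" using transfer[OF g] by blast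
    obtain M' where M': "M' ** M = mat 1" using obtain_inverse_matrix[OF M(2)] by metis
    have Ue: "U e = E.act M' (U g)" unfolding M(1) E.act_mult[symmetric] M' by simp
    have "E.generic (E.act M' (U g))" using gen[OF e] Ue by simp
    from E.point_hom_act[OF gen[OF g] this x[unfolded R_def]] show ?thesis
      unfolding h_def R_def Ue[symmetric] by metis
  qed

  \<comment> \<open>The composition of evaluation at \<open>U g\<close> with the inverse of
    evaluation at \<open>U e\<close>, which exists because the two images coincide by
    \<open>to_e\<close> and \<open>from_e\<close>.\<close>
  define \<sigma> where "\<sigma> = (\<lambda>g x. SOME y. y \<in> carrier R \<and> h e y = h g x)"
  have \<sigma>: "\<sigma> g x \<in> carrier R \<and> h e (\<sigma> g x) = h g x" if "g \<in> aff_group" "x \<in> carrier R" for g x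
    unfolding \<sigma>_def by (rule someI_ex) (use to_e[OF that] in blast)
  have \<sigma>_iso: "\<sigma> g \<in> ring_iso R R" if g: "g \<in> aff_group" for g
  proof (rule ring_iso_memI)
    interpret hg: field_to_type R "h g" by (rule hom[OF g])
    fix x assume x: "x \<in> carrier R"
    show "\<sigma> g x \<in> carrier R" using \<sigma>[OF g x] by blast
    fix y assume y: "y \<in> carrier R"
    show "\<sigma> g (x \<otimes>\<^bsub>R\<^esub> y) = \<sigma> g x \<otimes>\<^bsub>R\<^esub> \<sigma> g y"
      by (rule he.h_inj) (use \<sigma>[OF g] x y in auto)
    show "\<sigma> g (x \<oplus>\<^bsub>R\<^esub> y) = \<sigma> g x \<oplus>\<^bsub>R\<^esub> \<sigma> g y"
      by (rule he.h_inj) (use \<sigma>[OF g] x y in auto)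
  next
    interpret hg: field_to_type R "h g" by (rule hom[OF g])
    show "\<sigma> g \<one>\<^bsub>R\<^esub> = \<one>\<^bsub>R\<^esub>"
      by (rule he.h_inj) (use \<sigma>[OF g he.one_closed] in auto)
    show "bij_betw (\<sigma> g) (carrier R) (carrier R)"
      unfolding bij_betw_def
    proof
      show "inj_on (\<sigma> g) (carrier R)"
      proof (rule inj_onI)
        fix x y assume "x \<in> carrier R" "y \<in> carrier R" "\<sigma> g x = \<sigma> g y"
        then show "x = y" using \<sigma>[OF g] hg.h_inj by metis
      qed
      show "\<sigma> g ` carrier R = carrier R"
      proof
        show "carrier R \<subseteq> \<sigma> g ` carrier R"
        proof
          fix x assume x: "x \<in> carrier R"
          obtain y where y: "y \<in> carrier R" "h g y = h e x" using from_e[OF g x] by blast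
          then have "\<sigma> g y = x" using \<sigma>[OF g y(1)] x by (intro he.h_inj) auto
          then show "x \<in> \<sigma> g ` carrier R" using y(1) by blast
        qed
      qed (use \<sigma>[OF g] in auto)
    qed
  qed

  have K_rat: "\<exists>y\<in>K. h e y = to_ac (to_fract p)" for p
  proof -
    \<comment> \<open>The first two rows of the inverse of \<open>B\<close> are forms through the
      point; on \<open>U e\<close> their values are t and 1, so l/m generates k(t).\<close>
    define l m where "l = linear_form (\<chi> j. to_ac (B' $ 1 $ j))"
      and "m = linear_form (\<chi> j. to_ac (B' $ 2 $ j))"
    have Ba: "(\<Sum>j\<in>UNIV. B' $ i $ j * a $ j) = (if i = 3 then 1 else 0)" for i
    proof -
      have "(\<Sum>j\<in>UNIV. B' $ i $ j * a $ j) = (B' ** B) $ i $ 3"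
        by (simp add: matrix_matrix_mult_def B(2))
      then show ?thesis by (simp add: B'(2) mat_def)
    qed
    have thr: "linear_form (\<chi> j. to_ac (B' $ i $ j)) \<in> linear_forms_through PP" if "i \<noteq> 3" for i
      unfolding PP_def
    proof (rule linear_form_through)
      have "to_ac (\<Sum>j\<in>UNIV. B' $ i $ j * a $ j) = to_ac 0" using Ba[of i] that by simp
      then show "(\<chi> j. to_ac (B' $ i $ j)) $ 1 * (\<chi> i. to_ac (a $ i)) $ 1 + (\<chi> j. to_ac (B' $ i $ j)) $ 2 * (\<chi> i. to_ac (a $ i)) $ 2 +
        (\<chi> j. to_ac (B' $ i $ j)) $ 3 * (\<chi> i. to_ac (a $ i)) $ 3 = (0 :: 'a alg_closure)"
        by (simp add: sum_3)
    qed
    have ev: "ev3 emb_rat (U e) (linear_form (\<chi> j. to_ac (B' $ i $ j))) = std_point e $ i" for i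
    proof -
      have "ev3 emb_rat (U e) (linear_form (\<chi> j. to_ac (B' $ i $ j))) = E.act B' (U e) $ i"
        unfolding ev3_linear_form[OF E.type_hom_emb] E.act_nth by simp
      also have "E.act B' (U e) = std_point e" unfolding U_def E.act_mult[symmetric] B'(2) by simp
      finally show ?thesis .
    qed
    have lm: "l \<in> linear_forms_through PP" "m \<in> linear_forms_through PP"
      "ev3 emb_rat (U e) l = rat_t" "ev3 emb_rat (U e) m = 1"
      unfolding l_def m_def using thr[of 1] thr[of 2] ev[of 1] ev[of 2] by (simp_all add: std_point_def)
    have "homogeneous3 1 l" "homogeneous3 1 m" using lm(1,2) unfolding linear_forms_through_def by auto
    then have cf: "curve_frac q l m" by (intro E.curve_fracI[OF gen[OF e]]) (auto simp: lm)
    define u where "u = curve_class q l m"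
    have "u \<in> E.proj_gens PP"
      unfolding E.proj_gens_def u_def using lm(1,2) cf unfolding curve_frac_def by blast
    then have u: "u \<in> K" unfolding K_eq by (rule generate_field.incl)
    have hu: "h e u = rat_t" unfolding u_def h_class[OF e cf] lm by simp
    show ?thesis
    proof (induction p)
      case 0
      have "\<zero>\<^bsub>R\<^esub> \<in> K" using subringE(2)[OF subfieldE(1)[OF Ksub]] .
      then show ?case using he.h_zero by force
    next
      case (pCons c p)
      then obtain y where y: "y \<in> K" "h e y = to_ac (to_fract p)" by blast
      define k where "k = curve_class q (const3 c) 1"
      have "k \<in> E.proj_gens PP" unfolding E.proj_gens_def k_def by blast
      then have k: "k \<in> K" unfolding K_eq by (rule generate_field.incl)
      have hk: "h e k = emb_rat c"
        unfolding k_def h_class[OF e E.curve_frac_const[OF gen[OF e]]]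
        by (simp add: ev3_const3[OF E.type_hom_emb] type_hom.hom_1[OF E.type_hom_ev3_emb])
      have "u \<otimes>\<^bsub>R\<^esub> y \<in> K" using subringE(6)[OF subfieldE(1)[OF Ksub] u y(1)] .
      then have "k \<oplus>\<^bsub>R\<^esub> u \<otimes>\<^bsub>R\<^esub> y \<in> K" using subringE(7)[OF subfieldE(1)[OF Ksub] k] by blast
      moreover have "h e (k \<oplus>\<^bsub>R\<^esub> u \<otimes>\<^bsub>R\<^esub> y) = emb_rat c + rat_t * to_ac (to_fract p)"
        using KR k u y by (simp add: subset_iff hk hu)
      moreover have "to_ac (to_fract (pCons c p)) = emb_rat c + rat_t * to_ac (to_fract p)"
      proof -
        have "pCons c p = [:c:] + tvar * p" by simp
        then show ?thesis by (simp only: to_fract_add to_fract_mult to_ac_add to_ac_mult)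
      qed
      ultimately show ?case by metis
    qed
  qed
  have K_frac: "to_ac r \<in> h e ` K" for r
  proof -
    obtain p s where r: "r = Fract p s" "s \<noteq> 0" by (cases r) auto
    obtain y z where yz: "y \<in> K" "h e y = to_ac (to_fract p)" "z \<in> K" "h e z = to_ac (to_fract s)"
      using K_rat by metis
    have z0: "z \<noteq> \<zero>\<^bsub>R\<^esub>" using yz(4) r(2) by auto
    have "inv\<^bsub>R\<^esub> z \<in> K" using he.subfield_m_inv(1)[OF Ksub] yz(3) z0 by blast
    then have "y \<otimes>\<^bsub>R\<^esub> inv\<^bsub>R\<^esub> z \<in> K" using subringE(6)[OF subfieldE(1)[OF Ksub] yz(1)] by blast
    moreover have "h e (y \<otimes>\<^bsub>R\<^esub> inv\<^bsub>R\<^esub> z) = to_ac r"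
      using yz z0 KR he.inv_closed' by (simp add: subset_iff r Fract_conv_to_fract divide_inverse)
    ultimately show ?thesis by force
  qed

  have fixed: "x \<in> K" if x: "x \<in> carrier R" and fx: "\<And>g. g \<in> aff_group \<Longrightarrow> h g x = h e x" for x
  proof -
    obtain a' b where ab: "x = curve_class q a' b" "curve_frac q a' b" using classR[OF x] by blast
    have evw: "evw (E.aff rat_t 1 g w) (dehom (subst_form B p)) = ev3 emb_rat (U g) p" for g p
      unfolding ev1_dehom[OF E.type_hom_emb] E.ev3_subst_form U_def std_point_def ..
    define A where "A = dehom (subst_form B a')"
    define D where "D = dehom (subst_form B b)"
    have bnz: "ev3 emb_rat (U g) b \<noteq> 0" if "g \<in> aff_group" for g
      by (rule E.curve_frac_ev3[OF gen[OF that] ab(2)])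
    \<comment> \<open>Multiplying numerator and denominator by the cofactor of the norm makes the
      denominator a polynomial in t alone. The new numerator is then constant on the orbit, and
      \<open>aff_orbit_fixed\<close> applies to it.\<close>
    have "evw w D \<noteq> 0" using evw[of e b] bnz[OF e] unfolding aff_e D_def by simp
    then have "\<not> dgz_t q dvd D" unfolding evw_eq_0_iff .
    then obtain D' c r where D': "c \<noteq> 0" "D * D' = [:c:] + dgz_t q * r" by (rule dgz_t_norm)
    have main: "evw (E.aff rat_t 1 g w) (A * D') = to_ac (to_fract c) * h e x" if g: "g \<in> aff_group" for g
    proof -
      interpret z: type_hom "evw (E.aff rat_t 1 g w)" by (rule type_hom_evw)
      have "evw (E.aff rat_t 1 g w) (D * D') = to_ac (to_fract c)"
        unfolding D'(2) by (simp add: evw_dgz dgz_aff_w[OF g] evw_const)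
      then have "ev3 emb_rat (U g) b * evw (E.aff rat_t 1 g w) D' = to_ac (to_fract c)"
        by (simp add: D_def evw)
      then have "to_ac (to_fract c) * h g x = ev3 emb_rat (U g) a' * evw (E.aff rat_t 1 g w) D'"
        unfolding ab(1) h_class[OF g ab(2)] using bnz[OF g] by (simp add: field_simps)
      also have "\<dots> = evw (E.aff rat_t 1 g w) (A * D')" by (simp add: A_def evw)
      finally show ?thesis using fx[OF g] by simp
    qed
    have "evw (E.aff rat_t 1 g w) (A * D') = evw w (A * D')" if "g \<in> aff_group" for g
      using main[OF that] main[OF e] unfolding aff_e by simp
    then obtain d where "evw w (A * D') = to_ac (to_fract d)" by (rule aff_orbit_fixed)
    then have "to_ac (to_fract c) * h e x = to_ac (to_fract d)" using main[OF e] unfolding aff_e by simp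
    then have "h e x = to_ac (to_fract d / to_fract c)" using D'(1) by (simp add: field_simps)
    then obtain y where "y \<in> K" "h e x = h e y" using K_frac by (metis imageE)
    then show ?thesis using he.h_inj[OF x] KR by blast
  qed

  show ?thesis
    unfolding he.galois_over_def[folded R_def] PP_def[symmetric] K_def[symmetric] R_def[symmetric]
  proof (intro conjI ballI equalityI subsetI)
    show "field R" by (rule he.field_axioms)
    show "subfield K R" by (rule Ksub)
    fix x assume x: "x \<in> carrier R"
    obtain p where p: "p \<noteq> 0" "poly (map_poly to_ac p) (h e x) = 0" by (rule alg_closure_algebraic)
    show "(he.algebraic over K) x"
    proof (rule he.poly_imp_algebraic[OF subfieldE(1)[OF Ksub] x])
      show "map_poly to_ac p \<noteq> 0" using p(1) by (simp add: map_poly_eq_0_iff)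
      show "poly.coeff (map_poly to_ac p) n \<in> h e ` K" for n by (simp add: coeff_map_poly K_frac)
      show "poly (map_poly to_ac p) (h e x) = 0" by (rule p(2))
    qed
  next
    fix x assume "x \<in> {x \<in> carrier R. \<forall>\<sigma>\<in>ring_iso R R. (\<forall>a\<in>K. \<sigma> a = a) \<longrightarrow> \<sigma> x = x}"
    then have x: "x \<in> carrier R" "\<And>\<sigma>. \<sigma> \<in> ring_iso R R \<Longrightarrow> (\<forall>a\<in>K. \<sigma> a = a) \<Longrightarrow> \<sigma> x = x" by blast+
    show "x \<in> K"
    proof (rule fixed[OF x(1)])
      fix g :: "'a \<times> 'a \<times> 'a" assume g: "g \<in> aff_group"
      have "\<sigma> g a = a" if "a \<in> K" for a
        using \<sigma>[OF g, of a] h_K[OF g that] that KR by (intro he.h_inj) auto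
      then have "\<sigma> g x = x" using x(2)[OF \<sigma>_iso[OF g]] by blast
      then show "h g x = h e x" using \<sigma>[OF g x(1)] by simp
    qed
  next
    fix x assume "x \<in> K"
    then show "x \<in> {x \<in> carrier R. \<forall>\<sigma>\<in>ring_iso R R. (\<forall>a\<in>K. \<sigma> a = a) \<longrightarrow> \<sigma> x = x}" using KR by blast
  qed
qed

section \<open>Galois orbits\<close>

text \<open>The product is multiplied out inside \<open>R\<close>, so one family of elements gives
  the coefficients under every homomorphism; this is what later allows two places to be
  compared.\<close>

lemma orbit_coefficients:
  assumes R: "field R" and Orb: "finite Orb" "Orb \<subseteq> carrier R"
  shows "\<exists>c. (\<forall>n. c n \<in> carrier R) \<and>
    (\<forall>h :: _ \<Rightarrow> 'e::Fields.field. field_to_type R h \<longrightarrow> (\<forall>n. poly.coeff (\<Prod>v\<in>Orb. [:- h v, 1:]) n = h (c n)))"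
  using Orb
proof (induction Orb rule: finite_induct)
  case empty
  interpret field R by fact
  show ?case
  proof (intro exI[of _ "\<lambda>n. if n = 0 then \<one>\<^bsub>R\<^esub> else \<zero>\<^bsub>R\<^esub>"] conjI allI impI)
    fix h :: "_ \<Rightarrow> 'e" and n assume "field_to_type R h"
    then interpret field_to_type R h .
    show "poly.coeff (\<Prod>v\<in>{}. [:- h v, 1:]) n = h (if n = 0 then \<one>\<^bsub>R\<^esub> else \<zero>\<^bsub>R\<^esub>)"
      by (simp add: coeff_eq_0)
  qed auto
next
  case (insert v Orb)
  interpret field R by fact
  obtain c where c: "\<And>n. c n \<in> carrier R"
    "\<And>h n. field_to_type R (h :: _ \<Rightarrow> 'e) \<Longrightarrow> poly.coeff (\<Prod>v\<in>Orb. [:- h v, 1:]) n = h (c n)"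
  proof -
    have "Orb \<subseteq> carrier R" using insert by simp
    from insert.IH[OF this] show ?thesis using that by blast
  qed
  have v: "v \<in> carrier R" using insert by simp
  define c' where "c' = (\<lambda>n. (case n of 0 \<Rightarrow> \<zero>\<^bsub>R\<^esub> | Suc m \<Rightarrow> c m) \<oplus>\<^bsub>R\<^esub> \<ominus>\<^bsub>R\<^esub> (v \<otimes>\<^bsub>R\<^esub> c n))"
  show ?case
  proof (intro exI[of _ c'] conjI allI impI)
    show "c' n \<in> carrier R" for n using c(1) v by (auto simp: c'_def split: nat.split)
    fix h :: "_ \<Rightarrow> 'e" and n assume h: "field_to_type R h"
    then interpret field_to_type R h .
    have "poly.coeff (\<Prod>v\<in>insert v Orb. [:- h v, 1:]) n = (case n of 0 \<Rightarrow> 0 | Suc m \<Rightarrow> h (c m)) - h v * h (c n)"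
      using insert.hyps c(2)[OF h] by (simp add: coeff_pCons split: nat.split)
    also have "\<dots> = h (c' n)" using c(1) v by (auto simp: c'_def split: nat.split)
    finally show "poly.coeff (\<Prod>v\<in>insert v Orb. [:- h v, 1:]) n = h (c' n)" .
  qed
qed

lemma field_to_type_comp:
  assumes "field_to_type R h" "\<sigma> \<in> ring_iso R R"
  shows "field_to_type R (\<lambda>x. h (\<sigma> x))"
proof -
  interpret field_to_type R h by fact
  have \<sigma>: "\<sigma> \<in> ring_hom R R" using assms(2) unfolding ring_iso_def by blast
  note cl = ring_hom_closed[OF \<sigma>]
  show ?thesis
  proof (intro field_to_type.intro field_to_type_axioms.intro ring_hom_memI)
    show "field R" by (rule field_axioms)
  qed (auto simp: ring_hom_one[OF \<sigma>] ring_hom_mult[OF \<sigma>] ring_hom_add[OF \<sigma>] cl)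
qed

text \<open>The conjugates of \<open>z\<close> are roots of one polynomial over \<open>K\<close>,
  hence finite in number. Automorphisms over \<open>K\<close> permute them, so the coefficients of
  the orbit polynomial are fixed and lie in \<open>K\<close>.\<close>

lemma galois_orbit:
  assumes gal: "ring.galois_over R K" and h: "field_to_type R (h :: _ \<Rightarrow> 'e::Fields.field)" and z: "z \<in> carrier R"
  obtains Orb c where "finite Orb" "Orb \<subseteq> carrier R" "z \<in> Orb"
    "\<And>v. v \<in> Orb \<Longrightarrow> \<exists>\<sigma>\<in>ring_iso R R. (\<forall>a\<in>K. \<sigma> a = a) \<and> v = \<sigma> z"
    "\<And>n. c n \<in> K"
    "\<And>h n. field_to_type R (h :: _ \<Rightarrow> 'e) \<Longrightarrow> poly.coeff (\<Prod>v\<in>Orb. [:- h v, 1:]) n = h (c n)"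
proof -
  interpret field_to_type R h by fact
  have K: "subfield K R" "\<And>x. x \<in> carrier R \<Longrightarrow> (algebraic over K) x"
    and fixK: "\<And>x. x \<in> carrier R \<Longrightarrow> (\<forall>\<sigma>\<in>ring_iso R R. (\<forall>a\<in>K. \<sigma> a = a) \<longrightarrow> \<sigma> x = x) \<Longrightarrow> x \<in> K"
    using gal unfolding galois_over_def by blast+
  define G where "G = {\<sigma> \<in> ring_iso R R. \<forall>a\<in>K. \<sigma> a = a}"
  have G: "field_to_type R (\<lambda>x. h (\<sigma> x))" "\<And>x. x \<in> carrier R \<Longrightarrow> \<sigma> x \<in> carrier R" "inj_on \<sigma> (carrier R)" if "\<sigma> \<in> G" for \<sigma>
    using that field_to_type_comp[OF h] ring_hom_closed[of \<sigma> R R] unfolding G_def ring_iso_def by (auto simp: bij_betw_def)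
  define Orb where "Orb = (\<lambda>\<sigma>. \<sigma> z) ` G"
  have Orb: "Orb \<subseteq> carrier R" using G(2) z by (auto simp: Orb_def)
  have finO: "finite Orb"
  proof -
    obtain xs where xs: "xs \<in> carrier (univ_poly R K)" "xs \<noteq> []" "eval xs z = \<zero>\<^bsub>R\<^esub>"
      using algebraicE[OF subfieldE(1)[OF K(1)] z K(2)[OF z]] by blast
    have pol: "polynomial\<^bsub>R\<^esub> K xs" using xs(1) univ_poly_carrier by blast
    obtain a ys where ys: "xs = a # ys" using xs(2) by (cases xs) auto
    have sub: "set xs \<subseteq> K" and a: "a \<noteq> \<zero>\<^bsub>R\<^esub>" using pol unfolding polynomial_def ys by auto
    then have sub': "set xs \<subseteq> carrier R" using subfieldE(3)[OF K(1)] by blast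
    define P where "P = Poly (rev (map h xs))"
    have "P \<noteq> 0" using Poly_rev_neq_0[of "h a" "map h ys"] a sub' by (simp add: P_def ys)
    have "poly P (h (\<sigma> z)) = 0" if "\<sigma> \<in> G" for \<sigma>
    proof -
      interpret s: field_to_type R "\<lambda>x. h (\<sigma> x)" by (rule G(1)[OF that])
      have "map (\<lambda>x. h (\<sigma> x)) xs = map h xs" using that sub by (auto simp: G_def)
      then have "poly P (h (\<sigma> z)) = h (\<sigma> (eval xs z))" unfolding s.h_eval[OF sub' z] by (simp only: P_def)
      then show ?thesis using xs(3) s.h_zero by simp
    qed
    then have "h ` Orb \<subseteq> {x. poly P x = 0}" by (auto simp: Orb_def)
    then have "finite (h ` Orb)" using poly_roots_finite[OF \<open>P \<noteq> 0\<close>] finite_subset by blast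
    moreover have "inj_on h Orb" using Orb h_inj by (auto simp: inj_on_def)
    ultimately show ?thesis by (rule finite_imageD)
  qed
  have perm: "\<sigma> ` Orb = Orb" if \<sigma>: "\<sigma> \<in> G" for \<sigma>
  proof (rule endo_inj_surj[OF finO])
    show "\<sigma> ` Orb \<subseteq> Orb"
    proof
      fix x assume "x \<in> \<sigma> ` Orb"
      then obtain \<tau> where \<tau>: "\<tau> \<in> G" "x = (\<sigma> \<circ> \<tau>) z" by (auto simp: Orb_def)
      have "\<sigma> \<circ> \<tau> \<in> ring_iso R R" using \<tau> \<sigma> ring_iso_set_trans unfolding G_def by blast
      then have "\<sigma> \<circ> \<tau> \<in> G" using \<tau> \<sigma> by (simp add: G_def)
      then show "x \<in> Orb" using \<tau>(2) unfolding Orb_def by blast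
    qed
    show "inj_on \<sigma> Orb" using G(3)[OF \<sigma>] Orb by (rule inj_on_subset)
  qed
  obtain c where c: "\<And>n. c n \<in> carrier R"
    "\<And>h n. field_to_type R (h :: _ \<Rightarrow> 'e) \<Longrightarrow> poly.coeff (\<Prod>v\<in>Orb. [:- h v, 1:]) n = h (c n)"
    using orbit_coefficients[OF field_axioms finO Orb] by metis
  have cK: "c n \<in> K" for n
  proof (rule fixK[OF c(1)], intro ballI impI)
    fix \<sigma> assume "\<sigma> \<in> ring_iso R R" "\<forall>a\<in>K. \<sigma> a = a"
    then have \<sigma>: "\<sigma> \<in> G" by (simp add: G_def)
    have inj: "inj_on \<sigma> Orb" using G(3)[OF \<sigma>] Orb by (rule inj_on_subset)
    have "h (\<sigma> (c n)) = poly.coeff (\<Prod>v\<in>Orb. [:- h (\<sigma> v), 1:]) n" using c(2)[OF G(1)[OF \<sigma>]] by simp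
    also have "(\<Prod>v\<in>Orb. [:- h (\<sigma> v), 1:]) = (\<Prod>v\<in>\<sigma> ` Orb. [:- h v, 1:])"
      by (simp add: prod.reindex[OF inj])
    also have "poly.coeff \<dots> n = h (c n)" unfolding perm[OF \<sigma>] by (rule c(2)[OF h])
    finally show "\<sigma> (c n) = c n" using G(2)[OF \<sigma>] c(1) by (intro h_inj) auto
  qed
  have idG: "(\<lambda>x. x) \<in> G"
    unfolding G_def ring_iso_def ring_hom_def bij_betw_def by (auto simp: inj_on_def)
  then have "(\<lambda>\<sigma>. \<sigma> z) (\<lambda>x. x) \<in> Orb" unfolding Orb_def by (rule imageI)
  then have zO: "z \<in> Orb" by simp
  have "\<exists>\<sigma>\<in>ring_iso R R. (\<forall>a\<in>K. \<sigma> a = a) \<and> v = \<sigma> z" if "v \<in> Orb" for v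
    using that unfolding Orb_def G_def by blast
  from that[OF finO Orb zO this cK c(2)] show ?thesis by blast
qed

section \<open>Laurent series\<close>

lemma type_hom_fls_const: "type_hom (fls_const :: 'c::field \<Rightarrow> 'c fls)"
  by unfold_locales (auto simp: fls_plus_const fls_const_mult_const)

text \<open>The valuation ring of the Laurent series; zero belongs to it because its subdegree is 0
  by convention.\<close>

definition fls_int :: "'c::field fls set"
  where "fls_int = {x. 0 \<le> fls_subdegree x}"

lemma fls_int_add: "x \<in> fls_int \<Longrightarrow> y \<in> fls_int \<Longrightarrow> x + y \<in> fls_int"
  using fls_plus_subdegree[of x y] by (cases "x + y = 0") (auto simp: fls_int_def)

lemma fls_int_mult: "x \<in> fls_int \<Longrightarrow> y \<in> fls_int \<Longrightarrow> x * y \<in> fls_int"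
  by (cases "x = 0 \<or> y = 0") (auto simp: fls_int_def)

lemma fls_int_simps [simp]: "0 \<in> fls_int" "1 \<in> fls_int" "fls_const c \<in> fls_int" "- x \<in> fls_int \<longleftrightarrow> x \<in> fls_int"
  "fps_to_fls f \<in> fls_int"
  by (auto simp: fls_int_def fls_subdegree_fls_to_fps_gt0)

lemma fls_int_poly:
  assumes "\<And>n. poly.coeff p n \<in> fls_int" "x \<in> fls_int"
  shows "poly p x \<in> fls_int"
  using assms(1)
proof (induction p)
  case (pCons a p)
  have "a \<in> fls_int" using pCons.prems[of 0] by simp
  moreover have "poly.coeff p n \<in> fls_int" for n using pCons.prems[of "Suc n"] by simp
  then have "poly p x \<in> fls_int" by (rule pCons.IH)
  ultimately show ?case using assms(2) by (simp add: fls_int_add fls_int_mult)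
qed simp

text \<open>If \<open>x\<close> had a pole, its inverse e would have positive order, and the
  reflected monic polynomial would say that 1 is the product of e with an integral element.\<close>

lemma fls_int_integrally_closed:
  assumes p: "poly.coeff p (degree p) = 1" "\<And>n. poly.coeff p n \<in> fls_int" and "poly p x = 0"
  shows "x \<in> fls_int"
proof (rule ccontr)
  assume "x \<notin> fls_int"
  then have x: "fls_subdegree x < 0" "x \<noteq> 0" by (auto simp: fls_int_def)
  define e where "e = inverse x"
  have e: "fls_subdegree e > 0" "e \<noteq> 0" using x by (simp_all add: e_def)
  have "poly (reflect_poly p) e = 0" using poly_reflect_poly_nz[OF e(2), of p] assms(3) by (simp add: e_def)
  moreover obtain a r where r: "reflect_poly p = pCons a r" by (cases "reflect_poly p")
  moreover have "a = poly.coeff (reflect_poly p) 0" by (simp add: r)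
  then have "a = 1" using p(1) by (simp add: coeff_0_reflect_poly)
  ultimately have eq: "e * poly r e = - 1" by (simp add: eq_neg_iff_add_eq_0 add.commute)
  have "poly.coeff r n \<in> fls_int" for n
  proof -
    have "poly.coeff r n = poly.coeff (reflect_poly p) (Suc n)" by (simp add: r)
    then show ?thesis using p(2) by (simp add: coeff_reflect_poly)
  qed
  then have "poly r e \<in> fls_int" using e by (intro fls_int_poly) (auto simp: fls_int_def)
  moreover have "poly r e \<noteq> 0" using eq by auto
  ultimately have "fls_subdegree (e * poly r e) > 0" using e by (simp add: fls_int_def)
  then show False unfolding eq by simp
qed

text \<open>\<open>m\<close> is the order of \<open>p\<close> at 0. That it is independent of
  \<open>x\<close> lets the orders of one rational function of u be compared at two different
  places.\<close>

lemma fls_subdegree_ev1: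
  fixes p :: "'c::field poly"
  assumes "p \<noteq> 0"
  shows "\<exists>m::nat. \<forall>x. x \<noteq> 0 \<longrightarrow> fls_subdegree x > 0 \<longrightarrow>
    ev1 fls_const x p \<noteq> 0 \<and> fls_subdegree (ev1 fls_const x p) = int m * fls_subdegree x"
  using assms
proof (induction p)
  case (pCons a p)
  note ev = type_hom.ev1_pCons[OF type_hom_fls_const]
  have int: "ev1 fls_const x r \<in> fls_int" if "fls_subdegree x > 0" for x and r :: "'c poly"
    unfolding ev1_def using that by (intro fls_int_poly) (auto simp: coeff_map_poly fls_int_def)
  show ?case
  proof (cases "a = 0")
    case True
    then have "p \<noteq> 0" using pCons by simp
    then obtain m where m: "\<And>x. x \<noteq> 0 \<Longrightarrow> fls_subdegree x > 0 \<Longrightarrow>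
      ev1 fls_const x p \<noteq> 0 \<and> fls_subdegree (ev1 fls_const x p) = int m * fls_subdegree x"
      using pCons.IH by blast
    show ?thesis
      using m by (intro exI[of _ "Suc m"]) (auto simp: ev True algebra_simps)
  next
    case False
    have "fls_const a + x * ev1 fls_const x p \<noteq> 0 \<and> fls_subdegree (fls_const a + x * ev1 fls_const x p) = 0"
      if x: "x \<noteq> 0" "fls_subdegree x > 0" for x
    proof (cases "x * ev1 fls_const x p = 0")
      case True
      show ?thesis unfolding True using False by simp
    next
      case nz: False
      then have "fls_subdegree (x * ev1 fls_const x p) > 0"
        using int[OF x(2), of p] x by (auto simp: fls_int_def)
      then have lt: "fls_subdegree (fls_const a) < fls_subdegree (x * ev1 fls_const x p)" by simp
      have nth: "fls_nth (fls_const a + x * ev1 fls_const x p) 0 = a"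
        using \<open>fls_subdegree (x * ev1 fls_const x p) > 0\<close> by (simp del: fls_subdegree_mult)
      have "fls_const a + x * ev1 fls_const x p \<noteq> 0" using nth False by (metis fls_zero_nth)
      moreover have "fls_subdegree (fls_const a + x * ev1 fls_const x p) = fls_subdegree (fls_const a)"
        by (rule fls_subdegree_add_eq1[OF _ lt]) (use False in simp)
      ultimately show ?thesis by simp
    qed
    then show ?thesis by (intro exI[of _ 0]) (auto simp: ev)
  qed
qed simp

text \<open>If \<open>a\<close> has order i, the two summands have orders i and 1 - i. These are
  never equal, and the smaller one is at most 0. The exact order 1 of \<open>t\<close> is
  essential.\<close>

lemma fls_subdegree_add_quotient:
  fixes a t :: "'c::field fls"
  assumes "a \<noteq> 0" "fls_subdegree t = 1"
  shows "a + t / a \<noteq> 0 \<and> fls_subdegree (a + t / a) \<le> 0"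
proof -
  have t: "t \<noteq> 0" using assms(2) by auto
  have q: "t / a \<noteq> 0" "fls_subdegree (t / a) = 1 - fls_subdegree a"
    using assms t by (simp_all add: divide_inverse)
  show ?thesis
  proof (cases "fls_subdegree a \<le> 0")
    case True
    then have lt: "fls_subdegree a < fls_subdegree (t / a)" using q by simp
    have "fls_nth (a + t / a) (fls_subdegree a) \<noteq> 0" using lt assms by simp
    then have "a + t / a \<noteq> 0" by (metis fls_zero_nth)
    then show ?thesis using fls_subdegree_add_eq1[OF assms(1) lt] True by simp
  next
    case False
    then have lt: "fls_subdegree (t / a) < fls_subdegree a" using q by simp
    have "fls_nth (a + t / a) (fls_subdegree (t / a)) \<noteq> 0" using lt q(1) by (simp del: fls_divide_subdegree)
    then have "a + t / a \<noteq> 0" by (metis fls_zero_nth)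
    then show ?thesis using fls_subdegree_add_eq2[OF q(1) lt] False q by simp
  qed
qed

section \<open>A criterion for points that are not Galois\<close>

definition dot3 :: "'c::comm_ring_1 ^ 3 \<Rightarrow> 'c ^ 3 \<Rightarrow> 'c"
  where "dot3 a v = a$1 * v$1 + a$2 * v$2 + a$3 * v$3"

definition cross3 :: "'c::comm_ring_1 ^ 3 \<Rightarrow> 'c ^ 3 \<Rightarrow> 'c ^ 3"
  where "cross3 v w = vector [v$2 * w$3 - v$3 * w$2, v$3 * w$1 - v$1 * w$3, v$1 * w$2 - v$2 * w$1]"

lemma cross3_nth [simp]:
  "cross3 v w $ 1 = v$2 * w$3 - v$3 * w$2" "cross3 v w $ 2 = v$3 * w$1 - v$1 * w$3"
  "cross3 v w $ 3 = v$1 * w$2 - v$2 * w$1"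
  by (simp_all add: cross3_def)

lemma dot3_cross3: "dot3 (cross3 v w) u = det3 u v w"
  by (simp add: dot3_def det3_def algebra_simps)

lemma det3_orthogonal:
  fixes v :: "'c::idom ^ 3"
  assumes "v \<noteq> 0" "dot3 a v = 0" "dot3 b v = 0" "dot3 c v = 0"
  shows "det3 a b c = 0"
proof -
  have "v$1 * det3 a b c = dot3 a v * (b$2 * c$3 - b$3 * c$2) - dot3 b v * (a$2 * c$3 - a$3 * c$2) + dot3 c v * (a$2 * b$3 - a$3 * b$2)"
    "v$2 * det3 a b c = - dot3 a v * (b$1 * c$3 - b$3 * c$1) + dot3 b v * (a$1 * c$3 - a$3 * c$1) - dot3 c v * (a$1 * b$3 - a$3 * b$1)"
    "v$3 * det3 a b c = dot3 a v * (b$1 * c$2 - b$2 * c$1) - dot3 b v * (a$1 * c$2 - a$2 * c$1) + dot3 c v * (a$1 * b$2 - a$2 * b$1)"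
    unfolding dot3_def det3_def by (simp_all add: algebra_simps)
  moreover have "v$1 \<noteq> 0 \<or> v$2 \<noteq> 0 \<or> v$3 \<noteq> 0" using assms(1) by (auto simp: vec_eq_iff forall_3)
  ultimately show ?thesis using assms(2-4) by auto
qed

lemma divide_comb:
  fixes x :: "'c::field"
  assumes "D \<noteq> 0" "x * D = a * l + b * m"
  shows "x = a / D * l + b / D * m"
proof -
  have "x = (x * D) / D" using assms(1) by simp
  then show ?thesis unfolding assms(2) by (simp add: add_divide_distrib)
qed

lemma det3_eq_0_comb:
  fixes l m u :: "'c::field ^ 3"
  assumes "det3 u l m = 0" "cross3 l m \<noteq> 0"
  obtains a b where "u = a *s l + b *s m"
proof -
  have d: "u$1 * (l$2 * m$3 - l$3 * m$2) - u$2 * (l$1 * m$3 - l$3 * m$1) + u$3 * (l$1 * m$2 - l$2 * m$1) = 0"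
    using assms(1) by (simp add: det3_def)
  consider "l$1 * m$2 - l$2 * m$1 \<noteq> 0" | "l$2 * m$3 - l$3 * m$2 \<noteq> 0" | "l$3 * m$1 - l$1 * m$3 \<noteq> 0"
    using assms(2) by (auto simp: vec_eq_iff forall_3)
  then show ?thesis
  proof cases
    case 1
    define D where "D = l$1 * m$2 - l$2 * m$1"
    have D: "D \<noteq> 0" using 1 by (simp add: D_def)
    have "u$1 * D = (u$1 * m$2 - u$2 * m$1) * l$1 + (l$1 * u$2 - l$2 * u$1) * m$1"
      "u$2 * D = (u$1 * m$2 - u$2 * m$1) * l$2 + (l$1 * u$2 - l$2 * u$1) * m$2"
      by (simp_all add: D_def algebra_simps)
    moreover have "u$3 * D = (u$1 * m$2 - u$2 * m$1) * l$3 + (l$1 * u$2 - l$2 * u$1) * m$3"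
      using d by (simp add: D_def algebra_simps)
    ultimately have "u = ((u$1 * m$2 - u$2 * m$1) / D) *s l + ((l$1 * u$2 - l$2 * u$1) / D) *s m"
      using divide_comb[OF D] by (intro vec3_cong) simp_all
    then show ?thesis by (rule that)
  next
    case 2
    define D where "D = l$2 * m$3 - l$3 * m$2"
    have D: "D \<noteq> 0" using 2 by (simp add: D_def)
    have "u$2 * D = (u$2 * m$3 - u$3 * m$2) * l$2 + (l$2 * u$3 - l$3 * u$2) * m$2"
      "u$3 * D = (u$2 * m$3 - u$3 * m$2) * l$3 + (l$2 * u$3 - l$3 * u$2) * m$3"
      by (simp_all add: D_def algebra_simps)
    moreover have "u$1 * D = (u$2 * m$3 - u$3 * m$2) * l$1 + (l$2 * u$3 - l$3 * u$2) * m$1"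
      using d by (simp add: D_def algebra_simps)
    ultimately have "u = ((u$2 * m$3 - u$3 * m$2) / D) *s l + ((l$2 * u$3 - l$3 * u$2) / D) *s m"
      using divide_comb[OF D] by (intro vec3_cong) simp_all
    then show ?thesis by (rule that)
  next
    case 3
    define D where "D = l$3 * m$1 - l$1 * m$3"
    have D: "D \<noteq> 0" using 3 by (simp add: D_def)
    have "u$3 * D = (u$3 * m$1 - u$1 * m$3) * l$3 + (l$3 * u$1 - l$1 * u$3) * m$3"
      "u$1 * D = (u$3 * m$1 - u$1 * m$3) * l$1 + (l$3 * u$1 - l$1 * u$3) * m$1"
      by (simp_all add: D_def algebra_simps)
    moreover have "u$2 * D = (u$3 * m$1 - u$1 * m$3) * l$2 + (l$3 * u$1 - l$1 * u$3) * m$2"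
      using d by (simp add: D_def algebra_simps)
    ultimately have "u = ((u$3 * m$1 - u$1 * m$3) / D) *s l + ((l$3 * u$1 - l$1 * u$3) / D) *s m"
      using divide_comb[OF D] by (intro vec3_cong) simp_all
    then show ?thesis by (rule that)
  qed
qed

lemma cross3_eq_0:
  fixes l m :: "'c::field ^ 3"
  assumes "cross3 l m = 0" "m \<noteq> 0"
  obtains k where "l = k *s m"
proof -
  have e: "l$2 * m$3 = l$3 * m$2" "l$3 * m$1 = l$1 * m$3" "l$1 * m$2 = l$2 * m$1"
    using assms(1) by (auto simp: vec_eq_iff forall_3)
  consider "m$1 \<noteq> 0" | "m$2 \<noteq> 0" | "m$3 \<noteq> 0" using assms(2) by (auto simp: vec_eq_iff forall_3)
  then show ?thesis
  proof cases
    case 1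
    then have "l = (l$1 / m$1) *s m" using e by (intro vec3_cong) (simp_all add: field_simps)
    then show ?thesis by (rule that)
  next
    case 2
    then have "l = (l$2 / m$2) *s m" using e by (intro vec3_cong) (simp_all add: field_simps)
    then show ?thesis by (rule that)
  next
    case 3
    then have "l = (l$3 / m$3) *s m" using e by (intro vec3_cong) (simp_all add: field_simps)
    then show ?thesis by (rule that)
  qed
qed

definition lin :: "'c::field ^ 3 \<Rightarrow> 'c fls ^ 3 \<Rightarrow> 'c fls"
  where "lin l U = fls_const (l$1) * U$1 + fls_const (l$2) * U$2 + fls_const (l$3) * U$3"

lemma ev3_lin: "ev3 fls_const U (linear_form l) = lin l U"
  unfolding lin_def by (rule ev3_linear_form[OF type_hom_fls_const])

lemma lin_comb: "lin (a *s l + b *s m) U = fls_const a * lin l U + fls_const b * lin m U"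
  by (simp add: lin_def algebra_simps flip: fls_plus_const fls_const_mult_const)

lemma nonconstant_fls:
  assumes "lin m U \<noteq> 0" "fls_subdegree (lin l U / lin m U) \<noteq> 0"
  shows "nonconstant fls_const U"
  unfolding nonconstant_def
proof
  assume "\<exists>s v. \<forall>i. U $ i = s * fls_const (v $ i)"
  then obtain s v where "\<forall>i. U $ i = s * fls_const (v $ i)" by blast
  then have "lin n U = s * fls_const (dot3 n v)" for n
    by (simp add: lin_def dot3_def algebra_simps flip: fls_plus_const fls_const_mult_const)
  then have "lin l U / lin m U = fls_const (dot3 l v) / fls_const (dot3 m v)" using assms(1) by simp
  also have "\<dots> = fls_const (dot3 l v / dot3 m v)" by (rule fls_const_divide_const)
  finally show False using assms(2) by simp
qed

text \<open>\<open>u\<close> is a uniformizer at the first place and has a multiple zero at the second one, where \<open>w\<close> is a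
  uniformizer. All conjugates of the inverse of \<open>w + u/w\<close> are integral at the first place, so it is
  integral over the local ring of \<open>u = 0\<close>, although \<open>w + u/w\<close> vanishes at the second place.\<close>

lemma not_galois:
  fixes U1 U2 :: "'a::finite_field alg_closure fls ^ 3" and v l m n n' :: "'a alg_closure ^ 3"
  assumes q: "q = CARD('a)" and F: "dgz_at q U1 = 0" "dgz_at q U2 = 0"
    and v: "v \<noteq> 0" "dot3 l v = 0" "dot3 m v = 0"
    and m: "lin m U1 \<noteq> 0" "lin m U2 \<noteq> 0"
    and u1: "fls_subdegree (lin l U1 / lin m U1) = 1"
    and u2: "lin l U2 / lin m U2 = 0 \<or> 2 \<le> fls_subdegree (lin l U2 / lin m U2)"
    and n: "lin n' U2 \<noteq> 0" "fls_subdegree (lin n U2 / lin n' U2) = 1"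
  shows "\<not> ring.galois_over (function_field (DGZ_form q)) (projection_subfield (DGZ_form q) (proj_point v))"
proof
  interpret L: kfield "fls_const :: 'a alg_closure \<Rightarrow> _" q
    unfolding kfield_def kdomain_def kalgebra_iff using q type_hom_fls_const by blast
  define R where "R = function_field (DGZ_form q :: 'a alg_closure poly3)"
  define K where "K = projection_subfield (DGZ_form q) (proj_point v)"
  assume "ring.galois_over (function_field (DGZ_form q)) (projection_subfield (DGZ_form q) (proj_point v))"
  then have gal: "ring.galois_over R K" by (simp add: R_def K_def)
  have gen1: "L.generic U1" unfolding L.generic_def using F nonconstant_fls[OF m(1), of l] u1 by simp
  have gen2: "L.generic U2" unfolding L.generic_def using F nonconstant_fls[OF n(1), of n] n(2) by simp
  define h1 where "h1 = L.point_hom U1"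
  define h2 where "h2 = L.point_hom U2"
  have h1: "field_to_type R h1" and h2: "field_to_type R h2"
    unfolding h1_def h2_def R_def using gen1 gen2 by (auto intro: L.point_hom_field_to_type)
  interpret h1: field_to_type R h1 by fact
  interpret h2: field_to_type R h2 by fact
  have hf: "homogeneous3 (Suc 0) (linear_form l)" for l :: "'a alg_closure ^ 3" by (rule homogeneous3_linear_form)
  have cf: "curve_frac q (linear_form l) (linear_form m)" if "lin m U1 \<noteq> 0 \<or> lin m U2 \<noteq> 0" for l m
    using that L.curve_fracI[OF gen1 hf hf, of m l] L.curve_fracI[OF gen2 hf hf, of m l] unfolding ev3_lin by blast
  define u where "u = curve_class q (linear_form l) (linear_form m)"
  define w where "w = curve_class q (linear_form n) (linear_form n')"
  have uR: "u \<in> carrier R" and wR: "w \<in> carrier R"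
    unfolding u_def w_def R_def using cf m n by (auto intro: L.curve_class_closed)
  define t1 where "t1 = lin l U1 / lin m U1"
  define t2 where "t2 = lin l U2 / lin m U2"
  have hu: "h1 u = t1" "h2 u = t2"
    unfolding u_def h1_def h2_def t1_def t2_def
    using L.point_hom_class[OF gen1 cf] L.point_hom_class[OF gen2 cf] m by (simp_all add: ev3_lin)
  have hw: "h2 w = lin n U2 / lin n' U2"
    unfolding w_def h2_def using L.point_hom_class[OF gen2 cf] n by (simp add: ev3_lin)
  have t1: "t1 \<noteq> 0" "fls_subdegree t1 = 1" using u1 by (auto simp: t1_def)
  then have u0: "u \<noteq> \<zero>\<^bsub>R\<^esub>" using hu(1) by auto
  \<comment> \<open>The vanishing alternative for the second place is excluded: \<open>u\<close> is
    nonzero in the function field and evaluation is injective.\<close>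
  then have t2: "t2 \<noteq> 0" "2 \<le> fls_subdegree t2" using u2 hu(2) h2.h_eq_0_iff[OF uR] by (auto simp: t2_def)
  have w0: "w \<noteq> \<zero>\<^bsub>R\<^esub>" using hw n(2) by auto
  define y where "y = w \<oplus>\<^bsub>R\<^esub> u \<otimes>\<^bsub>R\<^esub> inv\<^bsub>R\<^esub> w"
  have yR: "y \<in> carrier R" unfolding y_def using uR wR w0 h1.inv_closed' by auto
  have hy: "h y = h w + h u / h w" if "field_to_type R h" for h :: "_ \<Rightarrow> 'a alg_closure fls"
  proof -
    interpret field_to_type R h by fact
    show ?thesis unfolding y_def using uR wR w0 inv_closed' by (simp add: divide_inverse)
  qed
  have unit: "h y \<noteq> 0 \<and> fls_subdegree (h y) \<le> 0" if "field_to_type R h" "h u = t1" for h :: "_ \<Rightarrow> 'a alg_closure fls"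
  proof -
    interpret field_to_type R h by fact
    show ?thesis unfolding hy[OF that(1)] that(2) using t1(2) wR w0 by (intro fls_subdegree_add_quotient) auto
  qed
  have y0: "y \<noteq> \<zero>\<^bsub>R\<^esub>" using unit[OF h1 hu(1)] by auto
  define z where "z = inv\<^bsub>R\<^esub> y"
  have zR: "z \<in> carrier R" unfolding z_def using yR y0 by (rule h1.inv_closed')

  have Kgen: "K = generate_field R (L.proj_gens (proj_point v))" unfolding K_def R_def by (rule L.projection_subfield_eq)
  have gensR: "L.proj_gens (proj_point v) \<subseteq> carrier R" unfolding R_def by (rule L.proj_gens_closed[OF gen1])
  have uK: "u \<in> K"
  proof -
    have "u \<in> L.proj_gens (proj_point v)"
      unfolding u_def L.proj_gens_def using cf[of m l] m v(2,3) unfolding curve_frac_def dot3_def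
      by (blast intro: linear_form_through)
    then show ?thesis unfolding Kgen by (rule generate_field.incl)
  qed
  note ev = type_hom.type_hom_ev1[OF type_hom_fls_const]
  \<comment> \<open>\<open>K\<close> is k(u): each element is A(u)/B(u), with the same
    \<open>A\<close> and \<open>B\<close> at both places. The condition is stated without
    division.\<close>
  define rep where "rep = (\<lambda>x (A :: 'a alg_closure poly) B. B \<noteq> 0 \<and> h1 x * ev1 fls_const t1 B = ev1 fls_const t1 A
    \<and> h2 x * ev1 fls_const t2 B = ev1 fls_const t2 A)"
  have ev_nz: "ev1 fls_const t1 B \<noteq> 0" "ev1 fls_const t2 B \<noteq> 0" if "B \<noteq> 0" for B :: "'a alg_closure poly"
    using fls_subdegree_ev1[OF that] t1 t2 by auto
  have repK: "x \<in> carrier R \<and> (\<exists>A B. rep x A B)" if "x \<in> K" for x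
    using that unfolding Kgen
  proof (induction rule: generate_field.induct)
    case one
    have "rep \<one>\<^bsub>R\<^esub> 1 1" by (simp add: rep_def type_hom.hom_1[OF ev])
    then show ?case by auto
  next
    case (incl x)
    then have xR: "x \<in> carrier R" using gensR by blast
    from gen1 incl have "\<exists>A B. rep x A B"
    proof (cases rule: L.proj_gens_cases)
      case (1 c)
      have "h1 x = fls_const c" "h2 x = fls_const c"
        unfolding 1(1) h1_def h2_def L.point_hom_class[OF gen1 1(2)] L.point_hom_class[OF gen2 1(2)]
        by (simp_all add: ev3_const3[OF type_hom_fls_const] type_hom.hom_1[OF L.type_hom_ev3_emb])
      then have "rep x [:c:] 1"
        by (simp add: rep_def type_hom.hom_1[OF ev] type_hom.ev1_pCons[OF type_hom_fls_const] type_hom.ev1_0[OF type_hom_fls_const])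
      then show ?thesis by blast
    next
      case (2 l' m')
      obtain a where a: "l' = linear_form a" "dot3 a v = 0" using linear_forms_throughE[OF 2(3)] by (auto simp: dot3_def)
      obtain b where b: "m' = linear_form b" "dot3 b v = 0" using linear_forms_throughE[OF 2(4)] by (auto simp: dot3_def)
      \<comment> \<open>The quotient of \<open>l\<close> and \<open>m\<close> is not constant, so
        the two forms are independent and span all forms vanishing at \<open>v\<close>.\<close>
      have cr: "cross3 l m \<noteq> 0"
      proof
        assume 0: "cross3 l m = 0"
        have "m \<noteq> 0" using m(1) by (auto simp: lin_def)
        from cross3_eq_0[OF 0 this] obtain k where "l = k *s m" .
        then have "lin l U1 = fls_const k * lin m U1" using lin_comb[of k m 0 0 U1] by simp
        then show False using t1(2) m(1) by (simp add: t1_def)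
      qed
      obtain a1 a2 where a12: "a = a1 *s l + a2 *s m"
        using det3_eq_0_comb[OF det3_orthogonal[OF v(1) a(2) v(2,3)] cr] .
      obtain b1 b2 where b12: "b = b1 *s l + b2 *s m"
        using det3_eq_0_comb[OF det3_orthogonal[OF v(1) b(2) v(2,3)] cr] .
      have ev2: "ev1 fls_const t [:a2, a1:] = fls_const a2 + t * fls_const a1" for t :: "'a alg_closure fls" and a1 a2
        by (simp add: type_hom.ev1_pCons[OF type_hom_fls_const] type_hom.ev1_0[OF type_hom_fls_const])
      have la: "lin a U1 = lin m U1 * ev1 fls_const t1 [:a2, a1:]" "lin a U2 = lin m U2 * ev1 fls_const t2 [:a2, a1:]"
        unfolding a12 lin_comb ev2 t1_def t2_def using m by (simp_all add: field_simps)
      have lb: "lin b U1 = lin m U1 * ev1 fls_const t1 [:b2, b1:]" "lin b U2 = lin m U2 * ev1 fls_const t2 [:b2, b1:]"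
        unfolding b12 lin_comb ev2 t1_def t2_def using m by (simp_all add: field_simps)
      have nz: "lin b U1 \<noteq> 0" "lin b U2 \<noteq> 0"
        using L.curve_frac_ev3[OF gen1 2(2)] L.curve_frac_ev3[OF gen2 2(2)] unfolding b ev3_lin by auto
      have "h1 x = lin a U1 / lin b U1" "h2 x = lin a U2 / lin b U2"
        using L.point_hom_class[OF gen1 2(2)] L.point_hom_class[OF gen2 2(2)]
        unfolding 2(1) h1_def h2_def unfolding a b ev3_lin by auto
      moreover have "[:b2, b1:] \<noteq> 0"
      proof
        assume "[:b2, b1:] = 0"
        then show False using nz(1) unfolding lb(1) by (simp add: type_hom.ev1_0[OF type_hom_fls_const])
      qed
      ultimately have "rep x [:a2, a1:] [:b2, b1:]"
        using nz unfolding rep_def la lb by auto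
      then show ?thesis by blast
    qed
    then show ?case using xR by blast
  next
    case (a_inv x)
    then obtain A B where "rep x A B" "x \<in> carrier R" by blast
    then have "rep (\<ominus>\<^bsub>R\<^esub> x) (- A) B" by (simp add: rep_def type_hom.hom_uminus[OF ev])
    then show ?case using \<open>x \<in> carrier R\<close> by blast
  next
    case (m_inv x)
    then obtain A B where AB: "rep x A B" and x: "x \<in> carrier R" by blast
    have "h1 x \<noteq> 0" "h2 x \<noteq> 0" using x m_inv by auto
    moreover have "A \<noteq> 0"
    proof
      assume "A = 0"
      then show False using AB ev_nz \<open>h1 x \<noteq> 0\<close> by (auto simp: rep_def type_hom.ev1_0[OF type_hom_fls_const])
    qed
    ultimately have "rep (inv\<^bsub>R\<^esub> x) B A"
      using AB x m_inv(2) by (auto simp: rep_def field_simps)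
    then show ?case using h1.inv_closed'[OF x m_inv(2)] by blast
  next
    case (eng_add x y)
    then obtain A B A' B' where r: "rep x A B" "rep y A' B'" and xy: "x \<in> carrier R" "y \<in> carrier R" by blast
    from r have A: "ev1 fls_const t1 A = h1 x * ev1 fls_const t1 B" "ev1 fls_const t2 A = h2 x * ev1 fls_const t2 B"
      "ev1 fls_const t1 A' = h1 y * ev1 fls_const t1 B'" "ev1 fls_const t2 A' = h2 y * ev1 fls_const t2 B'"
      and B: "B * B' \<noteq> 0" by (auto simp: rep_def)
    have "rep (x \<oplus>\<^bsub>R\<^esub> y) (A * B' + A' * B) (B * B')"
      using xy B by (simp add: rep_def type_hom.hom_add[OF ev] type_hom.hom_mult[OF ev] A algebra_simps)
    then show ?case using xy by blast
  next
    case (eng_mult x y)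
    then obtain A B A' B' where r: "rep x A B" "rep y A' B'" and xy: "x \<in> carrier R" "y \<in> carrier R" by blast
    from r have A: "ev1 fls_const t1 A = h1 x * ev1 fls_const t1 B" "ev1 fls_const t2 A = h2 x * ev1 fls_const t2 B"
      "ev1 fls_const t1 A' = h1 y * ev1 fls_const t1 B'" "ev1 fls_const t2 A' = h2 y * ev1 fls_const t2 B'"
      and B: "B * B' \<noteq> 0" by (auto simp: rep_def)
    have "rep (x \<otimes>\<^bsub>R\<^esub> y) (A * A') (B * B')"
      using xy B by (simp add: rep_def type_hom.hom_mult[OF ev] A algebra_simps)
    then show ?case using xy by blast
  qed
  \<comment> \<open>On \<open>K\<close> the order at the second place is the order at the first one
    times the order of \<open>u\<close> there, which is positive.\<close>
  have intK: "h2 x \<in> fls_int" if xK: "x \<in> K" "h1 x \<in> fls_int" for x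
  proof -
    obtain A B where r: "rep x A B" and xR: "x \<in> carrier R" using repK[OF xK(1)] by blast
    show ?thesis
    proof (cases "x = \<zero>\<^bsub>R\<^esub>")
      case False
      then have x0: "h1 x \<noteq> 0" "h2 x \<noteq> 0" using xR by auto
      have B: "B \<noteq> 0" using r by (simp add: rep_def)
      have A: "A \<noteq> 0"
      proof
        assume "A = 0"
        then show False using r ev_nz[OF B] x0(1) by (simp add: rep_def type_hom.ev1_0[OF type_hom_fls_const])
      qed
      obtain i where i: "\<And>x. x \<noteq> 0 \<Longrightarrow> fls_subdegree x > 0 \<Longrightarrow> fls_subdegree (ev1 fls_const x A) = int i * fls_subdegree x"
        using fls_subdegree_ev1[OF A] by blast
      obtain j where j: "\<And>x. x \<noteq> 0 \<Longrightarrow> fls_subdegree x > 0 \<Longrightarrow> fls_subdegree (ev1 fls_const x B) = int j * fls_subdegree x"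
        using fls_subdegree_ev1[OF B] by blast
      have "fls_subdegree (h1 x) + fls_subdegree (ev1 fls_const t1 B) = fls_subdegree (ev1 fls_const t1 A)"
        "fls_subdegree (h2 x) + fls_subdegree (ev1 fls_const t2 B) = fls_subdegree (ev1 fls_const t2 A)"
        using r x0 ev_nz[OF B] by (simp_all add: rep_def flip: fls_subdegree_mult)
      then have "fls_subdegree (h1 x) = int i - int j" "fls_subdegree (h2 x) = (int i - int j) * fls_subdegree t2"
        using i[of t1] j[of t1] i[of t2] j[of t2] t1 t2 by (simp_all add: algebra_simps)
      then show ?thesis using xK(2) t2(2) by (simp add: fls_int_def)
    qed simp
  qed

  obtain Orb c where orb: "finite Orb" "Orb \<subseteq> carrier R" "z \<in> Orb"
    "\<And>v. v \<in> Orb \<Longrightarrow> \<exists>\<sigma>\<in>ring_iso R R. (\<forall>a\<in>K. \<sigma> a = a) \<and> v = \<sigma> z"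
    "\<And>n. c n \<in> K"
    "\<And>h n. field_to_type R (h :: _ \<Rightarrow> 'a alg_closure fls) \<Longrightarrow> poly.coeff (\<Prod>v\<in>Orb. [:- h v, 1:]) n = h (c n)"
    by (rule galois_orbit[OF gal h1 zR]) blast
  have "h1 x \<in> fls_int" if xOrb: "x \<in> Orb" for x
  proof -
    obtain \<sigma> where \<sigma>: "\<sigma> \<in> ring_iso R R" "\<forall>a\<in>K. \<sigma> a = a" "x = \<sigma> z" using orb(4)[OF xOrb] by blast
    \<comment> \<open>Composition with an automorphism over \<open>K\<close> yields another place
      with the same value of \<open>u\<close>, so the estimate for w + u/w holds there too.\<close>
    have s: "field_to_type R (\<lambda>x. h1 (\<sigma> x))" by (rule field_to_type_comp[OF h1 \<sigma>(1)])
    interpret s: field_to_type R "\<lambda>x. h1 (\<sigma> x)" by (rule s)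
    have "h1 (\<sigma> u) = t1" using \<sigma>(2) uK hu(1) by simp
    from unit[OF s this] have "fls_subdegree (inverse (h1 (\<sigma> y))) \<ge> 0" by simp
    then show ?thesis unfolding \<sigma>(3) z_def using s.h_inv[OF yR y0] by (simp add: fls_int_def)
  qed
  then have orbi: "\<forall>x\<in>Orb. h1 x \<in> fls_int" by blast
  have int1': "poly.coeff (\<Prod>v\<in>S. [:- h1 v, 1:]) n \<in> fls_int" if "finite S" "\<forall>x\<in>S. h1 x \<in> fls_int" for S n
    using that
  proof (induction S arbitrary: n rule: finite_induct)
    case empty
    then show ?case by (cases n) auto
  next
    case (insert x S)
    then have IH: "poly.coeff (\<Prod>v\<in>S. [:- h1 v, 1:]) n \<in> fls_int" for n by simp
    have "h1 x \<in> fls_int" using insert by simp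
    then have *: "- (h1 x * poly.coeff (\<Prod>v\<in>S. [:- h1 v, 1:]) n) \<in> fls_int" for n
      using fls_int_mult[OF _ IH] by simp
    have "poly.coeff (\<Prod>v\<in>insert x S. [:- h1 v, 1:]) n =
        - (h1 x * poly.coeff (\<Prod>v\<in>S. [:- h1 v, 1:]) n) + (case n of 0 \<Rightarrow> 0 | Suc m \<Rightarrow> poly.coeff (\<Prod>v\<in>S. [:- h1 v, 1:]) m)"
      using insert.hyps by (simp add: coeff_pCons split: nat.split)
    also have "\<dots> \<in> fls_int" using * IH by (intro fls_int_add) (auto split: nat.split)
    finally show ?case .
  qed
  have int1: "poly.coeff (\<Prod>v\<in>Orb. [:- h1 v, 1:]) n \<in> fls_int" for n
    by (rule int1'[OF orb(1) orbi])
  define P2 where "P2 = (\<Prod>v\<in>Orb. [:- h2 v, 1:])"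
  have int2: "poly.coeff P2 n \<in> fls_int" for n
    using intK[OF orb(5)[of n]] int1[of n] unfolding P2_def orb(6)[OF h2] orb(6)[OF h1] by blast
  have lc: "poly.coeff P2 (degree P2) = 1" unfolding P2_def by (simp only: lead_coeff_prod) simp
  have "poly [:- h2 z, 1:] (h2 z) = 0" by simp
  then have root: "poly P2 (h2 z) = 0"
    unfolding P2_def poly_prod using prod_zero[OF orb(1), of "\<lambda>v. poly [:- h2 v, 1:] (h2 z)"] orb(3) by blast
  have "h2 z \<in> fls_int" by (rule fls_int_integrally_closed[OF lc int2 root])
  \<comment> \<open>At the second place \<open>w\<close> has order 1 and \<open>u\<close> at least
    2, so both summands of \<open>y\<close> have positive order and the inverse of \<open>y\<close>
    has a pole.\<close>
  moreover have "fls_subdegree (h2 y) > 0"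
  proof -
    have a: "h2 w \<noteq> 0" "fls_subdegree (h2 w) = 1" using w0 wR n(2) hw by auto
    have b: "fls_subdegree (h2 u / h2 w) \<ge> 1"
      using a t2 unfolding hu by (simp add: divide_inverse)
    have "h2 w + h2 u / h2 w \<noteq> 0" using hy[OF h2] y0 yR by auto
    then show ?thesis unfolding hy[OF h2] using fls_plus_subdegree[of "h2 w" "h2 u / h2 w"] a b by simp
  qed
  ultimately show False
    unfolding z_def using h2.h_inv[OF yR y0] by (simp add: fls_int_def)
qed

section \<open>Power series solutions\<close>

lemma fps_X_power_dvd_iff: "fps_X ^ n dvd (f :: 'c::field fps) \<longleftrightarrow> (\<forall>i<n. fps_nth f i = 0)"
proof
  assume "fps_X ^ n dvd f"
  then obtain g where "f = fps_X ^ n * g" by (elim dvdE)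
  then show "\<forall>i<n. fps_nth f i = 0" by (simp add: fps_X_power_mult_nth)
next
  assume "\<forall>i<n. fps_nth f i = 0"
  then have "f = fps_X ^ n * fps_shift n f"
    by (intro fps_ext) (simp add: fps_X_power_mult_nth)
  then show "fps_X ^ n dvd f" by (rule dvdI)
qed

text \<open>Successive iterates from 0 agree to increasing order, so their coefficients stabilize.
  The condition on constant terms is the case n = 0 of the contraction.\<close>

lemma fps_fixpoint:
  fixes \<Psi> :: "'c::field fps \<Rightarrow> 'c fps"
  assumes 0: "\<And>f. fps_nth f 0 = 0 \<Longrightarrow> fps_nth (\<Psi> f) 0 = 0"
    and contr: "\<And>f g n. fps_nth f 0 = 0 \<Longrightarrow> fps_nth g 0 = 0 \<Longrightarrow> 0 < n \<Longrightarrow> fps_X ^ n dvd f - g \<Longrightarrow> fps_X ^ Suc n dvd \<Psi> f - \<Psi> g"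
  obtains f where "fps_nth f 0 = 0" "\<Psi> f = f"
proof -
  define a where "a = (\<lambda>n. (\<Psi> ^^ n) 0)"
  have a0: "fps_nth (a n) 0 = 0" for n by (induction n) (auto simp: a_def 0)
  have contr': "fps_X ^ Suc n dvd \<Psi> f - \<Psi> g" if "fps_nth f 0 = 0" "fps_nth g 0 = 0" "fps_X ^ n dvd f - g" for f g n
  proof (cases "n = 0")
    case True
    then show ?thesis using 0[OF that(1)] 0[OF that(2)] fps_X_power_dvd_iff[of 1 "\<Psi> f - \<Psi> g"] by simp
  next
    case False
    then show ?thesis using that by (intro contr) auto
  qed
  have step: "fps_X ^ Suc n dvd a (Suc n) - a n" for n
  proof (induction n)
    case 0
    then show ?case using a0[of 1] a0[of 0] fps_X_power_dvd_iff[of 1 "a 1 - a 0"] by simp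
  next
    case (Suc n)
    then show ?case using contr'[OF a0 a0 Suc] by (simp add: a_def)
  qed
  have stable: "fps_nth (a m) i = fps_nth (a (Suc i)) i" if "Suc i \<le> m" for m i
    using that
  proof (induction m rule: dec_induct)
    case (step m)
    have "fps_nth (a (Suc m) - a m) i = 0"
      using \<open>\<And>n. fps_X ^ Suc n dvd a (Suc n) - a n\<close>[of m, unfolded fps_X_power_dvd_iff] step.hyps by simp
    then show ?case using step.IH by simp
  qed simp
  define f where "f = Abs_fps (\<lambda>i. fps_nth (a (Suc i)) i)"
  have fa: "fps_X ^ n dvd f - a n" for n
    unfolding fps_X_power_dvd_iff using stable[of _ n] by (simp add: f_def)
  have f0: "fps_nth f 0 = 0" using a0[of 1] by (simp add: f_def)
  have "fps_nth (\<Psi> f - f) n = 0" for n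
  proof -
    have "fps_X ^ Suc n dvd \<Psi> f - \<Psi> (a n)" by (rule contr'[OF f0 a0 fa])
    moreover have "fps_X ^ Suc n dvd f - a (Suc n)" by (rule fa)
    ultimately have "fps_X ^ Suc n dvd (\<Psi> f - \<Psi> (a n)) - (f - a (Suc n))" by (rule dvd_diff)
    also have "(\<Psi> f - \<Psi> (a n)) - (f - a (Suc n)) = \<Psi> f - f" by (simp add: a_def)
    finally show ?thesis unfolding fps_X_power_dvd_iff by simp
  qed
  then have "\<Psi> f - f = 0" by (intro fps_ext) simp
  then show ?thesis using f0 that by simp
qed

section \<open>Congruences of power series and determinants\<close>

lemma dvd_mult_diff:
  fixes d a b c e :: "'c::comm_ring_1"
  assumes "d dvd a - b" "d dvd c - e"
  shows "d dvd a * c - b * e"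
proof -
  have "a * c - b * e = (a - b) * c + b * (c - e)" by (simp add: algebra_simps)
  then show ?thesis using assms by simp
qed

lemma dvd_power_diff: "d dvd a - b \<Longrightarrow> d dvd a ^ n - b ^ n" for d a b :: "'c::comm_ring_1"
  by (induction n) (auto intro: dvd_mult_diff)

lemma dvd_add_diff: "d dvd a - b \<Longrightarrow> d dvd c - e \<Longrightarrow> d dvd (a + c) - (b + e)" for d :: "'c::comm_ring_1"
  using dvd_add[of d "a - b" "c - e"] by (simp add: algebra_simps)

lemma dvd_diff_diff: "d dvd a - b \<Longrightarrow> d dvd c - e \<Longrightarrow> d dvd (a - c) - (b - e)" for d :: "'c::comm_ring_1"
  using dvd_diff[of d "a - b" "c - e"] by (simp add: algebra_simps)

lemma dvd_inverse_diff:
  fixes f g :: "'c::field fps"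
  assumes "d dvd f - g" "fps_nth f 0 \<noteq> 0" "fps_nth g 0 \<noteq> 0"
  shows "d dvd inverse f - inverse g"
proof -
  have f: "inverse f * f = 1" and g: "inverse g * g = 1"
    using assms by (auto intro: inverse_mult_eq_1)
  have "inverse f - inverse g = inverse f * (inverse g * g) - inverse g * (inverse f * f)" by (simp add: f g)
  also have "\<dots> = (f - g) * (- (inverse f * inverse g))" by (simp add: algebra_simps)
  finally show ?thesis using assms(1) by simp
qed

lemma dvd_det3_diff:
  fixes d :: "'c::comm_ring_1"
  assumes "\<And>i. d dvd a $ i - a' $ i" "\<And>i. d dvd b $ i - b' $ i" "\<And>i. d dvd c $ i - c' $ i"
  shows "d dvd det3 a b c - det3 a' b' c'"
  unfolding det3_def by (intro dvd_add_diff dvd_diff_diff dvd_mult_diff assms)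

lemma type_hom_fps_const: "type_hom (fps_const :: 'c::comm_ring_1 \<Rightarrow> 'c fps)"
  by unfold_locales auto

lemma type_hom_fps_nth_0: "type_hom (\<lambda>f :: 'c::comm_ring_1 fps. fps_nth f 0)"
  by unfold_locales auto

definition vconst :: "'c::field ^ 3 \<Rightarrow> 'c fps ^ 3"
  where "vconst v = (\<chi> i. fps_const (v $ i))"

lemma vconst_nth [simp]: "vconst v $ i = fps_const (v $ i)"
  by (simp add: vconst_def)

lemma det3_vconst: "det3 (vconst u) (vconst v) (vconst w) = fps_const (det3 u v w)"
  by (simp add: det3_def)

text \<open>The equation is linear in the first column of the determinant; the unknown enters the other two
  columns only through its \<open>q\<close>-th power, which makes the iteration contracting.\<close>

lemma dgz_num_solution:
  fixes P S T :: "'a::finite_field alg_closure ^ 3"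
  assumes q: "q = CARD('a)" and P: "dgz_num q P = 0" and T: "det3 T (frob q P) (frob (q ^ 3) P) \<noteq> 0"
  obtains f where "fps_nth f 0 = 0"
    "dgz_num q (vconst P + fps_X *s vconst S + f *s vconst T) = 0"
    "\<And>k. fps_X ^ k dvd
       det3 (vconst P) (frob q (vconst P + fps_X *s vconst S + f *s vconst T)) (frob (q ^ 3) (vconst P + fps_X *s vconst S + f *s vconst T))
       + fps_X * det3 (vconst S) (frob q (vconst P + fps_X *s vconst S + f *s vconst T)) (frob (q ^ 3) (vconst P + fps_X *s vconst S + f *s vconst T))
      \<Longrightarrow> fps_X ^ k dvd f"
proof -
  interpret A: kalgebra "fps_const :: 'a alg_closure \<Rightarrow> _" q
    unfolding kalgebra_iff using q type_hom_fps_const by blast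
  define V where "V = (\<lambda>f. vconst P + fps_X *s vconst S + f *s vconst T)"
  define num where "num = (\<lambda>f. det3 (vconst P) (frob q (V f)) (frob (q ^ 3) (V f)) + fps_X * det3 (vconst S) (frob q (V f)) (frob (q ^ 3) (V f)))"
  define den where "den = (\<lambda>f. det3 (vconst T) (frob q (V f)) (frob (q ^ 3) (V f)))"
  define \<Psi> where "\<Psi> = (\<lambda>f. - (num f * inverse (den f)))"
  have V0: "(\<chi> i. fps_nth (frob n (V f) $ i) 0) = frob n P" if "fps_nth f 0 = 0" for f n
    unfolding vec_eq_iff using that by (simp add: V_def type_hom.hom_power[OF type_hom_fps_nth_0])
  have vc0: "(\<chi> i. fps_nth (vconst u $ i) 0) = u" for u :: "'a alg_closure ^ 3"
    by (simp add: vec_eq_iff)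
  have den0: "fps_nth (den f) 0 \<noteq> 0" if "fps_nth f 0 = 0" for f
    unfolding den_def type_hom.hom_det3[OF type_hom_fps_nth_0] V0[OF that] vc0 using T .
  have num0: "fps_nth (num f) 0 = 0" if "fps_nth f 0 = 0" for f
    using P unfolding num_def fps_add_nth fps_mult_nth_0 type_hom.hom_det3[OF type_hom_fps_nth_0] V0[OF that] vc0
    by (simp add: dgz_num_def)
  obtain f where f: "fps_nth f 0 = 0" "\<Psi> f = f"
  proof (rule fps_fixpoint[of \<Psi>])
    show "fps_nth (\<Psi> f) 0 = 0" if "fps_nth f 0 = 0" for f
      using num0[OF that] by (simp add: \<Psi>_def)
    fix f g :: "'a alg_closure fps" and n :: nat
    assume fg: "fps_nth f 0 = 0" "fps_nth g 0 = 0" "0 < n" "fps_X ^ n dvd f - g"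
    \<comment> \<open>The columns change by powers of f - g with exponents q and q^3, both at least
      2; this gains the required order, since n is positive.\<close>
    have pow: "fps_X ^ Suc n dvd (f - g) ^ m" if "2 \<le> m" for m
    proof -
      have "(fps_X ^ n) ^ m dvd (f - g) ^ m" using fg(4) by (rule dvd_power_same)
      moreover have "Suc n \<le> n * m" using mult_le_mono2[OF that, of n] fg(3) by linarith
      then have "(fps_X :: 'a alg_closure fps) ^ Suc n dvd (fps_X ^ n) ^ m"
        unfolding power_mult[symmetric] by (rule le_imp_power_dvd)
      ultimately show ?thesis by (rule dvd_trans[rotated])
    qed
    have Vdiff: "V f $ i - V g $ i = (f - g) * fps_const (T $ i)" for i
      by (simp add: V_def algebra_simps)
    have 1: "fps_X ^ Suc n dvd frob q (V f) $ i - frob q (V g) $ i" for i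
      
    proof -
      have "frob q (V f) $ i - frob q (V g) $ i = (V f $ i - V g $ i) ^ q" by (simp only: frob_nth A.frob_diff)
      also have "\<dots> = (f - g) ^ q * fps_const (T $ i) ^ q" by (simp only: Vdiff power_mult_distrib)
      finally show ?thesis using dvd_mult2[OF pow[OF A.q_ge_2]] by (simp only:)
    qed
    have "q \<le> q ^ 3" using A.q_ge_2 by (intro self_le_power) auto
    then have "2 \<le> q ^ 3" using A.q_ge_2 by (rule order.trans[rotated])
    have 2: "fps_X ^ Suc n dvd frob (q ^ 3) (V f) $ i - frob (q ^ 3) (V g) $ i" for i
      
    proof -
      have "frob (q ^ 3) (V f) $ i - frob (q ^ 3) (V g) $ i = (V f $ i - V g $ i) ^ q ^ 3" by (simp only: frob_nth A.frob_n_diff)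
      also have "\<dots> = (f - g) ^ q ^ 3 * fps_const (T $ i) ^ q ^ 3" by (simp only: Vdiff power_mult_distrib)
      finally show ?thesis using dvd_mult2[OF pow[OF \<open>2 \<le> q ^ 3\<close>]] by (simp only:)
    qed
    have det: "fps_X ^ Suc n dvd det3 u (frob q (V f)) (frob (q ^ 3) (V f)) - det3 u (frob q (V g)) (frob (q ^ 3) (V g))" for u
      by (intro dvd_det3_diff 1 2) simp
    have nd: "fps_X ^ Suc n dvd num f - num g" unfolding num_def by (intro dvd_add_diff dvd_mult_diff det) simp
    have dd: "fps_X ^ Suc n dvd inverse (den f) - inverse (den g)"
      by (intro dvd_inverse_diff den0 fg) (simp only: den_def det)
    have "fps_X ^ Suc n dvd num f * inverse (den f) - num g * inverse (den g)" by (rule dvd_mult_diff[OF nd dd])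
    then have "fps_X ^ Suc n dvd - (num f * inverse (den f) - num g * inverse (den g))" by (simp only: dvd_minus_iff)
    then show "fps_X ^ Suc n dvd \<Psi> f - \<Psi> g" by (simp add: \<Psi>_def algebra_simps)
  qed blast
  have inv: "inverse (den f) * den f = 1" using den0[OF f(1)] by (rule inverse_mult_eq_1)
  have "f * den f = \<Psi> f * den f" by (simp only: f(2))
  also have "\<dots> = - (num f * (inverse (den f) * den f))" by (simp add: \<Psi>_def mult.assoc)
  finally have fden: "f * den f = - num f" by (simp add: inv)
  have "dgz_num q (V f) = det3 (V f) (frob q (V f)) (frob (q ^ 3) (V f))" by (simp add: dgz_num_def)
  also have "\<dots> = num f + f * den f"
  proof -
    have lin: "det3 (a + b + c) v w = det3 a v w + det3 b v w + det3 c v w" for a b c v w :: "'a alg_closure fps ^ 3"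
      by (simp add: det3_def algebra_simps)
    have sc: "det3 (s *s a) v w = s * det3 a v w" for s and a v w :: "'a alg_closure fps ^ 3"
      by (simp add: det3_def algebra_simps)
    have "det3 (V f) v w = det3 (vconst P) v w + fps_X * det3 (vconst S) v w + f * det3 (vconst T) v w" for v w
      by (simp only: V_def lin sc)
    then show ?thesis by (simp add: num_def den_def)
  qed
  finally have "dgz_num q (V f) = 0" by (simp add: fden)
  moreover have "fps_X ^ k dvd f" if "fps_X ^ k dvd num f" for k
  proof -
    have "f = - (num f * inverse (den f))" using f(2) by (simp add: \<Psi>_def)
    moreover have "fps_X ^ k dvd - (num f * inverse (den f))" using that by simp
    ultimately show ?thesis by simp
  qed
  ultimately show ?thesis using that[OF f(1)] unfolding V_def num_def by blast
qed

text \<open>At (p : 1 : 0) with p of degree two, the Dickson invariant has a simple zero in x. Put x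
  = p + s and let the parameter be the slope z/(x - p). Then e = s \<open>\<epsilon>\<close> and V =
  X s \<open>W\<close> with units \<open>\<epsilon>\<close> and \<open>W\<close>, and the equation
  V^(q-1) + e^q = 0 becomes s = -X^(q-1) W^(q-1) / \<open>\<epsilon>\<close>^q, which is
  contracting.\<close>

lemma cusp_solution:
  fixes p :: "'a::finite_field alg_closure"
  assumes q: "q = CARD('a)" and p: "p ^ q ^ 2 = p" "p ^ q \<noteq> p"
  obtains s where "fps_nth s 0 = 0" "s \<noteq> 0" "dgz q (fps_const p + s) 1 (fps_X * s) = 0"
    "dgz_den q (vector [fps_const p + s, 1, fps_X * s]) \<noteq> 0"
proof -
  interpret A: kdomain "fps_const :: 'a alg_closure \<Rightarrow> _" q
    unfolding kdomain_def kalgebra_iff using q type_hom_fps_const by blast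
  note [simp del] = A.hom_add A.hom_diff A.hom_mult A.hom_power A.hom_uminus
  define \<delta> where "\<delta> = (\<lambda>s. moore2 q (fps_const p + s) (1 :: 'a alg_closure fps))"
  have \<delta>: "\<delta> s = fps_const (p - p ^ q) + s - s ^ q" for s
  proof -
    have "\<delta> s = fps_const p + s - (fps_const p ^ q + s ^ q)"
      unfolding \<delta>_def moore2_def A.frob_add by (simp only: power_one mult_1_right)
    also have "fps_const p ^ q = fps_const (p ^ q)" by (rule fps_const_power)
    also have "fps_const p + s - (fps_const (p ^ q) + s ^ q) = fps_const p - fps_const (p ^ q) + s - s ^ q" by simp
    also have "fps_const p - fps_const (p ^ q) = fps_const (p - p ^ q)" by (rule fps_const_sub)
    finally show ?thesis .
  qed
  have \<delta>0: "fps_nth (\<delta> s) 0 = p - p ^ q" if "fps_nth s 0 = 0" for s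
    using that A.q_gt_0 unfolding \<delta> by (simp add: fps_nth_power_0)
  have pq: "p - p ^ q \<noteq> 0" using p(2) by simp
  define \<epsilon> where "\<epsilon> = (\<lambda>s. inverse (\<delta> s) * (1 - s ^ (q ^ 2 - 1)))"
  define W where "W = (\<lambda>s. fps_X ^ (q ^ 2 - 1) * s ^ (q ^ 2 - 1) - s * \<epsilon> s * fps_X ^ (q - 1) * s ^ (q - 1) + \<delta> s ^ (q - 1))"
  define \<Psi> where "\<Psi> = (\<lambda>s. - (fps_X ^ (q - 1) * (W s ^ (q - 1) * inverse (\<epsilon> s) ^ q)))"
  have q21: "0 < q ^ 2 - 1" using one_less_power[OF A.q_gt_1, of 2] by simp
  have \<epsilon>0: "fps_nth (\<epsilon> s) 0 = inverse (p - p ^ q)" if "fps_nth s 0 = 0" for s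
    using \<delta>0[OF that] that q21 by (simp add: \<epsilon>_def fps_nth_power_0)
  have W0: "fps_nth (W s) 0 = (p - p ^ q) ^ (q - 1)" if "fps_nth s 0 = 0" for s
    using \<delta>0[OF that] that q21 by (simp add: W_def fps_nth_power_0)
  obtain s where s: "fps_nth s 0 = 0" "\<Psi> s = s"
  proof (rule fps_fixpoint[of \<Psi>])
    show "fps_nth (\<Psi> s) 0 = 0" for s using A.q_gt_1 by (simp add: \<Psi>_def fps_nth_power_0)
    fix f g :: "'a alg_closure fps" and n :: nat
    assume fg: "fps_nth f 0 = 0" "fps_nth g 0 = 0" "fps_X ^ n dvd f - g"
    have \<delta>d: "fps_X ^ n dvd \<delta> f - \<delta> g"
      unfolding \<delta> by (intro dvd_add_diff dvd_diff_diff dvd_power_diff fg) simp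
    have \<epsilon>d: "fps_X ^ n dvd \<epsilon> f - \<epsilon> g"
      unfolding \<epsilon>_def using \<delta>0 fg pq
      by (intro dvd_mult_diff dvd_inverse_diff \<delta>d dvd_diff_diff dvd_power_diff) auto
    have Wd: "fps_X ^ n dvd W f - W g"
      unfolding W_def by (intro dvd_add_diff dvd_diff_diff dvd_mult_diff dvd_power_diff \<delta>d \<epsilon>d fg(3)) auto
    have "fps_X ^ n dvd inverse (\<epsilon> f) - inverse (\<epsilon> g)"
      using \<epsilon>0 fg pq by (intro dvd_inverse_diff \<epsilon>d) auto
    then have "fps_X ^ n dvd W f ^ (q - 1) * inverse (\<epsilon> f) ^ q - W g ^ (q - 1) * inverse (\<epsilon> g) ^ q"
      by (intro dvd_mult_diff dvd_power_diff Wd)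
    moreover have "fps_X dvd (fps_X :: 'a alg_closure fps) ^ (q - 1)"
      using A.q_gt_1 by (intro dvd_power) simp
    ultimately have "fps_X * fps_X ^ n dvd fps_X ^ (q - 1) *
      (W f ^ (q - 1) * inverse (\<epsilon> f) ^ q - W g ^ (q - 1) * inverse (\<epsilon> g) ^ q)"
      by (intro mult_dvd_mono)
    then have "fps_X ^ Suc n dvd - (fps_X ^ (q - 1) *
      (W f ^ (q - 1) * inverse (\<epsilon> f) ^ q - W g ^ (q - 1) * inverse (\<epsilon> g) ^ q))" by (simp only: dvd_minus_iff power_Suc)
    then show "fps_X ^ Suc n dvd \<Psi> f - \<Psi> g" by (simp add: \<Psi>_def algebra_simps)
  qed blast
  have nz: "\<delta> s \<noteq> 0" "\<epsilon> s \<noteq> 0" "W s \<noteq> 0"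
    using \<delta>0[OF s(1)] \<epsilon>0[OF s(1)] W0[OF s(1)] pq by auto
  have \<epsilon>i: "inverse (\<epsilon> s) * \<epsilon> s = 1" using \<epsilon>0[OF s(1)] pq by (intro inverse_mult_eq_1) simp
  have \<delta>i: "inverse (\<delta> s) * \<delta> s = 1" using \<delta>0[OF s(1)] pq by (intro inverse_mult_eq_1) simp
  have "inverse (\<epsilon> s) \<noteq> 0" using \<epsilon>i by (metis mult_zero_left zero_neq_one)
  then have "\<Psi> s \<noteq> 0" using nz unfolding \<Psi>_def by simp
  then have s0: "s \<noteq> 0" using s(2) by simp
  define x where "x = fps_const p + s"
  have e: "dickson q x 1 = s * \<epsilon> s"
  proof -
    have "\<delta> s * dickson q x 1 = x - x ^ q ^ 2"
      using moore2_mult_dickson[OF A.q_gt_0, of x 1] by (simp add: \<delta>_def x_def)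
    also have "\<dots> = s - s ^ q ^ 2"
      unfolding x_def A.frob_n_add by (simp add: fps_const_power p(1))
    also have "s ^ q ^ 2 = s * s ^ (q ^ 2 - 1)" using power_minus_mult[of "q ^ 2" s] by (simp add: mult.commute)
    also have "s - s * s ^ (q ^ 2 - 1) = \<delta> s * (s * \<epsilon> s)"
      using \<delta>i by (simp add: \<epsilon>_def algebra_simps)
    finally show ?thesis using nz(1) by simp
  qed
  have pw: "y ^ q = y * y ^ (q - 1)" "y ^ q ^ 2 = y * y ^ (q ^ 2 - 1)" for y :: "'a alg_closure fps"
    using power_minus_mult[of q y] power_minus_mult[of "q ^ 2" y] by (simp_all add: mult.commute)
  have V: "span_poly q x 1 (fps_X * s) = fps_X * s * W s"
    unfolding span_poly_def e pw[of "fps_X * s"] unfolding W_def \<delta>_def[symmetric] x_def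
    by (simp add: power_mult_distrib \<delta>_def algebra_simps)
  have "s * \<epsilon> s ^ q = - (fps_X ^ (q - 1) * W s ^ (q - 1))"
  proof -
    have "s * \<epsilon> s ^ q = \<Psi> s * \<epsilon> s ^ q" by (simp only: s(2))
    also have "\<dots> = - (fps_X ^ (q - 1) * W s ^ (q - 1) * (inverse (\<epsilon> s) * \<epsilon> s) ^ q)"
      unfolding \<Psi>_def power_mult_distrib by (simp only: mult_ac mult_minus_left mult_minus_right)
    finally show ?thesis by (simp add: \<epsilon>i)
  qed
  then have "s ^ (q - 1) * (s * \<epsilon> s ^ q) = s ^ (q - 1) * (- (fps_X ^ (q - 1) * W s ^ (q - 1)))" by simp
  then have F: "dgz q x 1 (fps_X * s) = 0"
    unfolding dgz_def V e power_mult_distrib pw(1)[of s] by (simp add: mult_ac)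
  have "dgz_den q (vector [x, 1, fps_X * s]) = \<delta> s * (fps_X * s * W s)"
    unfolding A.dgz_den_eq by (simp add: V) (simp add: \<delta>_def x_def)
  then have "dgz_den q (vector [x, 1, fps_X * s]) \<noteq> 0" using nz s0 by simp
  then show ?thesis using that[OF s(1) s0] F by (simp add: x_def)
qed

section \<open>The dual curve\<close>

text \<open>The determinant of u, u^(q^2), u^(q^3) divided by \<open>D2\<close>, in a closed form
  that makes sense where \<open>D2\<close> vanishes.\<close>

definition dual_at :: "nat \<Rightarrow> 'b::comm_ring_1 ^ 3 \<Rightarrow> 'b"
  where "dual_at q u = dickson q (u$1) (u$2) * span_poly q (u$1) (u$2) (u$3) ^ (q - 1) + moore2 q (u$1) (u$2) ^ (q ^ 2 - q)"

lemma (in type_hom) hom_dual_at [simp]: "h (dual_at q u) = dual_at q (\<chi> i. h (u$i))"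
  by (simp add: dual_at_def)

text \<open>The computation parallels the one for \<open>F\<close>; now the terms with z^q cancel,
  and the remaining coefficients are again minors from \<open>moore2_3\<close>.\<close>

lemma dual_at_mult_den_aux:
  fixes emb :: "'a::finite_field alg_closure \<Rightarrow> 'b::idom" and u :: "'b ^ 3"
  assumes A: "kalgebra emb q" and nz: "moore2 q (u$1) (u$2) \<noteq> 0"
  shows "dual_at q u * dgz_den q u = det3 u (frob (q ^ 2) u) (frob (q ^ 3) u)"
proof -
  interpret kalgebra emb q by fact
  define x y z where xyz: "x = u$1" "y = u$2" "z = u$3"
  define d e V where "d = moore2 q x y" "e = dickson q x y" "V = span_poly q x y z"
  define A where "A = d ^ (q ^ 2 - q)"
  define E where "E = x * y ^ q ^ 2 - x ^ q ^ 2 * y"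
  have de: "d * e = E" using moore2_mult_dickson[of q x y] by (simp add: d_e_V_def E_def)
  have q2: "q \<le> q ^ 2" using q_ge_2 by (simp add: power2_eq_square)
  have dA: "d ^ q * A = d ^ q ^ 2" using q2 by (simp add: A_def flip: power_add)
  have Vq: "V ^ q = z ^ q ^ 3 - e ^ q * z ^ q ^ 2 + A * z ^ q"
    unfolding d_e_V_def A_def by (rule span_poly_frob)
  have VV: "V ^ (q - 1) * V = V ^ q" by (rule power_minus_mult) simp
  have den: "dgz_den q u = d * V" by (simp add: dgz_den_eq d_e_V_def xyz)
  have den': "d * V = d * z ^ q ^ 2 - E * z ^ q + d ^ q * z"
    unfolding den[symmetric] unfolding d_e_V_def moore2_frob E_def unfolding moore2_def dgz_den_def det3_def
    by (simp add: xyz[symmetric] algebra_simps)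
  have "dual_at q u = e * V ^ (q - 1) + A" by (simp add: dual_at_def A_def d_e_V_def xyz)
  then have "dual_at q u * dgz_den q u = d * e * (V ^ (q - 1) * V) + A * (d * V)"
    unfolding den by (simp add: algebra_simps)
  also have "\<dots> = E * (z ^ q ^ 3 - e ^ q * z ^ q ^ 2 + A * z ^ q) + A * (d * z ^ q ^ 2 - E * z ^ q + d ^ q * z)"
    unfolding VV Vq de den' ..
  also have "\<dots> = E * z ^ q ^ 3 - (e ^ q * E - d * A) * z ^ q ^ 2 + (d ^ q * A) * z"
    by (simp add: algebra_simps)
  also have "e ^ q * E - d * A = x * y ^ q ^ 3 - x ^ q ^ 3 * y"
    using moore2_3(1)[OF A, of x y] nz by (simp add: d_e_V_def A_def E_def xyz)
  also have "d ^ q * A = x ^ q ^ 2 * y ^ q ^ 3 - x ^ q ^ 3 * y ^ q ^ 2"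
    unfolding dA using moore2_3(3)[OF A, of x y] nz by (simp add: d_e_V_def xyz)
  finally show ?thesis
    unfolding det3_def E_def by (simp add: xyz algebra_simps)
qed

context kalgebra
begin

lemma dual_at_mult_den: "dual_at q (u :: 'b ^ 3) * dgz_den q u = det3 u (frob (q ^ 2) u) (frob (q ^ 3) u)"
proof -
  interpret e: type_hom "ev3 emb u" by (rule type_hom_ev3) unfold_locales
  have "dual_at q vars3 * dgz_den q (vars3 :: 'a alg_closure poly3 ^ 3) = det3 vars3 (frob (q ^ 2) vars3) (frob (q ^ 3) vars3)"
    by (rule dual_at_mult_den_aux[OF kalgebra_const3]) (simp add: moore2_vars_neq_0 q_ge_2)
  then have "ev3 emb u (dual_at q vars3 * dgz_den q vars3) = ev3 emb u (det3 vars3 (frob (q ^ 2) vars3) (frob (q ^ 3) vars3))"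
    by (rule arg_cong)
  moreover have "(\<chi> i. ev3 emb u (frob n vars3 $ i)) = frob n u" for n
    using ev3_vars3[of u] by (simp add: vec_eq_iff)
  ultimately show ?thesis by (simp only: e.hom_mult e.hom_dual_at e.hom_dgz_at e.hom_det3 ev3_vars3)
qed

text \<open>Invariance is proved for the vector of variables, where \<open>D2\<close> can be
  cancelled, and then specialized. It is therefore available for lines with vanishing
  \<open>D2\<close>, to which it is applied.\<close>

lemma dual_at_act:
  assumes "det M \<noteq> 0"
  shows "dual_at q (act M u) = dual_at q u"
proof -
  interpret c: kalgebra "const3 :: 'a alg_closure \<Rightarrow> _" q by (rule kalgebra_const3)
  interpret e: type_hom "ev3 emb u" by (rule type_hom_ev3) unfold_locales
  define v where "v = (vars3 :: 'a alg_closure poly3 ^ 3)"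
  have nz: "const3 (to_ac (det M)) * dgz_den q v \<noteq> 0"
    using dgz_den_vars_neq_0[OF kalgebra_const3] assms by (simp add: v_def const3_def)
  have "dual_at q (c.act M v) * (const3 (to_ac (det M)) * dgz_den q v)
      = const3 (to_ac (det M)) * det3 v (frob (q ^ 2) v) (frob (q ^ 3) v)"
    using c.dual_at_mult_den[of "c.act M v"] unfolding c.dgz_den_act c.frob_act c.det3_act .
  also have "\<dots> = dual_at q v * (const3 (to_ac (det M)) * dgz_den q v)"
    unfolding c.dual_at_mult_den[symmetric] by (simp only: mult_ac)
  finally have "dual_at q (c.act M v) = dual_at q v" using nz by (metis mult_right_cancel)
  then have "ev3 emb u (dual_at q (c.act M v)) = ev3 emb u (dual_at q v)" by (rule arg_cong)
  moreover have "(\<chi> i. ev3 emb u (c.act M v $ i)) = act M u"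
    using ev3_vars3[of u] unfolding vec_eq_iff c.act_nth act_nth v_def
    by (simp only: e.hom_add e.hom_mult ev3_const3[OF type_hom_axioms] vec_lambda_beta) simp
  ultimately show ?thesis unfolding e.hom_dual_at by (simp only: v_def ev3_vars3)
qed

end

section \<open>The plane over the algebraic closure\<close>

definition rvec :: "'a::field ^ 3 \<Rightarrow> 'a alg_closure ^ 3"
  where "rvec a = (\<chi> i. to_ac (a $ i))"

lemma rvec_nth [simp]: "rvec a $ i = to_ac (a $ i)"
  by (simp add: rvec_def)

lemma rvec_eq_0_iff [simp]: "rvec a = 0 \<longleftrightarrow> a = 0"
  by (simp add: vec_eq_iff)

lemma frob_scale: "frob n (c *s u) = c ^ n *s frob n u"
  by (simp add: vec_eq_iff power_mult_distrib)

lemma det3_scale: "det3 (a *s u) (b *s v) (c *s w) = a * b * c * det3 u v w"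
  by (simp add: det3_def algebra_simps)

lemma dgz_den_scale: "dgz_den q (c *s u) = c * c ^ q * c ^ q ^ 2 * dgz_den q u"
  unfolding dgz_den_def frob_scale det3_scale ..

lemma dgz_num_scale: "dgz_num q (c *s u) = c * c ^ q * c ^ q ^ 3 * dgz_num q u"
  unfolding dgz_num_def frob_scale det3_scale ..

lemma type_hom_identity: "type_hom id"
  by unfold_locales auto

locale kplane = kdomain "id :: 'a::finite_field alg_closure \<Rightarrow> 'a alg_closure" q for q
begin

lemma to_ac_power_q [simp]: "to_ac (a :: 'a) ^ q = to_ac a" "to_ac (a :: 'a) ^ q ^ n = to_ac a"
  using emb_to_ac_power[of a] emb_to_ac_power_n[of a n] by simp_all

lemma type_hom_frob: "type_hom (\<lambda>x :: 'a alg_closure. x ^ q ^ n)"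
  by unfold_locales (auto simp: frob_n_add power_mult_distrib)

lemma dgz_frob:
  "dgz_den q (frob (q ^ n) (u :: 'a alg_closure ^ 3)) = dgz_den q u ^ q ^ n"
  "dgz_num q (frob (q ^ n) (u :: 'a alg_closure ^ 3)) = dgz_num q u ^ q ^ n"
  unfolding type_hom.hom_dgz_at[OF type_hom_frob] frob_def by simp_all

lemma obtain_frob_preimage:
  obtains w :: "'a alg_closure ^ 3" where "frob (q ^ n) w = v"
proof -
  have "\<exists>y. y ^ q ^ n = v $ i" for i by (rule nth_root_exists) simp
  then obtain w where "\<And>i. w i ^ q ^ n = v $ i" by metis
  then have "frob (q ^ n) (\<chi> i. w i) = v" by (simp add: vec_eq_iff)
  then show ?thesis by (rule that)
qed

lemma dot3_act: "dot3 c (act M u) = dot3 (act (transpose M) c) u"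
  by (simp add: dot3_def act_nth transpose_def algebra_simps)

lemma act_rvec: "act M (rvec a) = rvec (M *v a)"
  by (simp add: vec_eq_iff act_nth matrix_vector_mult_def sum_3)

lemma moore2_eq_0E:
  assumes "moore2 q x (y :: 'a alg_closure) = 0"
  obtains a b :: 'a and c where "a \<noteq> 0 \<or> b \<noteq> 0" "x = c * to_ac a" "y = c * to_ac b"
proof (cases "y = 0")
  case True
  then show ?thesis using that[of 1 0 x] by simp
next
  case False
  have "(x / y) ^ q = x / y"
    using assms False by (simp add: power_divide moore2_def frac_eq_eq)
  then obtain a :: 'a where "x / y = to_ac a" using range_to_ac[of "x / y"] q by auto
  then show ?thesis using that[of a 1 y] False by (simp add: field_simps)
qed

text \<open>\<open>D2\<close> is the Moore determinant times \<open>V\<close>. If the former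
  vanishes, the first two coordinates are proportional over the finite field. Otherwise z is a root
  of \<open>V\<close>, whose q^2 roots are exactly the combinations of x and y.\<close>

lemma rational_relation:
  fixes v :: "'a alg_closure ^ 3"
  assumes "dgz_den q v = 0"
  obtains a :: "'a ^ 3" where "a \<noteq> 0" "dot3 (rvec a) v = 0"
proof (cases "moore2 q (v$1) (v$2) = 0")
  case True
  obtain a b :: 'a and c where abc: "a \<noteq> 0 \<or> b \<noteq> 0" "v$1 = c * to_ac a" "v$2 = c * to_ac b"
    using moore2_eq_0E[OF True] .
  show ?thesis
  proof (rule that)
    show "vector [- b, a, 0] \<noteq> (0 :: 'a ^ 3)" using abc(1) by (auto simp: vec_eq_iff forall_3)
    show "dot3 (rvec (vector [- b, a, 0])) v = 0" using abc(2,3) by (simp add: dot3_def)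
  qed
next
  case False
  define x y z where xyz: "x = v$1" "y = v$2" "z = v$3"
  define P where "P = span_poly q [:x:] [:y:] [:0, 1:]"
  have poly_P: "poly P w = span_poly q x y w" for w
  proof -
    have "type_hom (\<lambda>p. poly p w)" by unfold_locales auto
    from type_hom.hom_span_poly[OF this] show ?thesis by (simp add: P_def)
  qed
  have P: "degree P = q ^ 2" "P \<noteq> 0" using degree_span_poly[OF q_ge_2, of x y] by (auto simp: P_def)
  have nz: "moore2 q x y \<noteq> 0" using False by (simp add: xyz)
  define R where "R = (\<lambda>(a, b). to_ac a * x + to_ac b * y) ` (UNIV :: ('a \<times> 'a) set)"
  have inj: "inj (\<lambda>(a :: 'a, b). to_ac a * x + to_ac b * y)"
  proof (rule injI, clarify)
    fix a b a' b' :: 'a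
    assume "to_ac a * x + to_ac b * y = to_ac a' * x + to_ac b' * y"
    then have "id (to_ac (a - a')) * x + id (to_ac (b - b')) * y = 0" by (simp add: algebra_simps)
    from comb_eq_0[OF nz, THEN iffD1, OF this] show "a = a' \<and> b = b'" by simp
  qed
  have cR: "card R = q ^ 2"
    unfolding R_def card_image[OF inj] by (simp add: card_cartesian_product q power2_eq_square flip: UNIV_Times_UNIV)
  have fR: "finite R" by (simp add: R_def)
  have "z \<in> R"
  proof (rule ccontr)
    assume "z \<notin> R"
    then have "card (insert z R) = q ^ 2 + 1" using fR cR by simp
    moreover have "card (insert z R) \<le> degree P"
    proof (rule card_roots_le[OF P(2)])
      have "span_poly q x y z = 0" using assms nz by (simp add: dgz_den_eq xyz)
      moreover have "span_poly q x y (to_ac a * x + to_ac b * y) = 0" for a b :: 'a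
        using span_poly_comb[OF nz, of a b] by simp
      ultimately show "insert z R \<subseteq> {w. poly P w = 0}" by (auto simp: poly_P R_def)
    qed
    ultimately show False using P(1) by simp
  qed
  then obtain a b :: 'a where ab: "z = to_ac a * x + to_ac b * y" by (auto simp: R_def)
  show ?thesis
  proof (rule that)
    show "vector [a, b, - 1] \<noteq> (0 :: 'a ^ 3)" by (auto simp: vec_eq_iff forall_3)
    show "dot3 (rvec (vector [a, b, - 1])) v = 0" using ab by (simp add: dot3_def xyz)
  qed
qed

text \<open>The line over the finite field that contains \<open>v\<close> is moved to z = 0.\<close>

lemma normal_form:
  fixes v :: "'a alg_closure ^ 3"
  assumes "dgz_den q v = 0"
  obtains M N :: "'a ^ 3 ^ 3" and x y where "det M \<noteq> 0" "det N \<noteq> 0" "M ** N = mat 1" "N ** M = mat 1"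
    "v = act M (vector [x, y, 0])"
proof -
  obtain a :: "'a ^ 3" where a: "a \<noteq> 0" "dot3 (rvec a) v = 0" using rational_relation[OF assms] .
  obtain B where B: "det B \<noteq> 0" "\<And>i. B $ i $ 3 = a $ i"
    by (rule obtain_matrix_third_column[OF a(1)]) blast
  define N where "N = transpose B"
  have N: "det N \<noteq> 0" using B(1) by (simp add: N_def det_transpose)
  obtain M where M: "N ** M = mat 1" "M ** N = mat 1" "det M \<noteq> 0" using obtain_inverse_matrix[OF N] .
  have "act N v $ 3 = 0" using a(2) by (simp add: act_nth N_def transpose_def B(2) dot3_def)
  then have "act N v = vector [act N v $ 1, act N v $ 2, 0]" by (intro vec3_cong) simp_all
  then have "act M (vector [act N v $ 1, act N v $ 2, 0]) = act (M ** N) v" by (simp add: act_mult)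
  also have "\<dots> = v" by (simp add: M(2))
  finally show ?thesis using that[OF M(3) N M(2,1)] by metis
qed

lemma act_moore2_eq_0:
  assumes "moore2 q x (y :: 'a alg_closure) = 0"
  obtains b c where "act M (vector [x, y, 0]) = c *s rvec b"
proof -
  obtain a b :: 'a and c where abc: "x = c * to_ac a" "y = c * to_ac b"
    using moore2_eq_0E[OF assms] .
  have "vector [x, y, 0] = c *s rvec (vector [a, b, 0])" by (rule vec3_cong) (simp_all add: abc)
  then have "act M (vector [x, y, 0]) = c *s rvec (M *v vector [a, b, 0])" by (simp add: act_scale act_rvec)
  then show ?thesis by (rule that)
qed

text \<open>A line over the finite field is stable under Frobenius, so it contains all conjugates of
  \<open>v\<close>.\<close>

lemma rational_orthogonal_dgz_den:
  assumes "b \<noteq> 0" "dot3 (rvec b) (v :: 'a alg_closure ^ 3) = 0"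
  shows "dgz_den q v = 0"
proof -
  have "dot3 (frob (q ^ n) v) (rvec b) = dot3 (rvec b) v ^ q ^ n" for n
    by (simp add: dot3_def frob_n_add power_mult_distrib mult.commute)
  then have "dot3 (frob (q ^ n) v) (rvec b) = 0" for n using assms(2) by (simp add: zero_power)
  from this[of 0] this[of 1] this[of 2] show ?thesis
    unfolding dgz_den_def using assms(1)
    by (intro det3_orthogonal[of "rvec b"]) (simp_all add: frob_def)
qed

end

section \<open>Places of the curve\<close>

lemma det3_self [simp]: "det3 u u w = 0" "det3 u w u = 0" "det3 w u u = 0"
  by (simp_all add: det3_def algebra_simps)

lemma det3_self_scale: "det3 u w (c *s u) = 0"
  by (simp add: det3_def algebra_simps)

lemma det3_swap: "det3 v u w = - det3 u v w" "det3 u w v = - det3 u v w"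
  by (simp_all add: det3_def algebra_simps)

lemma det3_comb:
  "det3 (a *s u + b *s w) x y = a * det3 u x y + b * det3 w x y"
  "det3 x (a *s u + b *s w) y = a * det3 x u y + b * det3 x w y"
  by (simp_all add: det3_def algebra_simps)

lemma type_hom_fps_to_fls: "type_hom (fps_to_fls :: 'c::comm_ring_1 fps \<Rightarrow> _)"
  by unfold_locales (auto simp: fls_times_fps_to_fls)

definition vfls :: "'c::field fps ^ 3 \<Rightarrow> 'c fls ^ 3"
  where "vfls V = (\<chi> i. fps_to_fls (V $ i))"

lemma lin_vfls: "lin l (vfls V) = fps_to_fls (dot3 (vconst l) V)"
  by (simp add: lin_def dot3_def vfls_def fls_times_fps_to_fls)

lemma dot3_branch:
  "dot3 (vconst l) (vconst P + s *s vconst S + f *s vconst T) = fps_const (dot3 l P) + s * fps_const (dot3 l S) + f * fps_const (dot3 l T)"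
  by (simp add: dot3_def algebra_simps fps_const_add[symmetric] fps_const_mult[symmetric] del: fps_const_add fps_const_mult)

lemma subdegree_fps_to_fls_divide:
  fixes f g :: "'c::field fps"
  assumes "f \<noteq> 0" "g \<noteq> 0"
  shows "fls_subdegree (fps_to_fls f / fps_to_fls g) = int (subdegree f) - int (subdegree g)"
  using assms fls_divide_subdegree[of "fps_to_fls f" "fps_to_fls g"] by (simp add: fls_subdegree_fls_to_fps)

lemma subdegree_ge_if_dvd: "fps_X ^ n dvd f \<Longrightarrow> f \<noteq> 0 \<Longrightarrow> n \<le> subdegree f" for f :: "'c::field fps"
  unfolding fps_X_power_dvd_iff by (rule subdegree_geI) auto

lemma dvd_imp_subdegree_divide:
  fixes f g :: "'c::field fps"
  assumes "fps_X ^ (subdegree g + k) dvd f" "g \<noteq> 0"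
  shows "fps_to_fls f / fps_to_fls g = 0 \<or> int k \<le> fls_subdegree (fps_to_fls f / fps_to_fls g)"
  using assms subdegree_ge_if_dvd[of "subdegree g + k" f] subdegree_fps_to_fls_divide[of f g] by (cases "f = 0") auto

lemma dgz_at_vfls:
  fixes V :: "'a::finite_field alg_closure fps ^ 3"
  assumes q: "q = CARD('a)" and V: "dgz_num q V = 0" "dgz_den q V \<noteq> 0"
  shows "dgz_at q (vfls V) = 0"
proof -
  have "kalgebra (fps_const :: 'a alg_closure \<Rightarrow> _) q"
    unfolding kalgebra_iff using q type_hom_fps_const by blast
  from kalgebra.dgz_at_mult_den[OF this, of V] V have "dgz_at q V = 0" by simp
  then have "fps_to_fls (dgz_at q V) = 0" by simp
  then show ?thesis unfolding type_hom.hom_dgz_at[OF type_hom_fps_to_fls] vfls_def .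
qed

text \<open>\<open>T\<close> off the tangent line at \<open>P\<close> makes the equation solvable
  for \<open>f\<close>, which measures how far the branch departs from the line through
  \<open>P\<close> and \<open>S\<close>. If \<open>S\<close> is on the tangent line, the order of
  \<open>f\<close> is at least two. If moreover \<open>S\<close> is the Frobenius conjugate of
  \<open>P\<close>, and \<open>P\<close> is fixed by the third power of Frobenius, it is at least
  three.\<close>

lemma branch_solution:
  fixes P S T :: "'a::finite_field alg_closure ^ 3"
  assumes q: "q = CARD('a)" and P: "dgz_num q P = 0" "dgz_den q P \<noteq> 0"
    and T: "det3 T (frob q P) (frob (q ^ 3) P) \<noteq> 0"
  obtains f where "fps_nth f 0 = 0" "dgz_at q (vfls (vconst P + fps_X *s vconst S + f *s vconst T)) = 0"
    "det3 S (frob q P) (frob (q ^ 3) P) = 0 \<Longrightarrow> fps_X ^ 2 dvd f"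
    "\<And>\<kappa>. S = frob q P \<Longrightarrow> frob (q ^ 3) P = \<kappa> *s P \<Longrightarrow> fps_X ^ 3 dvd f"
proof -
  interpret A: kalgebra "fps_const :: 'a alg_closure \<Rightarrow> _" q
    unfolding kalgebra_iff using q type_hom_fps_const by blast
  note [simp del] = A.hom_add A.hom_diff A.hom_mult A.hom_power A.hom_uminus
  define V where "V = (\<lambda>f. vconst P + fps_X *s vconst S + f *s vconst T)"
  define D where "D = (\<lambda>f u. det3 (vconst u) (frob q (V f)) (frob (q ^ 3) (V f)))"
  obtain f where f: "fps_nth f 0 = 0" "dgz_num q (V f) = 0"
    "\<And>k. fps_X ^ k dvd D f P + fps_X * D f S \<Longrightarrow> fps_X ^ k dvd f"
    unfolding V_def D_def by (rule dgz_num_solution[OF q P(1) T, of S]) blast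
  have "(\<chi> i. fps_nth (V f $ i) 0) = P" using f(1) by (simp add: vec_eq_iff V_def)
  then have "fps_nth (dgz_den q (V f)) 0 = dgz_den q P"
    by (simp only: type_hom.hom_dgz_at[OF type_hom_fps_nth_0])
  then have "dgz_den q (V f) \<noteq> 0" using P(2) by auto
  then have at: "dgz_at q (vfls (V f)) = 0" using dgz_at_vfls[OF q f(2)] by blast
  have fX: "fps_X dvd f" using f(1) fps_X_power_dvd_iff[of 1 f] by simp
  have VX: "fps_X dvd V f $ i - vconst P $ i" for i using fX by (simp add: V_def)
  have fr: "fps_X ^ q ^ n dvd frob (q ^ n) (V f) $ i - vconst (frob (q ^ n) P) $ i" for n i
  proof -
    have "frob (q ^ n) (V f) $ i - vconst (frob (q ^ n) P) $ i = (V f $ i - vconst P $ i) ^ q ^ n"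
      unfolding A.frob_n_diff by simp
    then show ?thesis using dvd_power_same[OF VX] by (simp only:)
  qed
  have fr1: "fps_X ^ q dvd frob q (V f) $ i - vconst (frob q P) $ i" for i using fr[of 1 i] by simp
  have q3: "q + 1 \<le> q ^ 3"
  proof -
    have "q + 1 \<le> q * q" using mult_le_mono2[OF A.q_ge_2, of q] A.q_ge_2 by linarith
    also have "\<dots> \<le> q * q * q" using A.q_ge_2 by simp
    finally show ?thesis by (simp add: power3_eq_cube)
  qed
  have fr3: "fps_X ^ q dvd frob (q ^ 3) (V f) $ i - vconst (frob (q ^ 3) P) $ i" for i
    using dvd_trans[OF le_imp_power_dvd fr[of 3 i]] q3 by simp
  have D: "fps_X ^ q dvd D f u" if "det3 u (frob q P) (frob (q ^ 3) P) = 0" for u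
  proof -
    have "fps_X ^ q dvd D f u - det3 (vconst u) (vconst (frob q P)) (vconst (frob (q ^ 3) P))"
      unfolding D_def by (intro dvd_det3_diff fr1 fr3) simp
    then show ?thesis using that by (simp add: det3_vconst)
  qed
  have "fps_X ^ 2 dvd f" if "det3 S (frob q P) (frob (q ^ 3) P) = 0"
  proof (rule f(3))
    have "fps_X ^ q dvd D f P + fps_X * D f S"
      using D[of P] D[of S] P(1) that by (intro dvd_add dvd_mult) (auto simp: dgz_num_def)
    then show "fps_X ^ 2 dvd D f P + fps_X * D f S"
      by (rule dvd_trans[rotated]) (intro le_imp_power_dvd A.q_ge_2)
  qed
  moreover have "fps_X ^ 3 dvd f" if S: "S = frob q P" "frob (q ^ 3) P = \<kappa> *s P" for \<kappa>
  proof (rule f(3))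
    \<comment> \<open>Up to order q^3 the third column is a multiple of \<open>P\<close>, so the
      determinant with first column \<open>P\<close> vanishes to that order. The other summand has
      order at least q + 1, and q + 1 is at least 3.\<close>
    have "fps_X ^ q ^ 3 dvd D f P - det3 (vconst P) (frob q (V f)) (vconst (frob (q ^ 3) P))"
      unfolding D_def by (intro dvd_det3_diff fr) simp_all
    moreover have "det3 (vconst P) (frob q (V f)) (vconst (frob (q ^ 3) P)) = 0"
    proof -
      have "vconst (\<kappa> *s P) = fps_const \<kappa> *s vconst P" by (simp add: vec_eq_iff)
      then show ?thesis unfolding S(2) by (simp only: det3_self_scale)
    qed
    ultimately have 1: "fps_X ^ q ^ 3 dvd D f P" by simp
    have 2: "fps_X ^ (q + 1) dvd fps_X * D f S"
      using D[of S] S(1) by (simp add: mult_dvd_mono)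
    have "fps_X ^ (q + 1) dvd D f P + fps_X * D f S"
      using dvd_trans[OF le_imp_power_dvd[OF q3] 1] 2 by (rule dvd_add)
    then show "fps_X ^ 3 dvd D f P + fps_X * D f S"
      by (rule dvd_trans[rotated]) (use A.q_ge_2 in \<open>intro le_imp_power_dvd, simp\<close>)
  qed
  ultimately show ?thesis using that[OF f(1)] at unfolding V_def by blast
qed

section \<open>Branches along a tangent line\<close>

context kplane
begin

definition fr :: "'a alg_closure ^ 3 \<Rightarrow> nat \<Rightarrow> 'a alg_closure ^ 3"
  where "fr v n = frob (q ^ n) v"

lemma fr_0 [simp]: "fr v 0 = v"
  by (simp add: fr_def vec_eq_iff)

lemma frob_fr: "frob q (fr v n) = fr v (Suc n)" "frob (q ^ m) (fr v n) = fr v (n + m)"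
  by (simp_all add: fr_def frob_frob mult.commute power_add)

lemma dgz_fr:
  "dgz_den q (fr v n) = det3 (fr v n) (fr v (n + 1)) (fr v (n + 2))"
  "dgz_num q (fr v n) = det3 (fr v n) (fr v (n + 1)) (fr v (n + 3))"
  unfolding dgz_den_def dgz_num_def frob_fr by simp_all

lemma dgz_fr_eq_0:
  "dgz_den q (fr v n) = 0 \<longleftrightarrow> dgz_den q v = 0" "dgz_num q (fr v n) = 0 \<longleftrightarrow> dgz_num q v = 0"
  unfolding fr_def dgz_frob by simp_all

text \<open>The tangent line of the curve at \<open>Q\<close> passes through the Frobenius conjugate \<open>fr Q 1\<close> of \<open>Q\<close> as well.
  If it contains \<open>v\<close>, the projection from \<open>v\<close> is unramified at \<open>fr Q 1\<close> but ramified at \<open>Q\<close>.\<close>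

context
  fixes Q v :: "'a alg_closure ^ 3"
  assumes Q: "dgz_num q Q = 0" "dgz_den q Q \<noteq> 0"
    and v: "det3 v (fr Q 1) (fr Q 3) = 0" "det3 (fr Q 1) v (fr Q 2) \<noteq> 0"
begin

text \<open>\<open>cl\<close> is the tangent line at \<open>Q\<close>, and \<open>cm\<close> joins
  \<open>v\<close> to \<open>fr Q 2\<close>. Both contain \<open>v\<close>, so their quotient is a
  coordinate of the projection from \<open>v\<close>.\<close>

abbreviation "cl \<equiv> cross3 (fr Q 1) (fr Q 3)"
abbreviation "cm \<equiv> cross3 v (fr Q 2)"

lemma det_den: "det3 (fr Q n) (fr Q (n + 1)) (fr Q (n + 2)) \<noteq> 0"
  unfolding dgz_fr[symmetric] dgz_fr_eq_0 by (rule Q)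

lemma det_num: "det3 (fr Q n) (fr Q (n + 1)) (fr Q (n + 3)) = 0"
  unfolding dgz_fr[symmetric] dgz_fr_eq_0 by (rule Q)

lemma det_213: "det3 (fr Q 2) (fr Q 1) (fr Q 3) \<noteq> 0"
  using det_den[of 1] det3_swap(1)[of "fr Q 2" "fr Q 1" "fr Q 3"] by (simp add: numeral_eq_Suc)

lemma tangent_comb:
  obtains a b where "v = a *s fr Q 1 + b *s fr Q 3" "b \<noteq> 0"
proof -
  have "cl \<noteq> 0"
  proof
    assume "cl = 0"
    then have "dot3 cl (fr Q 2) = 0" by (simp add: dot3_def)
    then show False using det_213 by (simp add: dot3_cross3)
  qed
  from det3_eq_0_comb[OF v(1) this] obtain a b where ab: "v = a *s fr Q 1 + b *s fr Q 3" .
  have "b \<noteq> 0" using v(2) unfolding ab det3_comb by auto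
  with ab show ?thesis by (rule that)
qed

text \<open>The unknown correction is put in the direction \<open>v\<close>, where \<open>cl\<close>
  and \<open>cm\<close> both vanish, so the two forms have explicit values on the branch. This
  direction is admissible: since b is nonzero, \<open>v\<close> is not on the tangent line at
  \<open>fr Q 1\<close>.\<close>

lemma first_place:
  obtains U where "dgz_at q U = 0" "lin cm U \<noteq> 0" "fls_subdegree (lin cl U / lin cm U) = 1"
proof -
  obtain a b where ab: "v = a *s fr Q 1 + b *s fr Q 3" "b \<noteq> 0" using tangent_comb .
  have "det3 v (fr Q 2) (fr Q 4) = a * det3 (fr Q 1) (fr Q 2) (fr Q 4) + b * det3 (fr Q 3) (fr Q 2) (fr Q 4)"
    unfolding ab(1) det3_comb ..
  moreover have "det3 (fr Q 1) (fr Q 2) (fr Q 4) = 0" using det_num[of 1] by (simp add: numeral_eq_Suc)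
  moreover have "det3 (fr Q 3) (fr Q 2) (fr Q 4) \<noteq> 0"
    using det_den[of 2] det3_swap(1)[of "fr Q 3" "fr Q 2" "fr Q 4"] by (simp add: numeral_eq_Suc)
  ultimately have "det3 v (fr Q 2) (fr Q 4) \<noteq> 0" using ab(2) by simp
  then have T: "det3 v (frob q (fr Q 1)) (frob (q ^ 3) (fr Q 1)) \<noteq> 0" unfolding frob_fr by (simp add: numeral_eq_Suc)
  have P: "dgz_num q (fr Q 1) = 0" "dgz_den q (fr Q 1) \<noteq> 0" using Q by (simp_all only: dgz_fr_eq_0 not_False_eq_True)
  obtain f where f: "dgz_at q (vfls (vconst (fr Q 1) + fps_X *s vconst (fr Q 2) + f *s vconst v)) = 0"
    by (rule branch_solution[OF q P T, of "fr Q 2"]) blast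
  define U where "U = vfls (vconst (fr Q 1) + fps_X *s vconst (fr Q 2) + f *s vconst v)"
  have l: "lin cl U = fps_to_fls (fps_X * fps_const (det3 (fr Q 2) (fr Q 1) (fr Q 3)))"
    unfolding U_def lin_vfls dot3_branch dot3_cross3 by (simp add: v(1)[unfolded One_nat_def])
  have m: "lin cm U = fps_to_fls (fps_const (det3 (fr Q 1) v (fr Q 2)))"
    unfolding U_def lin_vfls dot3_branch dot3_cross3 by simp
  have "fls_subdegree (lin cl U / lin cm U) = 1"
    unfolding l m using det_213 v(2) by (subst subdegree_fps_to_fls_divide) auto
  moreover have "lin cm U \<noteq> 0" unfolding m using v(2) by simp
  ultimately show ?thesis using that f unfolding U_def by blast
qed

lemma v_nonzero: "v \<noteq> 0"
  using v(2) by (auto simp: det3_def)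

text \<open>At \<open>Q\<close> the direction \<open>v\<close> is tangent, so \<open>cl\<close>
  takes a value of order at least two while \<open>cm\<close> is a unit. The line joining
  \<open>Q\<close> to \<open>fr Q 2\<close> gives the uniformizer.\<close>

lemma not_galois_tangent:
  assumes c: "det3 Q v (fr Q 2) \<noteq> 0"
  shows "\<not> ring.galois_over (function_field (DGZ_form q)) (projection_subfield (DGZ_form q) (proj_point v))"
proof -
  obtain U1 where U1: "dgz_at q U1 = 0" "lin cm U1 \<noteq> 0" "fls_subdegree (lin cl U1 / lin cm U1) = 1"
    using first_place .
  have T: "det3 (fr Q 2) (frob q Q) (frob (q ^ 3) Q) \<noteq> 0"
    using det_213 by (simp add: fr_def)
  have S: "det3 v (frob q Q) (frob (q ^ 3) Q) = 0" using v(1) by (simp add: fr_def)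
  obtain f where f: "dgz_at q (vfls (vconst Q + fps_X *s vconst v + f *s vconst (fr Q 2))) = 0" "fps_X ^ 2 dvd f"
    by (rule branch_solution[OF q Q T, of v]) (use S in blast)
  define U2 where "U2 = vfls (vconst Q + fps_X *s vconst v + f *s vconst (fr Q 2))"
  have "det3 Q (fr Q 1) (fr Q 3) = 0" using det_num[of 0] by (simp add: numeral_eq_Suc)
  then have l: "lin cl U2 = fps_to_fls (f * fps_const (det3 (fr Q 2) (fr Q 1) (fr Q 3)))"
    unfolding U2_def lin_vfls dot3_branch dot3_cross3 by (simp add: v(1)[unfolded One_nat_def])
  have m: "lin cm U2 = fps_to_fls (fps_const (det3 Q v (fr Q 2)))"
    unfolding U2_def lin_vfls dot3_branch dot3_cross3 by simp
  have n: "lin (cross3 Q (fr Q 2)) U2 = fps_to_fls (fps_X * fps_const (det3 v Q (fr Q 2)))"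
    unfolding U2_def lin_vfls dot3_branch dot3_cross3 by simp
  show ?thesis
  proof (rule not_galois[OF q U1(1) _ v_nonzero _ _ U1(2) _ U1(3)])
    show "dgz_at q U2 = 0" using f(1) by (simp add: U2_def)
    show "dot3 cl v = 0" "dot3 cm v = 0" using v(1) by (simp_all add: dot3_cross3)
    show m0: "lin cm U2 \<noteq> 0" "lin cm U2 \<noteq> 0" unfolding m using c by simp_all
    show "lin cl U2 / lin cm U2 = 0 \<or> 2 \<le> fls_subdegree (lin cl U2 / lin cm U2)"
    proof -
      have "fps_X ^ (subdegree (fps_const (det3 Q v (fr Q 2))) + 2) dvd f * fps_const (det3 (fr Q 2) (fr Q 1) (fr Q 3))"
        using dvd_mult2[OF f(2)] by (simp only: subdegree_fps_const add_0)
      from dvd_imp_subdegree_divide[OF this] c show ?thesis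
        unfolding l m by (simp only: of_nat_numeral fps_const_eq_0_iff simp_thms)
    qed
    show "fls_subdegree (lin (cross3 Q (fr Q 2)) U2 / lin cm U2) = 1"
      unfolding n m using c by (subst subdegree_fps_to_fls_divide) (auto simp: det3_swap(1)[of v Q])
  qed
qed

end

text \<open>Here \<open>Q\<close> is \<open>v\<close> itself, so the second form also vanishes at
  \<open>Q\<close> and costs one order in the quotient. The contact of order three with the tangent
  line, available for such points, makes up for it.\<close>

lemma not_galois_cubic_point:
  assumes v: "dgz_num q v = 0" "dgz_den q v \<noteq> 0" "fr v 3 = \<kappa> *s v"
  shows "\<not> ring.galois_over (function_field (DGZ_form q)) (projection_subfield (DGZ_form q) (proj_point v))"
proof -
  have 1: "det3 v (fr v 1) (fr v 3) = 0" using v(1) dgz_fr(2)[of v 0] by simp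
  have D0: "det3 v (fr v 1) (fr v 2) \<noteq> 0" using v(2) dgz_fr(1)[of v 0] by (simp add: numeral_eq_Suc)
  then have 2: "det3 (fr v 1) v (fr v 2) \<noteq> 0" using det3_swap(1)[of "fr v 1" v "fr v 2"] by simp
  note nz = det_213[OF v(1,2) 1 2]
  define l where "l = cross3 (fr v 1) (fr v 3)"
  define m where "m = cross3 v (fr v 2)"
  define n where "n = cross3 (fr v 1) (fr v 2)"
  obtain U1 where U1: "dgz_at q U1 = 0" "lin m U1 \<noteq> 0" "fls_subdegree (lin l U1 / lin m U1) = 1"
    unfolding l_def m_def by (rule first_place[OF v(1,2) 1 2])
  have T: "det3 (fr v 2) (frob q v) (frob (q ^ 3) v) \<noteq> 0" using nz by (simp add: fr_def)
  obtain f where f: "dgz_at q (vfls (vconst v + fps_X *s vconst (fr v 1) + f *s vconst (fr v 2))) = 0" "fps_X ^ 3 dvd f"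
  proof (rule branch_solution[OF q v(1,2) T, of "fr v 1"])
    fix f assume f: "dgz_at q (vfls (vconst v + fps_X *s vconst (fr v 1) + f *s vconst (fr v 2))) = 0"
      "\<And>\<kappa>. fr v 1 = frob q v \<Longrightarrow> frob (q ^ 3) v = \<kappa> *s v \<Longrightarrow> fps_X ^ 3 dvd f"
    have "fps_X ^ 3 dvd f" by (rule f(2)[of \<kappa>]) (use v(3) in \<open>simp_all add: fr_def\<close>)
    with f(1) show thesis by (rule that)
  qed
  define U2 where "U2 = vfls (vconst v + fps_X *s vconst (fr v 1) + f *s vconst (fr v 2))"
  have l2: "lin l U2 = fps_to_fls (f * fps_const (det3 (fr v 2) (fr v 1) (fr v 3)))"
    unfolding U2_def lin_vfls dot3_branch l_def dot3_cross3 using 1 by simp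
  have m2: "lin m U2 = fps_to_fls (fps_X * fps_const (det3 (fr v 1) v (fr v 2)))"
    unfolding U2_def lin_vfls dot3_branch m_def dot3_cross3 by simp
  have n2: "lin n U2 = fps_to_fls (fps_const (det3 v (fr v 1) (fr v 2)))"
    unfolding U2_def lin_vfls dot3_branch n_def dot3_cross3 by simp
  show ?thesis
  proof (rule not_galois[OF q U1(1) _ v_nonzero[OF v(1,2) 1 2] _ _ U1(2) _ U1(3)])
    show "dgz_at q U2 = 0" using f(1) by (simp add: U2_def)
    show "dot3 l v = 0" "dot3 m v = 0" using 1 by (simp_all add: dot3_cross3 l_def m_def)
    show "lin m U2 \<noteq> 0" unfolding m2 using 2 by simp
    show "lin l U2 / lin m U2 = 0 \<or> 2 \<le> fls_subdegree (lin l U2 / lin m U2)"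
    proof -
      have g: "fps_X * fps_const (det3 (fr v 1) v (fr v 2)) \<noteq> 0" using 2 by simp
      have "subdegree (fps_X * fps_const (det3 (fr v 1) v (fr v 2))) + 2 = 3" using 2 by simp
      then have "fps_X ^ (subdegree (fps_X * fps_const (det3 (fr v 1) v (fr v 2))) + 2) dvd f * fps_const (det3 (fr v 2) (fr v 1) (fr v 3))"
        using dvd_mult2[OF f(2)] by (simp only:)
      from dvd_imp_subdegree_divide[OF this g] show ?thesis
        unfolding l2 m2 by (simp only: of_nat_numeral)
    qed
    show "lin n U2 \<noteq> 0" unfolding n2 using D0 by simp
    show "fls_subdegree (lin m U2 / lin n U2) = 1"
      unfolding n2 m2 using D0 2 by (subst subdegree_fps_to_fls_divide) auto
  qed
qed

end

lemma dual_at_scale: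
  assumes "0 < q"
  shows "dual_at q (s *s u) = s ^ ((q + 1) * (q ^ 2 - q)) * dual_at q u"
proof -
  obtain m where m: "q = Suc m" using assms by (cases q) auto
  have "(q - 1) * q + q ^ 2 * (q - 1) = (q + 1) * (q ^ 2 - q)"
    unfolding m by (simp add: power2_eq_square algebra_simps)
  then have 1: "s ^ ((q - 1) * q) * (s ^ q ^ 2) ^ (q - 1) = s ^ ((q + 1) * (q ^ 2 - q))"
    by (simp flip: power_mult power_add)
  have 2: "(s ^ (q + 1)) ^ (q ^ 2 - q) = s ^ ((q + 1) * (q ^ 2 - q))" by (rule power_mult[symmetric])
  have "dual_at q (s *s u) = (s ^ ((q - 1) * q) * (s ^ q ^ 2) ^ (q - 1)) * (dickson q (u$1) (u$2) * span_poly q (u$1) (u$2) (u$3) ^ (q - 1))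
    + (s ^ (q + 1)) ^ (q ^ 2 - q) * moore2 q (u$1) (u$2) ^ (q ^ 2 - q)"
    unfolding dual_at_def vector_smult_component moore2_homogeneous dickson_homogeneous span_poly_homogeneous[OF assms] power_mult_distrib
    by (simp only: mult_ac)
  then show ?thesis unfolding 1 2 dual_at_def by (simp only: distrib_left)
qed

section \<open>Points that are not rational\<close>

text \<open>Expresses the determinants of a point that is the intersection of two lines through
  determinants of the lines.\<close>

lemma det3_cross3:
  "det3 (cross3 a b) (cross3 b c) (cross3 d e) = det3 a b c * det3 b d e"
  by (simp add: det3_def algebra_simps)

text \<open>The line joining \<open>a\<close> to \<open>c\<close> meets the line \<open>l\<close>
  only in \<open>a\<close>, because \<open>c\<close> is not on \<open>l\<close>.\<close>

lemma parallel_if_coplanar: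
  fixes a b c l :: "'c::field ^ 3"
  assumes "dot3 l a = 0" "dot3 l b = 0" "dot3 l c \<noteq> 0" "a \<noteq> 0" "det3 a b c = 0"
  obtains k where "b = k *s a"
proof -
  have "c \<noteq> 0" using assms(3) by (auto simp: dot3_def)
  have "cross3 a c \<noteq> 0"
  proof
    assume "cross3 a c = 0"
    then obtain k where k: "a = k *s c" using cross3_eq_0 \<open>c \<noteq> 0\<close> by blast
    then have "dot3 l a = k * dot3 l c" by (simp add: dot3_def algebra_simps)
    then have "k = 0" using assms by simp
    then show False using k assms(4) by simp
  qed
  moreover have "det3 b a c = 0" using assms(5) det3_swap(1)[of b a c] by simp
  ultimately obtain x y where xy: "b = x *s a + y *s c" using det3_eq_0_comb by blast
  then have "dot3 l b = x * dot3 l a + y * dot3 l c" by (simp add: dot3_def algebra_simps)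
  then have "y = 0" using assms by simp
  then show ?thesis using xy that[of x] by simp
qed

context kplane
begin

definition non_galois :: "'a alg_closure ^ 3 \<Rightarrow> bool"
  where "non_galois v \<longleftrightarrow> \<not> ring.galois_over (function_field (DGZ_form q)) (projection_subfield (DGZ_form q) (proj_point v))"

lemma fr_add: "fr (fr v m) n = fr v (m + n)"
  by (simp add: fr_def frob_frob power_add mult.commute)

lemma fr_cross3: "fr (cross3 u v) n = cross3 (fr u n) (fr v n)"
  by (rule vec3_cong) (simp_all add: fr_def frob_n_diff power_mult_distrib)

lemma fr_scale: "fr (c *s v) n = c ^ q ^ n *s fr v n"
  by (simp add: fr_def frob_scale)

lemma obtain_fr_preimage:
  obtains w where "fr w n = v"
  using obtain_frob_preimage[of n v] unfolding fr_def by blast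

text \<open>For \<open>M = 1\<close>: the function \<open>z / (x - p y)\<close> has a simple zero on a branch through \<open>(p : 1 : 0)\<close>, but a
  multiple one on a branch through \<open>(p^q : 1 : 0)\<close>, where \<open>z / (x - p^q y)\<close> is a uniformizer.\<close>

lemma non_galois_cusp:
  assumes M: "det M \<noteq> 0" "N ** M = mat 1" and p: "p ^ q ^ 2 = p" "p ^ q \<noteq> p"
    and v: "v = w *s act M (vector [p, 1, 0])" "w \<noteq> 0"
  shows "non_galois v"
proof -
  have qc: "q = CARD('a)" by (rule q)
  interpret L: kdomain "fls_const :: 'a alg_closure \<Rightarrow> _" q
    unfolding kdomain_def kalgebra_iff using qc type_hom_fls_const by blast
  note [simp del] = L.hom_add L.hom_mult L.hom_power L.hom_diff L.hom_uminus
  \<comment> \<open>Pulling linear forms back along the inverse matrix reduces all values to the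
    coordinates in which the point is (p : 1 : 0).\<close>
  define pb where "pb = act (transpose N)"
  have pb_v: "dot3 (pb c) v = w * dot3 c (vector [p, 1, 0])" for c
  proof -
    have "dot3 (pb c) v = dot3 c (act N v)" unfolding pb_def dot3_act ..
    also have "act N v = w *s act (N ** M) (vector [p, 1, 0])" unfolding v(1) act_scale act_mult ..
    finally show ?thesis by (simp add: M(2) dot3_def algebra_simps)
  qed
  have pb_lin: "lin (pb c) (L.act M W) = lin c W" for c W
  proof -
    have "lin (pb c) U = lin c (L.act N U)" for U
      unfolding lin_def pb_def act_nth L.act_nth transpose_def
      by (simp add: algebra_simps fls_plus_const[symmetric] fls_const_mult_const[symmetric] del: fls_plus_const fls_const_mult_const)
    then have "lin (pb c) (L.act M W) = lin c (L.act (N ** M) W)" unfolding L.act_mult .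
    then show ?thesis unfolding M(2) L.act_mat_1 .
  qed
  have at: "dgz_at q (L.act M (vfls (vector [x, 1, z]))) = 0"
    if "dgz q x 1 z = 0" "dgz_den q (vector [x, 1, z]) \<noteq> 0" for x z :: "'a alg_closure fps"
  proof -
    have "fps_to_fls (dgz_den q (vector [x, 1, z])) \<noteq> 0" using that(2) by simp
    then have "dgz_den q (vfls (vector [x, 1, z])) \<noteq> 0"
      unfolding type_hom.hom_dgz_at[OF type_hom_fps_to_fls] vfls_def .
    moreover have "fps_to_fls (dgz_at q (vector [x, 1, z])) = 0" using that(1) by (simp add: dgz_at_def)
    then have "dgz_at q (vfls (vector [x, 1, z])) = 0"
      unfolding type_hom.hom_dgz_at[OF type_hom_fps_to_fls] vfls_def .
    ultimately show ?thesis using L.dgz_at_act[OF M(1)] by simp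
  qed
  have qq: "(p ^ q) ^ q = p" using p(1) by (simp add: power2_eq_square power_mult)
  have "(p ^ q) ^ q ^ 2 = (p ^ q ^ 2) ^ q" by (simp add: mult.commute flip: power_mult)
  then have p': "(p ^ q) ^ q ^ 2 = p ^ q" "(p ^ q) ^ q \<noteq> p ^ q" using p qq by auto
  obtain s where s: "fps_nth s 0 = 0" "s \<noteq> 0" "dgz q (fps_const p + s) 1 (fps_X * s) = 0"
    "dgz_den q (vector [fps_const p + s, 1, fps_X * s]) \<noteq> 0" using cusp_solution[OF qc p] .
  obtain t where t: "fps_nth t 0 = 0" "t \<noteq> 0" "dgz q (fps_const (p ^ q) + t) 1 (fps_X * t) = 0"
    "dgz_den q (vector [fps_const (p ^ q) + t, 1, fps_X * t]) \<noteq> 0" using cusp_solution[OF qc p'] .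
  define U1 where "U1 = L.act M (vfls (vector [fps_const p + s, 1, fps_X * s]))"
  define U2 where "U2 = L.act M (vfls (vector [fps_const (p ^ q) + t, 1, fps_X * t]))"
  define l where "l = pb (vector [0, 0, 1])"
  define m where "m = pb (vector [1, - p, 0])"
  define n where "n = pb (vector [1, - (p ^ q), 0])"
  have l1: "lin l U1 = fps_to_fls (fps_X * s)" and m1: "lin m U1 = fps_to_fls s"
    and l2: "lin l U2 = fps_to_fls (fps_X * t)" and n2: "lin n U2 = fps_to_fls t"
    unfolding l_def m_def n_def U1_def U2_def pb_lin lin_vfls
    by (simp_all add: dot3_def del: fps_const_power fps_const_neg add: fps_const_neg[symmetric])
  have m2: "lin m U2 = fps_to_fls (fps_const (p ^ q - p) + t)"
    unfolding m_def U2_def pb_lin lin_vfls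
    by (simp add: dot3_def del: fps_const_neg fps_const_sub fps_const_power add: fps_const_neg[symmetric] fps_const_sub[symmetric])
  have g0: "fps_nth (fps_const (p ^ q - p) + t) 0 \<noteq> 0" using p(2) t(1) by simp
  then have g: "fps_const (p ^ q - p) + t \<noteq> 0" by (metis fps_zero_nth)
  show ?thesis
    unfolding non_galois_def
  proof (rule not_galois[OF qc, of U1 U2 v l m n l])
    show "dgz_at q U1 = 0" "dgz_at q U2 = 0" unfolding U1_def U2_def using at s t by blast+
    show "v \<noteq> 0"
    proof
      assume "v = 0"
      then have "dot3 (pb (vector [0, 1, 0])) v = 0" by (simp add: dot3_def)
      then show False using v(2) unfolding pb_v by (simp add: dot3_def)
    qed
    show "dot3 l v = 0" "dot3 m v = 0" unfolding l_def m_def pb_v by (simp_all add: dot3_def)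
    show "lin m U1 \<noteq> 0" "lin m U2 \<noteq> 0" "lin n U2 \<noteq> 0" unfolding m1 m2 n2 using s(2) t(2) g by (simp_all del: fps_to_fls_plus)
    show "fls_subdegree (lin l U1 / lin m U1) = 1" "fls_subdegree (lin l U2 / lin n U2) = 1"
      unfolding l1 m1 l2 n2 using s(2) t(2) by (subst subdegree_fps_to_fls_divide; simp)+
    have "fps_X ^ 1 dvd t" unfolding fps_X_power_dvd_iff using t(1) by simp
    then have "fps_X ^ (subdegree (fps_const (p ^ q - p) + t) + 2) dvd fps_X * t"
      using g0 by (simp add: subdegree_eq_0 numeral_2_eq_2)
    from dvd_imp_subdegree_divide[OF this g]
    show "lin l U2 / lin m U2 = 0 \<or> 2 \<le> fls_subdegree (lin l U2 / lin m U2)"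
      unfolding l2 m2 by (simp only: of_nat_numeral)
  qed
qed

text \<open>The tangent at \<open>Q\<close> contains \<open>fr Q 3\<close>, so a third Frobenius
  preimage \<open>Q\<close> of \<open>v\<close> has \<open>v\<close> on its tangent line. This fails
  to give two distinct points only if \<open>Q\<close> is proportional to \<open>v\<close>, which is
  the cubic case.\<close>

lemma non_galois_on_curve:
  assumes v: "dgz_num q v = 0" "dgz_den q v \<noteq> 0"
  shows "non_galois v"
proof (cases "\<exists>\<kappa>. fr v 3 = \<kappa> *s v")
  case True
  then show ?thesis using not_galois_cubic_point[OF v] unfolding non_galois_def by blast
next
  case False
  obtain Q where Qv: "fr Q 3 = v" by (rule obtain_fr_preimage)
  have Q: "dgz_num q Q = 0" "dgz_den q Q \<noteq> 0" using v unfolding Qv[symmetric] dgz_fr_eq_0 by auto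
  have D1: "det3 (fr Q 1) (fr Q 2) (fr Q 3) \<noteq> 0"
    using Q(2) dgz_fr(1)[of Q 1] dgz_fr_eq_0(1)[of Q 1] by (simp add: numeral_eq_Suc)
  have 1: "det3 v (fr Q 1) (fr Q 3) = 0" unfolding Qv by simp
  have 2: "det3 (fr Q 1) v (fr Q 2) \<noteq> 0" using D1 det3_swap(2)[of "fr Q 1" v "fr Q 2"] by (simp add: Qv)
  have "det3 Q v (fr Q 2) \<noteq> 0"
  proof
    assume 0: "det3 Q v (fr Q 2) = 0"
    have N: "det3 Q (fr Q 1) v = 0" using Q(1) dgz_fr(2)[of Q 0] by (simp add: Qv)
    have "cross3 (fr Q 1) v \<noteq> 0"
    proof
      assume "cross3 (fr Q 1) v = 0"
      then have "dot3 (cross3 (fr Q 1) v) (fr Q 2) = 0" by (simp add: dot3_def)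
      then show False using 2 det3_swap[of "fr Q 2" "fr Q 1" v] det3_swap(2)[of "fr Q 1" "fr Q 2" v] by (simp add: dot3_cross3)
    qed
    from det3_eq_0_comb[OF N this] obtain a b where ab: "Q = a *s fr Q 1 + b *s v" .
    have "det3 (a *s fr Q 1 + b *s v) v (fr Q 2) = 0" using 0 unfolding ab[symmetric] .
    then have "a = 0" using 2 unfolding det3_comb by simp
    then have Qb: "Q = b *s v" using ab by simp
    then have "fr Q 3 = b ^ q ^ 3 *s fr v 3" by (metis fr_scale)
    then have vb: "v = b ^ q ^ 3 *s fr v 3" by (simp add: Qv)
    have "b \<noteq> 0" using Qb Q(2) by (auto simp: dgz_den_def det3_def)
    then have "inverse (b ^ q ^ 3) *s v = inverse (b ^ q ^ 3) *s (b ^ q ^ 3 *s fr v 3)" "b ^ q ^ 3 \<noteq> 0"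
      using vb by simp_all
    then have "fr v 3 = inverse (b ^ q ^ 3) *s v" by (simp add: vector_smult_assoc)
    then show False using False by blast
  qed
  then show ?thesis unfolding non_galois_def by (rule not_galois_tangent[OF Q 1 2])
qed

text \<open>A tangent line \<open>l\<close> of the curve through \<open>v\<close>: the point of tangency is recovered by dualizing again.\<close>

lemma non_galois_tangent_line:
  assumes l: "dual_at q l = 0" "dgz_den q l \<noteq> 0" "dot3 l v = 0" and v: "v \<noteq> 0" "dgz_den q v = 0 \<or> dgz_num q v \<noteq> 0"
  shows "non_galois v"
proof -
  obtain e where e: "fr e 1 = l" by (rule obtain_fr_preimage)
  \<comment> \<open>Biduality: the point of tangency is the intersection of \<open>l\<close> with
    its Frobenius preimage \<open>e\<close>.\<close>
  define Q where "Q = cross3 e (fr e 1)"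
  have Qn: "fr Q n = cross3 (fr e n) (fr e (Suc n))" for n
    by (simp add: Q_def fr_cross3 fr_add)
  have D: "det3 (fr e n) (fr e (Suc n)) (fr e (Suc (Suc n))) \<noteq> 0" for n
    using l(2) dgz_fr(1)[of e n] unfolding e[symmetric] dgz_fr_eq_0 by (metis Suc_1 add_Suc_right add.right_neutral dgz_fr_eq_0(1) One_nat_def)
  have "det3 l (fr l 2) (fr l 3) = 0"
    using dual_at_mult_den[of l] l(1) by (simp add: fr_def)
  then have D': "det3 (fr e 1) (fr e 3) (fr e 4) = 0"
    unfolding e[symmetric] fr_add by (simp add: numeral_eq_Suc)
  have "dgz_den q (fr Q 0) = det3 (fr e 0) (fr e 1) (fr e 2) * det3 (fr e 1) (fr e 2) (fr e 3)"
    unfolding dgz_fr unfolding Qn by (simp add: det3_cross3 numeral_eq_Suc del: fr_0)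
  then have Q0: "dgz_den q Q \<noteq> 0" using D[of 0] D[of 1] by (simp add: numeral_eq_Suc)
  have "dgz_num q (fr Q 0) = det3 (fr e 0) (fr e 1) (fr e 2) * det3 (fr e 1) (fr e 3) (fr e 4)"
    unfolding dgz_fr unfolding Qn by (simp add: det3_cross3 numeral_eq_Suc del: fr_0)
  then have Q1: "dgz_num q Q = 0" using D' by simp
  have lQ: "dot3 l Q = 0" "dot3 l (fr Q 1) = 0"
    unfolding Q_def e[symmetric] fr_cross3 fr_add by (simp_all add: dot3_def algebra_simps)
  have lQ3: "dot3 l (fr Q 3) = 0"
    using D' by (simp add: Qn e[symmetric] dot3_def det3_def algebra_simps)
  have lQ2: "dot3 l (fr Q 2) \<noteq> 0"
    using D[of 1] by (simp add: Qn e[symmetric] dot3_def det3_def algebra_simps numeral_eq_Suc)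
  have l0: "l \<noteq> 0" and "Q \<noteq> 0" using l(2) Q0 by (auto simp: dgz_den_def det3_def)
  have sym: "dot3 a b = dot3 b a" for a b :: "'a alg_closure ^ 3" by (simp add: dot3_def mult.commute)
  \<comment> \<open>The point \<open>v\<close> either annihilates \<open>D2\<close> or lies off the
    curve, so it is not proportional to a point of the curve with nonzero \<open>D2\<close>, in
    particular not to \<open>Q\<close> or \<open>fr Q 1\<close>.\<close>
  have np: "v \<noteq> k *s Q'" if "dgz_den q Q' \<noteq> 0" "dgz_num q Q' = 0" for k Q'
  proof
    assume vk: "v = k *s Q'"
    then have "k \<noteq> 0" using v(1) by auto
    then show False using v(2) that unfolding vk dgz_den_scale dgz_num_scale by simp
  qed
  have t: "det3 Q' v (fr Q 2) \<noteq> 0" if Q': "dgz_den q Q' \<noteq> 0" "dgz_num q Q' = 0" "dot3 l Q' = 0" for Q'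
  proof
    assume "det3 Q' v (fr Q 2) = 0"
    moreover have "Q' \<noteq> 0" using Q'(1) by (auto simp: dgz_den_def det3_def)
    ultimately obtain k where "v = k *s Q'"
      using parallel_if_coplanar[OF Q'(3) l(3) lQ2] by blast
    then show False using np[OF Q'(1,2)] by blast
  qed
  have 1: "det3 v (fr Q 1) (fr Q 3) = 0"
    by (rule det3_orthogonal[OF l0]) (use l(3) lQ(2) lQ3 sym in metis)+
  have 2: "det3 (fr Q 1) v (fr Q 2) \<noteq> 0"
    by (rule t) (use Q0 Q1 lQ in \<open>simp_all add: dgz_fr_eq_0 del: One_nat_def\<close>)
  have 3: "det3 Q v (fr Q 2) \<noteq> 0" by (rule t[OF Q0 Q1 lQ(1)])
  show ?thesis unfolding non_galois_def by (rule not_galois_tangent[OF Q1 Q0 1 2 3])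
qed

end

context kplane
begin

text \<open>With the point at (p : 1 : 0), the candidates are the lines (1, -p, z). The dual
  equation is e n^(q-1) = -d^(q^2-q) for n = V(z), solvable because p outside the field with q^2
  elements makes e nonzero; d is nonzero too, which makes n and thus \<open>D2\<close> of the line
  nonzero.\<close>

lemma obtain_tangent_line_special:
  assumes M: "det M \<noteq> 0" "N ** M = mat 1" "det N \<noteq> 0" and p: "p ^ q ^ 2 \<noteq> p"
    and v: "v = w *s act M (vector [p, 1, 0])"
  obtains l where "dual_at q l = 0" "dgz_den q l \<noteq> 0" "dot3 l v = 0"
proof -
  have pq: "p ^ q \<noteq> p" using p by (auto simp: power2_eq_square power_mult)
  define d where "d = moore2 q 1 (- p)"
  have d: "d = p - p ^ q" by (simp add: d_def moore2_def frob_uminus)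
  have "d * dickson q 1 (- p) = (- p) ^ q ^ 2 - (- p)"
    unfolding d_def moore2_mult_dickson[OF q_gt_0] by simp
  also have "(- p) ^ q ^ 2 = - (p ^ q ^ 2)" using frob_n_diff[of 0 p 2] by (simp add: zero_power)
  finally have de: "d * dickson q 1 (- p) = p - p ^ q ^ 2" by simp
  have d0: "d \<noteq> 0" using pq by (simp add: d)
  have e0: "dickson q 1 (- p) \<noteq> 0" using de p by auto
  have q1: "0 < q - 1" using q_gt_1 by simp
  then obtain n where n: "n ^ (q - 1) = - (d ^ (q ^ 2 - q)) / dickson q 1 (- p)"
    using nth_root_exists[of "q - 1"] by blast
  have "n ^ (q - 1) \<noteq> 0" unfolding n using d0 e0 by simp
  then have n0: "n \<noteq> 0" using q1 by (metis zero_power)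
  define P where "P = span_poly q [:1:] [:- p:] [:0, 1:] - [:n:]"
  have degS: "degree (span_poly q [:1:] [:- p:] [:0, 1:]) = q ^ 2" by (rule degree_span_poly(1)[OF q_ge_2])
  have "degree P = q ^ 2" unfolding P_def degS[symmetric] diff_conv_add_uminus
    by (rule degree_add_eq_left) (use degS in simp)
  then obtain z where "poly P z = 0" using alg_closed_imp_poly_has_root[of P] by auto
  moreover have "poly P z = span_poly q 1 (- p) z - n"
  proof -
    have "type_hom (\<lambda>p. poly p z)" by unfold_locales auto
    from type_hom.hom_span_poly[OF this] show ?thesis by (simp add: P_def)
  qed
  ultimately have z: "span_poly q 1 (- p) z = n" by simp
  define l' where "l' = (vector [1, - p, z] :: 'a alg_closure ^ 3)"
  have "dgz_den q l' = d * n" unfolding dgz_den_eq by (simp add: l'_def z d_def)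
  then have den: "dgz_den q l' \<noteq> 0" using d0 n0 by simp
  have "dual_at q l' = dickson q 1 (- p) * n ^ (q - 1) + d ^ (q ^ 2 - q)"
    by (simp add: dual_at_def l'_def z d_def)
  also have "\<dots> = 0" unfolding n using e0 by simp
  finally have dual: "dual_at q l' = 0" .
  have dN: "det (transpose N) \<noteq> 0" using M(3) by (simp add: det_transpose)
  show ?thesis
  proof (rule that)
    show "dual_at q (act (transpose N) l') = 0" unfolding dual_at_act[OF dN] by (rule dual)
    show "dgz_den q (act (transpose N) l') \<noteq> 0" unfolding dgz_den_act using den dN by simp
    have "dot3 (act (transpose N) l') v = dot3 l' (w *s act (N ** M) (vector [p, 1, 0]))"
      unfolding v act_mult dot3_act[symmetric] act_scale ..
    then show "dot3 (act (transpose N) l') v = 0" unfolding M(2) by (simp add: dot3_def l'_def)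
  qed
qed

text \<open>A binary form of positive degree has a projective zero. If it is a constant c on the
  chart s = 1, homogeneity makes it c times the m-th power of s, which vanishes at s = 0.\<close>

lemma obtain_dual_zero:
  assumes A: "\<And>s t. s \<noteq> 0 \<or> t \<noteq> 0 \<Longrightarrow> s *s A + t *s B \<noteq> (0 :: 'a alg_closure ^ 3)"
  obtains s t where "s \<noteq> 0 \<or> t \<noteq> 0" "dual_at q (s *s A + t *s B) = 0"
proof -
  define pencil where "pencil = (\<lambda>A B :: 'a alg_closure ^ 3. dual_at q (\<chi> i. [:A $ i, B $ i:]))"
  have pencil: "poly (pencil A B) s = dual_at q (A + s *s B)" for A B s
  proof -
    have "type_hom (\<lambda>p. poly p s)" by unfold_locales auto
    from type_hom.hom_dual_at[OF this] have "poly (pencil A B) s = dual_at q (\<chi> i. poly ((\<chi> i. [:A $ i, B $ i:]) $ i) s)"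
      unfolding pencil_def .
    also have "(\<chi> i. poly ((\<chi> i. [:A $ i, B $ i:]) $ i) s) = A + s *s B" by (simp add: vec_eq_iff)
    finally show ?thesis .
  qed
  show ?thesis
  proof (cases "degree (pencil A B) = 0")
    case False
    then obtain s where "poly (pencil A B) s = 0" using alg_closed_imp_poly_has_root by blast
    then show ?thesis using that[of 1 s] by (simp add: pencil)
  next
    case True
    then obtain c where c: "pencil A B = [:c:]" by (rule degree_eq_zeroE)
    define m where "m = (q + 1) * (q ^ 2 - q)"
    have "q < q ^ 2" using power_strict_increasing[of 1 2 q] q_gt_1 by simp
    then have m: "0 < m" by (simp add: m_def)
    have root: "poly (pencil B A - monom c m) s = 0" if "s \<in> UNIV - {0}" for s
    proof -
      have s: "s \<noteq> 0" using that by simp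
      then have "B + s *s A = s *s (A + inverse s *s B)" by (simp add: vec_eq_iff field_simps)
      then have "dual_at q (B + s *s A) = s ^ m * dual_at q (A + inverse s *s B)"
        unfolding m_def by (simp only: dual_at_scale[OF q_gt_0])
      also have "dual_at q (A + inverse s *s B) = c" unfolding pencil[symmetric] c by simp
      finally show ?thesis by (simp add: pencil poly_monom mult.commute)
    qed
    have "infinite (UNIV - {0 :: 'a alg_closure})" by (simp add: infinite_alg_closed)
    then have "pencil B A - monom c m = 0" by (rule poly_eq_0_if_infinite) (rule root)
    then have "poly (pencil B A) 0 = poly (monom c m) 0" by simp
    then have "dual_at q B = 0" unfolding pencil using m by (simp add: poly_monom zero_power)
    then show ?thesis using that[of 0 1] by simp
  qed
qed

text \<open>The pencil of lines through \<open>v\<close> contains a zero of the dual form. Were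
  \<open>D2\<close> to vanish on that line, the dual form in normal form would be a power of the
  Moore determinant and the line would be defined over the finite field, which is impossible for a
  line through \<open>v\<close>.\<close>

lemma obtain_tangent_line_general:
  fixes v :: "'a alg_closure ^ 3"
  assumes v: "dgz_den q v \<noteq> 0"
  obtains l where "dual_at q l = 0" "dgz_den q l \<noteq> 0" "dot3 l v = 0"
proof -
  define A where "A = cross3 v (fr v 1)"
  define B where "B = cross3 v (fr v 2)"
  have D: "det3 v (fr v 1) (fr v 2) \<noteq> 0" using v dgz_fr(1)[of v 0] by (simp add: numeral_eq_Suc)
  have lin: "dot3 (s *s A + t *s B) u = s * dot3 A u + t * dot3 B u" for s t u
    by (simp add: dot3_def algebra_simps)
  have nz: "s *s A + t *s B \<noteq> 0" if "s \<noteq> 0 \<or> t \<noteq> 0" for s t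
  proof
    assume "s *s A + t *s B = 0"
    then have z: "dot3 (s *s A + t *s B) u = 0" for u by (simp add: dot3_def)
    have "dot3 A (fr v 1) = 0" "dot3 B (fr v 2) = 0" by (simp_all add: A_def B_def dot3_cross3)
    then have "s * dot3 A (fr v 2) = 0" "t * dot3 B (fr v 1) = 0"
      using z[of "fr v 2"] z[of "fr v 1"] unfolding lin by simp_all
    moreover have "dot3 B (fr v 1) \<noteq> 0"
      using D det3_swap(1)[of "fr v 1" v "fr v 2"] by (simp add: B_def dot3_cross3)
    moreover have "dot3 A (fr v 2) \<noteq> 0"
      using D det3_swap(1)[of "fr v 2" v "fr v 1"] det3_swap(2)[of v "fr v 2" "fr v 1"] by (simp add: A_def dot3_cross3)
    ultimately show False using that by simp
  qed
  obtain s t where st: "s \<noteq> 0 \<or> t \<noteq> 0" "dual_at q (s *s A + t *s B) = 0" using obtain_dual_zero[OF nz] .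
  define l where "l = s *s A + t *s B"
  have lv: "dot3 l v = 0" unfolding l_def lin by (simp add: A_def B_def dot3_cross3)
  have "dgz_den q l \<noteq> 0"
  proof
    assume "dgz_den q l = 0"
    from normal_form[OF this] obtain M x y where M: "det M \<noteq> 0" "l = act M (vector [x, y, 0])" by metis
    have "dual_at q (vector [x, y, 0]) = 0"
      using st(2) unfolding l_def[symmetric] M(2) dual_at_act[OF M(1)] .
    moreover have "0 < q - 1" using q_gt_1 by simp
    ultimately have "moore2 q x y ^ (q ^ 2 - q) = 0"
      by (simp add: dual_at_def span_poly_def zero_power)
    then have "moore2 q x y = 0" by simp
    from act_moore2_eq_0[OF this, of M] obtain b c where bc: "l = c *s rvec b" unfolding M(2) by blast
    have "l \<noteq> 0" unfolding l_def by (rule nz[OF st(1)])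
    then have "c \<noteq> 0" "b \<noteq> 0" using bc by auto
    moreover have "c * dot3 (rvec b) v = 0" using lv unfolding bc by (simp add: dot3_def algebra_simps)
    ultimately have "dot3 (rvec b) v = 0" by simp
    then show False using rational_orthogonal_dgz_den[OF \<open>b \<noteq> 0\<close>] v by blast
  qed
  then show ?thesis using that st(2) lv unfolding l_def by blast
qed

text \<open>A point on a line over the finite field has a tangent line of the required kind unless p
  has degree two, where the Dickson invariant vanishes; then the branches on the rational line
  itself are used. Away from these lines, points of the curve and points off it are
  distinguished.\<close>

lemma non_galois_irrational:
  assumes v: "\<And>b c. v \<noteq> c *s rvec b"
  shows "non_galois v"
proof -
  have v0: "v \<noteq> 0" using v[of 0 0] by simp
  show ?thesis
  proof (cases "dgz_den q v = 0")
    case True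
    obtain M N x y where M: "det M \<noteq> 0" "det N \<noteq> 0" "M ** N = mat 1" "N ** M = mat 1"
      "v = act M (vector [x, y, 0])" using normal_form[OF True] .
    have xy: "moore2 q x y \<noteq> 0"
    proof
      assume "moore2 q x y = 0"
      from act_moore2_eq_0[OF this, of M] show False using v unfolding M(5) by metis
    qed
    then have y: "y \<noteq> 0" by (auto simp: moore2_def)
    define p where "p = x / y"
    have "vector [x, y, 0] = y *s (vector [p, 1, 0] :: 'a alg_closure ^ 3)" using y by (intro vec3_cong) (simp_all add: p_def)
    then have vp: "v = y *s act M (vector [p, 1, 0])" unfolding M(5) act_scale[symmetric] by simp
    have pq: "p ^ q \<noteq> p"
    proof
      assume "p ^ q = p"
      then have "x * y ^ q = x ^ q * y" using y by (simp add: p_def power_divide frac_eq_eq mult.commute)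
      then show False using xy by (simp add: moore2_def)
    qed
    show ?thesis
    proof (cases "p ^ q ^ 2 = p")
      case p: True
      show ?thesis by (rule non_galois_cusp[OF M(1,4) p pq vp y])
    next
      case p: False
      obtain l where "dual_at q l = 0" "dgz_den q l \<noteq> 0" "dot3 l v = 0"
        using obtain_tangent_line_special[OF M(1,4,2) p vp] .
      then show ?thesis using non_galois_tangent_line v0 True by blast
    qed
  next
    case False
    show ?thesis
    proof (cases "dgz_num q v = 0")
      case True
      show ?thesis by (rule non_galois_on_curve[OF True False])
    next
      case num: False
      obtain l where "dual_at q l = 0" "dgz_den q l \<noteq> 0" "dot3 l v = 0"
        using obtain_tangent_line_general[OF False] .
      then show ?thesis using non_galois_tangent_line v0 num by blast
    qed
  qed
qed

end

section \<open>The Galois points\<close>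

lemma proj_point_scale: "c \<noteq> 0 \<Longrightarrow> proj_point (c *s v) = proj_point v"
proof -
  have sub: "proj_point (c *s v) \<subseteq> proj_point v" if "c \<noteq> 0" for c :: 'a and v
    using that by (auto simp: proj_point_def vector_smult_assoc)
  assume "c \<noteq> 0"
  then show ?thesis using sub[of c v] sub[of "inverse c" "c *s v"] by (auto simp: vector_smult_assoc)
qed

lemma proj_point_eqE:
  assumes "proj_point u = proj_point v"
  obtains c where "c \<noteq> 0" "u = c *s v"
proof -
  have "u \<in> proj_point u" by (auto simp: proj_point_def intro!: exI[of _ 1])
  then show ?thesis using that unfolding assms by (auto simp: proj_point_def)
qed

text \<open>Each rational point has a unique representative whose leading nonzero coordinate is 1;
  the three summands count them by the position of that coordinate.\<close>

lemma card_rational_points: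
  "card (rational_points :: ('a::finite_field alg_closure ^ 3) set set) = CARD('a) ^ 2 + CARD('a) + 1"
proof -
  define S1 where "S1 = (\<lambda>(b, c). vector [1, b, c] :: 'a ^ 3) ` UNIV"
  define S2 where "S2 = (\<lambda>c. vector [0, 1, c] :: 'a ^ 3) ` UNIV"
  define S3 where "S3 = {vector [0, 0, 1] :: 'a ^ 3}"
  define S where "S = S1 \<union> (S2 \<union> S3)"
  have v3: "(vector [a, b, c] :: 'a ^ 3) = vector [a', b', c'] \<longleftrightarrow> a = a' \<and> b = b' \<and> c = c'" for a b c a' b' c'
    by (auto simp: vec_eq_iff forall_3)
  have "card S1 = CARD('a) ^ 2"
    unfolding S1_def by (subst card_image) (auto simp: inj_on_def v3 card_cartesian_product power2_eq_square simp flip: UNIV_Times_UNIV)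
  moreover have "card S2 = CARD('a)" unfolding S2_def by (subst card_image) (auto simp: inj_on_def v3)
  moreover have "S1 \<inter> (S2 \<union> S3) = {}" "S2 \<inter> S3 = {}" by (auto simp: S1_def S2_def S3_def v3)
  ultimately have cS: "card S = CARD('a) ^ 2 + CARD('a) + 1"
    unfolding S_def by (simp add: card_Un_disjoint S1_def S2_def S3_def)
  have "inj_on (\<lambda>a. proj_point (rvec a)) S"
  proof (rule inj_onI)
    fix a b assume ab: "a \<in> S" "b \<in> S" "proj_point (rvec a) = proj_point (rvec b)"
    then obtain c where c: "c \<noteq> 0" "rvec a = c *s rvec b" using proj_point_eqE by blast
    then have c': "to_ac (a$i) = c * to_ac (b$i)" for i by (metis rvec_nth vector_smult_component)
    from ab(1,2) c'[of 1] c'[of 2] c'[of 3] c(1) have "c = 1"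
      by (auto simp: S_def S1_def S2_def S3_def)
    then show "a = b" using c' by (simp add: vec_eq_iff)
  qed
  moreover have "(\<lambda>a. proj_point (rvec a)) ` S = rational_points"
  proof
    have "(0 :: 'a ^ 3) \<notin> S" by (auto simp: S_def S1_def S2_def S3_def vec_eq_iff forall_3 dest: sym)
    then show "(\<lambda>a. proj_point (rvec a)) ` S \<subseteq> rational_points"
      unfolding rational_points_def rvec_def by blast
    show "rational_points \<subseteq> (\<lambda>a. proj_point (rvec a)) ` S"
    proof
      fix P :: "('a alg_closure ^ 3) set" assume "P \<in> rational_points"
      then obtain a :: "'a ^ 3" where a: "a \<noteq> 0" "P = proj_point (rvec a)" by (auto simp: rational_points_def rvec_def)
      have "\<exists>c b. c \<noteq> 0 \<and> b \<in> S \<and> a = c *s b"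
      proof -
        consider "a$1 \<noteq> 0" | "a$1 = 0" "a$2 \<noteq> 0" | "a$1 = 0" "a$2 = 0" "a$3 \<noteq> 0"
          using a(1) by (auto simp: vec_eq_iff forall_3)
        then show ?thesis
        proof cases
          case 1
          then have "a = a$1 *s vector [1, a$2 / a$1, a$3 / a$1]" by (intro vec3_cong) simp_all
          moreover have "vector [1, a$2 / a$1, a$3 / a$1] \<in> S" by (auto simp: S_def S1_def v3)
          ultimately show ?thesis using 1 by blast
        next
          case 2
          then have "a = a$2 *s vector [0, 1, a$3 / a$2]" by (intro vec3_cong) simp_all
          moreover have "vector [0, 1, a$3 / a$2] \<in> S" by (auto simp: S_def S2_def v3)
          ultimately show ?thesis using 2 by blast
        next
          case 3
          then have "a = a$3 *s vector [0, 0, 1]" by (intro vec3_cong) simp_all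
          moreover have "vector [0, 0, 1] \<in> S" by (simp add: S_def S3_def)
          ultimately show ?thesis using 3 by blast
        qed
      qed
      then obtain c b where cb: "c \<noteq> 0" "b \<in> S" "a = c *s b" by blast
      have "rvec a = to_ac c *s rvec b" by (simp add: vec_eq_iff cb(3))
      then have "P = proj_point (rvec b)" using a(2) cb(1) proj_point_scale[of "to_ac c"] by simp
      then show "P \<in> (\<lambda>a. proj_point (rvec a)) ` S" using cb(2) by blast
    qed
  qed
  ultimately show ?thesis using cS card_image by metis
qed

theorem theorem1:
  fixes F :: "'a::finite_field alg_closure poly3"
    and q :: nat
  assumes "q = CARD('a)"
    and "F = DGZ_form q"
  shows "galois_points F = rational_points \<and> card (galois_points F) = q ^ 2 + q + 1"
proof -
  have plane: "kplane TYPE('a) q"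
    unfolding kplane_def kdomain_def kalgebra_iff using assms(1) type_hom_identity by blast
  have "galois_points F = rational_points"
  proof
    show "galois_points F \<subseteq> rational_points"
    proof
      fix P assume P: "P \<in> galois_points F"
      then obtain v where v: "P = proj_point v" "v \<noteq> 0" by (auto simp: galois_points_def proj_plane_def)
      have "\<not> kplane.non_galois q v"
        using P unfolding galois_points_def kplane.non_galois_def[OF plane] v(1) assms(2) by blast
      then obtain b c where bc: "v = c *s rvec b" using kplane.non_galois_irrational[OF plane, of v] by blast
      then have "c \<noteq> 0" "b \<noteq> 0" using v(2) by auto
      then have "P = proj_point (rvec b)" unfolding v(1) bc by (simp add: proj_point_scale)
      then show "P \<in> rational_points" unfolding rational_points_def rvec_def using \<open>b \<noteq> 0\<close> by blast
    qed
    show "rational_points \<subseteq> galois_points F"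
    proof
      fix P :: "('a alg_closure ^ 3) set" assume "P \<in> rational_points"
      then obtain a :: "'a ^ 3" where a: "a \<noteq> 0" "P = proj_point (rvec a)" by (auto simp: rational_points_def rvec_def)
      have "P \<in> proj_plane" unfolding proj_plane_def a(2) using a(1) rvec_eq_0_iff by blast
      then show "P \<in> galois_points F"
        unfolding galois_points_def assms(2) a(2) rvec_def using galois_rational[OF assms(1) a(1)] by blast
    qed
  qed
  then show ?thesis using card_rational_points[where ?'a = 'a] assms(1) by simp
qed

end
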